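(* Let $n\geq 3$ be odd, let $S_C$ be the polynomial algebra $\mathbb{K}[z_1,\dots,z_{n-1},\Omega]$ and $T_C$ the Laurent polynomial algebra $\mathbb{K}[z_1^{\pm1},\dots,z_{n-1}^{\pm1},\Omega^{\pm1}]$. (i) $S_C$ is a Poisson subalgebra of $F_n^C$ and the Poisson brackets on $S_C$ and $T_C$ are the log-canonical Poisson brackets determined by $\Lambda_n$ (with respect to the generators $z_1,\dots,z_{n-1},\Omega$). (ii) $T_C=U[\Omega^{\pm1}]$, where $U=\mathbb{K}[z_1^{\pm1},z_2^{\pm1},\dots,z_{n-1}^{\pm1}]$ is a Poisson simple subalgebra of $T_C$ and $\Omega$ is Poisson central. (iii) The non-zero proper Poisson prime ideals of $F_n^C$ are the ideals $(\Omega-\lambda)F_n$, $\lambda\in\mathbb{K}$, and the two ideals $M_1$ and $M_{-1}$. (iv) For $\mu\in\mathbb{K}$, the Poisson algebra $F_n^C/(\Omega-\mu)F_n^C$ is Poisson simple if and only if $\mu\neq\pm2$.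
   Context: $\mathbb{K}$ is an algebraically closed field of characteristic $0$. $F_n=\mathbb{K}[x_1,\dots,x_n]$. For odd $n\geq3$, $F_n^C$ is $F_n$ with the Poisson bracket given by: $\{x_i,x_{i+1}\}=x_ix_{i+1}-1$ for $1\leq i\leq n-1$; $\{x_n,x_1\}=x_nx_1-1$; $\{x_i,x_j\}=x_ix_j$ for $i\geq1$, $i+1<j\leq n$, $j-i$ odd; $\{x_i,x_j\}=-x_ix_j$ for $i\geq1$, $i+1<j\leq n$, $j-i$ even, $(i,j)\neq(1,n)$. $\theta$ is the Poisson automorphism of $F_n^C$ with $\theta(x_i)=x_{i+1}$, subscripts modulo $n$ in $\{1,\dots,n\}$. Define $z_{-1}=0$, $z_0=1$, $z_{i+1}=z_ix_{i+1}-z_{i-1}$ for $0\leq i\leq n-2$, and $\Omega=z_{n-1}x_n-z_{n-2}-\theta(z_{n-2})\in F_n$; the elements $z_1,\dots,z_{n-1},\Omega$ are algebraically independent and $T_C$ carries the bracket extended from $S_C$. $\Lambda_n=(\lambda_{ij})$ is the $n\times n$ skew-symmetric matrix with, for $j>i$, $\lambda_{ij}=1$ if $j$ is even and $i$ is odd, and $\lambda_{ij}=0$ otherwise. The log-canonical Poisson bracket determined by $\Lambda_n$ on a (Laurent) polynomial algebra in $y_1,\dots,y_n$ is the one with $\{y_i,y_j\}=\lambda_{ij}y_iy_j$. For $\lambda=\pm1$, $M_\lambda$ is the kernel of the composite $\mathbb{K}$-algebra homomorphism $F_n\rightarrow F_{n-2}\rightarrow F_{n-2}/(z_{n-2}-\lambda)F_{n-2}$,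 where $F_{n-2}=\mathbb{K}[x_1,\dots,x_{n-2}]$, the first map sends $x_i\mapsto x_i$ for $1\leq i\leq n-2$, $x_{n-1}\mapsto\lambda z_{n-3}$, $x_n\mapsto\lambda\theta(z_{n-3})$, and the second is the canonical epimorphism. Equivalently $M_\lambda$ is the ideal of $F_n$ generated by $z_{n-2}-\lambda$, $x_{n-1}-\lambda z_{n-3}$ and $x_n-\lambda\theta(z_{n-3})$. A Poisson ideal of a Poisson algebra $A$ is an ideal $I$ with $\{I,A\}\subseteq I$; a Poisson prime ideal is a Poisson ideal that is prime; $A$ is Poisson simple if its only Poisson ideals are $0$ and $A\neq0$; $a$ is Poisson central if $\{a,A\}=0$. *)

theory Defs
  imports
    "HOL-Library.Poly_Mapping"
    "HOL-Algebra.QuotRing"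
    "HOL-Algebra.Generated_Rings"
    "HOL-Computational_Algebra.Polynomial"
    "HOL-Computational_Algebra.Fraction_Field"
begin

section \<open>Poisson brackets on commutative rings\<close>

record 'a poisson_ring = "'a ring" +
  bracket :: "'a \<Rightarrow> 'a \<Rightarrow> 'a"

definition with_bracket :: "'a ring \<Rightarrow> ('a \<Rightarrow> 'a \<Rightarrow> 'a) \<Rightarrow> 'a poisson_ring" where
  "with_bracket R b = ring.extend R \<lparr>bracket = b\<rparr>"

text \<open>The set \<open>k\<close> is the copy of the base field inside \<open>A\<close>, so that a subring is a subalgebra
  iff it contains \<open>k\<close>.\<close>

definition poisson_subalgebra :: "'a set \<Rightarrow> 'a set \<Rightarrow> 'a poisson_ring \<Rightarrow> bool" where
  "poisson_subalgebra k S A \<longleftrightarrow>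
     subring S A \<and> k \<subseteq> S \<and> (\<forall>a\<in>S. \<forall>b\<in>S. bracket A a b \<in> S)"

definition poisson_ideal :: "'a set \<Rightarrow> 'a poisson_ring \<Rightarrow> bool" where
  "poisson_ideal I A \<longleftrightarrow> ideal I A \<and> (\<forall>a\<in>I. \<forall>b\<in>carrier A. bracket A a b \<in> I)"

definition poisson_prime_ideal :: "'a set \<Rightarrow> 'a poisson_ring \<Rightarrow> bool" where
  "poisson_prime_ideal P A \<longleftrightarrow> poisson_ideal P A \<and> primeideal P A"

definition poisson_simple :: "'a poisson_ring \<Rightarrow> bool" where
  "poisson_simple A \<longleftrightarrow>
     carrier A \<noteq> {\<zero>\<^bsub>A\<^esub>} \<and> (\<forall>I. poisson_ideal I A \<longrightarrow> I = {\<zero>\<^bsub>A\<^esub>} \<or> I = carrier A)"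

definition poisson_central :: "'a \<Rightarrow> 'a poisson_ring \<Rightarrow> bool" where
  "poisson_central a A \<longleftrightarrow> a \<in> carrier A \<and> (\<forall>b\<in>carrier A. bracket A a b = \<zero>\<^bsub>A\<^esub>)"

text \<open>The bracket induced on cosets, in the style of \<^const>\<open>rcoset_mult\<close>; it is well defined when
  \<open>I\<close> is a Poisson ideal.\<close>

definition poisson_quot :: "'a poisson_ring \<Rightarrow> 'a set \<Rightarrow> 'a set poisson_ring" where
  "poisson_quot A I =
     with_bracket (A Quot I) (\<lambda>X Y. \<Union>a\<in>X. \<Union>b\<in>Y. I +>\<^bsub>A\<^esub> bracket A a b)"


section \<open>Polynomials and Laurent polynomials\<close>

text \<open>Polynomials in the variables \<open>x\<^sub>0, x\<^sub>1, \<dots>\<close>; the ring \<open>F n\<close> below consists of those that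
  involve only \<open>x\<^sub>1, \<dots>, x\<^sub>n\<close>.\<close>

type_synonym 'k mpoly = "(nat \<Rightarrow>\<^sub>0 nat) \<Rightarrow>\<^sub>0 'k"
type_synonym 'k lpoly = "(nat \<Rightarrow>\<^sub>0 int) \<Rightarrow>\<^sub>0 'k"

definition pvar :: "nat \<Rightarrow> 'k::field mpoly" where
  "pvar i = Poly_Mapping.single (Poly_Mapping.single i 1) 1"

definition pconst :: "'k::field \<Rightarrow> 'k mpoly" where
  "pconst c = Poly_Mapping.single 0 c"

definition poly_carrier :: "nat \<Rightarrow> 'k::field mpoly set" where
  "poly_carrier n = {p. \<forall>m\<in>Poly_Mapping.keys p. Poly_Mapping.keys m \<subseteq> {1..n}}"

definition laurent_carrier :: "nat \<Rightarrow> 'k::field lpoly set" where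
  "laurent_carrier n = {p. \<forall>m\<in>Poly_Mapping.keys p. Poly_Mapping.keys m \<subseteq> {1..n}}"

definition F :: "nat \<Rightarrow> 'k::field mpoly ring" where
  "F n = \<lparr>carrier = poly_carrier n, monoid.mult = (*), one = 1, zero = 0, add = (+)\<rparr>"

text \<open>Evaluation at \<open>y\<close> of (Laurent) polynomials, where \<open>\<iota>\<close> embeds the coefficients.\<close>

definition peval :: "('k::field \<Rightarrow> 'a::comm_ring_1) \<Rightarrow> (nat \<Rightarrow> 'a) \<Rightarrow> 'k mpoly \<Rightarrow> 'a" where
  "peval \<iota> y p = (\<Sum>m\<in>Poly_Mapping.keys p. \<iota> (Poly_Mapping.lookup p m) *
      (\<Prod>i\<in>Poly_Mapping.keys m. y i ^ Poly_Mapping.lookup m i))"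

definition leval :: "('k::field \<Rightarrow> 'a::field) \<Rightarrow> (nat \<Rightarrow> 'a) \<Rightarrow> 'k lpoly \<Rightarrow> 'a" where
  "leval \<iota> y p = (\<Sum>m\<in>Poly_Mapping.keys p. \<iota> (Poly_Mapping.lookup p m) *
      (\<Prod>i\<in>Poly_Mapping.keys m. y i powi Poly_Mapping.lookup m i))"

text \<open>\<open>S\<close> is the polynomial algebra, resp. \<open>T\<close> is the Laurent polynomial algebra, in
  \<open>y\<^sub>1, \<dots>, y\<^sub>n\<close>: surjectivity says that it is generated by these elements, injectivity
  that they are algebraically independent.\<close>

definition polynomial_algebra ::
    "('k::field \<Rightarrow> 'a::comm_ring_1) \<Rightarrow> nat \<Rightarrow> (nat \<Rightarrow> 'a) \<Rightarrow> 'a set \<Rightarrow> bool" where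
  "polynomial_algebra \<iota> n y S \<longleftrightarrow> bij_betw (peval \<iota> y) (poly_carrier n) S"

definition laurent_algebra ::
    "('k::field \<Rightarrow> 'a::field) \<Rightarrow> nat \<Rightarrow> (nat \<Rightarrow> 'a) \<Rightarrow> 'a set \<Rightarrow> bool" where
  "laurent_algebra \<iota> n y T \<longleftrightarrow> bij_betw (leval \<iota> y) (laurent_carrier n) T"

text \<open>\<open>T = U[w\<^sup>\<plusminus>\<^sup>1]\<close>: every element of \<open>T\<close> is uniquely a finite sum \<open>\<Sum> a\<^sub>i w\<^sup>i\<close>
  (\<open>i\<close> an integer, \<open>a\<^sub>i \<in> U\<close>), and all such sums are in \<open>T\<close>.\<close>

definition laurent_extension :: "'a::field set \<Rightarrow> 'a \<Rightarrow> 'a set \<Rightarrow> bool" where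
  "laurent_extension U w T \<longleftrightarrow>
     bij_betw (\<lambda>a::int \<Rightarrow> 'a. \<Sum>i | a i \<noteq> 0. a i * w powi i)
       {a. finite {i. a i \<noteq> 0} \<and> range a \<subseteq> U} T"


section \<open>Partial derivatives\<close>

definition pderivative :: "nat \<Rightarrow> 'k::field mpoly \<Rightarrow> 'k mpoly" where
  "pderivative i p = (\<Sum>m\<in>Poly_Mapping.keys p.
     Poly_Mapping.single (m - Poly_Mapping.single i 1)
       (of_nat (Poly_Mapping.lookup m i) * Poly_Mapping.lookup p m))"

lemma pderivative_superset:
  assumes "finite M" "Poly_Mapping.keys p \<subseteq> M"
  shows "pderivative i p = (\<Sum>m\<in>M. Poly_Mapping.single (m - Poly_Mapping.single i 1)
           (of_nat (Poly_Mapping.lookup m i) * Poly_Mapping.lookup p m))"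
  unfolding pderivative_def
  by (rule sum.mono_neutral_left) (use assms in \<open>auto simp: in_keys_iff\<close>)

lemma pderivative_add: "pderivative i (p + q) = pderivative i p + pderivative i q"
proof -
  let ?M = "Poly_Mapping.keys p \<union> Poly_Mapping.keys q"
  have "Poly_Mapping.keys (p + q) \<subseteq> ?M" by (rule Poly_Mapping.keys_add)
  then show ?thesis
    by (simp add: pderivative_superset[of ?M] lookup_add distrib_left single_add sum.distrib)
qed

lemma pderivative_0 [simp]: "pderivative i 0 = 0"
  by (simp add: pderivative_def)

lemma pderivative_single:
  "pderivative i (Poly_Mapping.single m c) =
     Poly_Mapping.single (m - Poly_Mapping.single i 1) (of_nat (Poly_Mapping.lookup m i) * c)"
  by (subst pderivative_superset[of "{m}"]) (auto simp: lookup_single)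

lemma mpoly_induct [case_names single add]:
  fixes p :: "'k::field mpoly"
  assumes "\<And>m c. P (Poly_Mapping.single m c)" "\<And>p q. P p \<Longrightarrow> P q \<Longrightarrow> P (p + q)"
  shows "P p"
proof (induction p rule: update_induct)
  case const
  show ?case using assms(1)[of 0 0] by simp
next
  case (update f a b)
  have "Poly_Mapping.update a b f = f + Poly_Mapping.single a b"
    using update by (intro poly_mapping_eqI)
      (auto simp: lookup_update lookup_add lookup_single in_keys_iff when_def)
  then show ?case using update assms by metis
qed

lemma pderivative_mult:
  "pderivative i (p * q) = pderivative i p * q + p * pderivative i q"
proof (induction p rule: mpoly_induct)
  case (single m c)
  show ?case
  proof (induction q rule: mpoly_induct)
    case (single m' c')
    let ?d = "Poly_Mapping.single i (1::nat)"
    have 1: "Poly_Mapping.single (m + m' - ?d) (of_nat (Poly_Mapping.lookup m i) * (c * c')) =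
        pderivative i (Poly_Mapping.single m c) * Poly_Mapping.single m' c'"
    proof (cases "Poly_Mapping.lookup m i = 0")
      case False
      then have "m + m' - ?d = (m - ?d) + m'"
        by (intro poly_mapping_eqI) (auto simp: lookup_add lookup_minus lookup_single when_def)
      then show ?thesis by (simp add: pderivative_single mult_single mult.assoc)
    qed (simp add: pderivative_single)
    have 2: "Poly_Mapping.single (m + m' - ?d) (of_nat (Poly_Mapping.lookup m' i) * (c * c')) =
        Poly_Mapping.single m c * pderivative i (Poly_Mapping.single m' c')"
    proof (cases "Poly_Mapping.lookup m' i = 0")
      case False
      then have "m + m' - ?d = m + (m' - ?d)"
        by (intro poly_mapping_eqI) (auto simp: lookup_add lookup_minus lookup_single when_def)
      then show ?thesis by (simp add: pderivative_single mult_single mult.left_commute)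
    qed (simp add: pderivative_single)
    show ?case
      unfolding 1[symmetric] 2[symmetric]
      by (simp add: mult_single pderivative_single lookup_add distrib_right single_add)
  next
    case (add q q')
    then show ?case by (simp add: pderivative_add algebra_simps)
  qed
next
  case (add p p')
  then show ?case by (simp add: pderivative_add algebra_simps)
qed

lemma pderivative_pvar: "pderivative i (pvar j) = (if i = j then 1 else 0)"
  by (auto simp: pvar_def pderivative_single lookup_single simp flip: single_one)

lemma pderivative_pconst [simp]: "pderivative i (pconst c) = 0"
  by (simp add: pconst_def pderivative_single)

lift_definition fderivative :: "nat \<Rightarrow> 'k::field mpoly fract \<Rightarrow> 'k mpoly fract" is
  "\<lambda>i (p, q). (pderivative i p * q - p * pderivative i q, q * q)"
proof (clarsimp)
  fix i and p q p' q' :: "'k mpoly"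
  assume eq: "p * q' = p' * q"
  have d: "pderivative i p * q' + p * pderivative i q' = pderivative i p' * q + p' * pderivative i q"
    using arg_cong[OF eq, of "pderivative i"] by (simp add: pderivative_mult)
  show "(pderivative i p * q - p * pderivative i q) * (q' * q') =
        (pderivative i p' * q' - p' * pderivative i q') * (q * q)"
  proof -
    have "(pderivative i p * q - p * pderivative i q) * (q' * q') -
          (pderivative i p' * q' - p' * pderivative i q') * (q * q) =
        q * q' * ((pderivative i p * q' + p * pderivative i q') -
                  (pderivative i p' * q + p' * pderivative i q))
        - (pderivative i q' * q + pderivative i q * q') * (p * q' - p' * q)"
      by (simp add: algebra_simps)
    then show ?thesis using eq d by simp
  qed
qed

definition to_frac :: "'k::field mpoly \<Rightarrow> 'k mpoly fract" where
  "to_frac p = Fract p 1"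

definition fconst :: "'k::field \<Rightarrow> 'k mpoly fract" where
  "fconst c = to_frac (pconst c)"

lemma fderivative_to_frac:
  fixes p :: "'k::field mpoly"
  shows "fderivative i (to_frac p) = to_frac (pderivative i p)"
proof -
  have "pderivative i (1 :: 'k mpoly) = 0"
    using pderivative_pconst[of i 1] by (simp add: pconst_def)
  then show ?thesis
    unfolding to_frac_def by transfer simp
qed


section \<open>The Poisson algebra \<open>F\<^sub>n\<^sup>C\<close>\<close>

text \<open>\<open>bracket_coeff n i j\<close> is \<open>{x\<^sub>i, x\<^sub>j}\<close> for \<open>i, j \<in> {1..n}\<close>; note that the relation
  \<open>{x\<^sub>n, x\<^sub>1} = x\<^sub>n x\<^sub>1 - 1\<close> determines \<open>{x\<^sub>1, x\<^sub>n}\<close>.\<close>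

definition bracket_coeff_less :: "nat \<Rightarrow> nat \<Rightarrow> nat \<Rightarrow> 'k::field mpoly" where
  "bracket_coeff_less n i j =
     (if j = i + 1 then pvar i * pvar j - 1
      else if i = 1 \<and> j = n then - (pvar n * pvar 1 - 1)
      else if odd (j - i) then pvar i * pvar j
      else - (pvar i * pvar j))"

definition bracket_coeff :: "nat \<Rightarrow> nat \<Rightarrow> nat \<Rightarrow> 'k::field mpoly" where
  "bracket_coeff n i j =
     (if i < j then bracket_coeff_less n i j
      else if j < i then - bracket_coeff_less n j i
      else 0)"

text \<open>The biderivation with these values on generators, on polynomials and on fractions.\<close>

definition C_bracket :: "nat \<Rightarrow> 'k::field mpoly \<Rightarrow> 'k mpoly \<Rightarrow> 'k mpoly" where
  "C_bracket n f g =
     (\<Sum>i\<in>{1..n}. \<Sum>j\<in>{1..n}. bracket_coeff n i j * pderivative i f * pderivative j g)"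

definition C_frac_bracket ::
    "nat \<Rightarrow> 'k::field mpoly fract \<Rightarrow> 'k mpoly fract \<Rightarrow> 'k mpoly fract" where
  "C_frac_bracket n f g =
     (\<Sum>i\<in>{1..n}. \<Sum>j\<in>{1..n}. to_frac (bracket_coeff n i j) * fderivative i f * fderivative j g)"

definition FC :: "nat \<Rightarrow> 'k::field mpoly poisson_ring" where
  "FC n = with_bracket (F n) (C_bracket n)"

text \<open>The field of fractions of the ring of all polynomials, with the extended bracket.  It
  contains the algebra \<open>T\<^sub>C\<close> below.\<close>

definition FracC :: "nat \<Rightarrow> 'k::field mpoly fract poisson_ring" where
  "FracC n = with_bracket
     \<lparr>carrier = UNIV, monoid.mult = (*), one = 1, zero = 0, add = (+)\<rparr> (C_frac_bracket n)"

lemma C_bracket_pvar: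
  assumes "i \<in> {1..n}" "j \<in> {1..n}"
  shows "C_bracket n (pvar i) (pvar j) = bracket_coeff n i j"
proof -
  have "C_bracket n (pvar i) (pvar j) =
      (\<Sum>a\<in>{1..n}. \<Sum>b\<in>{1..n}. if b = j then (if a = i then bracket_coeff n a b else 0) else 0)"
    unfolding C_bracket_def pderivative_pvar by (intro sum.cong refl) auto
  also have "\<dots> = bracket_coeff n i j"
    using assms by (simp add: sum.delta)
  finally show ?thesis .
qed

lemma C_bracket_mult_left:
  "C_bracket n (f * g) h = C_bracket n f h * g + f * C_bracket n g h"
  by (simp add: C_bracket_def pderivative_mult sum_distrib_left sum_distrib_right
        algebra_simps flip: sum.distrib)

lemma C_bracket_mult_right:
  "C_bracket n h (f * g) = C_bracket n h f * g + f * C_bracket n h g"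
  by (simp add: C_bracket_def pderivative_mult sum_distrib_left sum_distrib_right
        algebra_simps flip: sum.distrib)

lemma C_frac_bracket_to_frac:
  fixes f g :: "'k::field mpoly"
  shows "C_frac_bracket n (to_frac f) (to_frac g) = to_frac (C_bracket n f g)"
proof -
  have add: "to_frac (p + q) = to_frac p + to_frac q"
    and mult: "to_frac (p * q) = to_frac p * to_frac q" for p q :: "'k mpoly"
    by (simp_all add: to_frac_def)
  have "to_frac (0::'k mpoly) = 0"
    by (simp add: to_frac_def Zero_fract_def)
  then have "to_frac (sum h A) = (\<Sum>a\<in>A. to_frac (h a))" for h :: "nat \<Rightarrow> 'k mpoly" and A
    by (induction A rule: infinite_finite_induct) (simp_all add: add)
  then show ?thesis
    by (simp add: C_frac_bracket_def C_bracket_def fderivative_to_frac mult)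
qed

definition \<theta> :: "nat \<Rightarrow> 'k::field mpoly \<Rightarrow> 'k mpoly" where
  "\<theta> n = peval pconst (\<lambda>i. if i = n then pvar 1 else pvar (i + 1))"

text \<open>The second equation is the recurrence for \<open>i = 0\<close> with \<open>z\<^sub>-\<^sub>1 = 0\<close>.\<close>

fun z :: "nat \<Rightarrow> 'k::field mpoly" where
  "z 0 = 1"
| "z (Suc 0) = z 0 * pvar 1 - 0"
| "z (Suc (Suc i)) = z (Suc i) * pvar (Suc (Suc i)) - z i"

definition \<Omega> :: "nat \<Rightarrow> 'k::field mpoly" where
  "\<Omega> n = z (n - 1) * pvar n - z (n - 2) - \<theta> n (z (n - 2))"

text \<open>The sequence \<open>z\<^sub>1, \<dots>, z\<^sub>n\<^sub>-\<^sub>1, \<Omega>\<close>, indexed by \<open>{1..n}\<close>.\<close>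

definition ygen :: "nat \<Rightarrow> nat \<Rightarrow> 'k::field mpoly" where
  "ygen n i = (if i = n then \<Omega> n else z i)"

definition S_C :: "nat \<Rightarrow> 'k::field mpoly set" where
  "S_C n = generate_ring (F n) (range pconst \<union> ygen n ` {1..n})"

definition T_C :: "nat \<Rightarrow> 'k::field mpoly fract set" where
  "T_C n = generate_ring (FracC n)
     (range fconst \<union> (\<lambda>i. to_frac (ygen n i)) ` {1..n}
                   \<union> (\<lambda>i. inverse (to_frac (ygen n i))) ` {1..n})"

definition U_C :: "nat \<Rightarrow> 'k::field mpoly fract set" where
  "U_C n = generate_ring (FracC n)
     (range fconst \<union> (\<lambda>i. to_frac (z i)) ` {1..n-1} \<union> (\<lambda>i. inverse (to_frac (z i))) ` {1..n-1})"

definition \<Lambda> :: "nat \<Rightarrow> nat \<Rightarrow> int" where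
  "\<Lambda> i j = (if i < j then (if even j \<and> odd i then 1 else 0)
            else if j < i then - (if even i \<and> odd j then 1 else 0)
            else 0)"

text \<open>To be used for generators \<open>y\<^sub>1, \<dots>, y\<^sub>n\<close> of a (Laurent) polynomial algebra.\<close>

definition log_canonical ::
    "nat \<Rightarrow> (nat \<Rightarrow> nat \<Rightarrow> int) \<Rightarrow> (nat \<Rightarrow> 'a::comm_ring_1) \<Rightarrow> ('a \<Rightarrow> 'a \<Rightarrow> 'a) \<Rightarrow> bool" where
  "log_canonical n L y b \<longleftrightarrow> (\<forall>i\<in>{1..n}. \<forall>j\<in>{1..n}. b (y i) (y j) = of_int (L i j) * y i * y j)"

text \<open>The kernel of \<open>F\<^sub>n \<rightarrow> F\<^sub>n\<^sub>-\<^sub>2 \<rightarrow> F\<^sub>n\<^sub>-\<^sub>2 / (z\<^sub>n\<^sub>-\<^sub>2 - l) F\<^sub>n\<^sub>-\<^sub>2\<close>.\<close>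

definition M_ideal :: "nat \<Rightarrow> 'k::field \<Rightarrow> 'k mpoly set" where
  "M_ideal n l =
     (let J = PIdl\<^bsub>F (n - 2)\<^esub> (z (n - 2) - pconst l);
          \<phi> = peval pconst (\<lambda>i. if i = n - 1 then pconst l * z (n - 3)
                                else if i = n then pconst l * \<theta> n (z (n - 3))
                                else pvar i)
      in a_kernel (F n) (F (n - 2) Quot J) (\<lambda>f. J +>\<^bsub>F (n - 2)\<^esub> \<phi> f))"

end

theory Submission
  imports Defs
begin

text \<open>Each \<open>z\<^sub>i\<close> is linear in \<open>x\<^sub>i\<close> with leading coefficient \<open>z\<^sub>i\<^sub>-\<^sub>1\<close>, and \<open>\<Omega>\<close> is linear in \<open>x\<^sub>n\<close> with leading
  coefficient \<open>z\<^sub>n\<^sub>-\<^sub>1\<close>; so inverting the \<open>z\<^sub>i\<close> turns \<open>F\<^sub>n\<close> into \<open>U[\<Omega>]\<close>.  There the Hamiltonians of the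
  \<open>z\<^sub>i\<close> act on monomials with distinct eigenvalues because the matrix \<open>\<Lambda>\<close> of even size \<open>n - 1\<close> is
  nondegenerate.  Hence a Poisson ideal that contains no monomial in the \<open>z\<^sub>i\<close> is governed by its
  intersection with \<open>K[\<Omega>]\<close>, and a Poisson prime of this kind is \<open>(\<Omega> - \<lambda>)\<close>.

  If \<open>i \<le> n - 2\<close> and \<open>z\<^sub>i\<close> is in a Poisson ideal, then bracketing with \<open>x\<^sub>i\<^sub>+\<^sub>1\<close> shows that \<open>z\<^sub>i\<^sub>-\<^sub>1\<close> is, too,
  so the ideal is trivial.  The only other possibility is \<open>z\<^sub>n\<^sub>-\<^sub>1 = 0\<close> modulo the ideal; then the
  bracket with \<open>x\<^sub>n\<close> gives \<open>\<theta>(z\<^sub>n\<^sub>-\<^sub>2) = z\<^sub>n\<^sub>-\<^sub>2\<close>, the determinant identity for continuants gives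
  \<open>z\<^sub>n\<^sub>-\<^sub>2\<^sup>2 = 1\<close>, and \<open>\<Omega> = - 2 z\<^sub>n\<^sub>-\<^sub>2\<close>.  This leads to \<open>M\<^sub>1\<close>, \<open>M\<^sub>-\<^sub>1\<close> and \<open>\<mu> = \<plusminus>2\<close>.  For ideals that are not
  prime, the argument is applied to the radical, which is a Poisson ideal in characteristic \<open>0\<close>.\<close>

text \<open>The monomial argument is used twice. Modulo a Poisson prime P containing z_{n-1}, the
  element z_{n-2} becomes a constant l with l^2 = 1. Then z_{n-1} = z_{n-2} x_{n-1} - z_{n-3} forces
  x_{n-1} = l z_{n-3}, and the bracket of z_{n-2} - l with x_n forces x_n = l \<theta>(z_{n-3}). So
  P is determined by its part in F_{n-2}, where z_{n-2} plays the role of \<Omega>: it commutes with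
  x_1, ..., x_{n-2}, is linear in the last of them, and the matrix for z_1, ..., z_{n-3} again has
  even size. Hence \<open>monomial_in_pideal\<close> is stated for an abstract element c.
  Conversely, M_l is a Poisson ideal because this substitution respects brackets modulo z_{n-2} - l,
  which is checked on generators. Instead of localising, denominators are cleared by monomials in
  the z_i. In a radical, which need not be prime, factors z_i are cancelled by means of colon
  ideals. Algebraic closedness serves to split a polynomial in \<Omega> into linear factors.\<close>

abbreviation (input) "keys \<equiv> Poly_Mapping.keys"
abbreviation (input) "lookup \<equiv> Poly_Mapping.lookup"
abbreviation (input) "single \<equiv> Poly_Mapping.single"

section \<open>Homomorphisms and derivations\<close>

definition is_hom :: "('a::comm_ring_1 \<Rightarrow> 'b::comm_ring_1) \<Rightarrow> bool" where
  "is_hom h \<longleftrightarrow> h 1 = 1 \<and> (\<forall>x y. h (x + y) = h x + h y) \<and> (\<forall>x y. h (x * y) = h x * h y)"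

lemma is_homD:
  assumes "is_hom h"
  shows "h 1 = 1" "h (x + y) = h x + h y" "h (x * y) = h x * h y" "h 0 = 0"
    "h (- x) = - h x" "h (x - y) = h x - h y" "h (x ^ k) = h x ^ k"
proof -
  show 1: "h 1 = 1" and a: "h (x + y) = h x + h y" and m: "h (x * y) = h x * h y" for x y
    using assms by (auto simp: is_hom_def)
  show z: "h 0 = 0" using a[of 0 0] by simp
  show n: "h (- x) = - h x" for x
    using a[of x "- x"] z by (simp add: eq_neg_iff_add_eq_0 add.commute)
  show "h (x - y) = h x - h y" using a[of x "- y"] n by simp
  show "h (x ^ k) = h x ^ k" by (induction k) (auto simp: 1 m)
qed

definition is_derivation :: "('a::comm_ring_1 \<Rightarrow> 'a) \<Rightarrow> bool" where
  "is_derivation d \<longleftrightarrow> (\<forall>x y. d (x + y) = d x + d y) \<and> (\<forall>x y. d (x * y) = d x * y + x * d y)"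

lemma is_derivationD:
  assumes "is_derivation d"
  shows "d (x + y) = d x + d y" "d (x * y) = d x * y + x * d y" "d 0 = 0" "d 1 = 0"
    "d (- x) = - d x" "d (x - y) = d x - d y"
proof -
  show a: "d (x + y) = d x + d y" and m: "d (x * y) = d x * y + x * d y" for x y
    using assms by (auto simp: is_derivation_def)
  show z: "d 0 = 0" using a[of 0 0] by simp
  show "d 1 = 0" using m[of 1 1] by simp
  show n: "d (- x) = - d x" for x
    using a[of x "- x"] z by (simp add: eq_neg_iff_add_eq_0 add.commute)
  show "d (x - y) = d x - d y" using a[of x "- y"] n by simp
qed

lemma derivation_sum:
  "is_derivation d \<Longrightarrow> d (\<Sum>i\<in>A. f i) = (\<Sum>i\<in>A. d (f i))"
  by (induction A rule: infinite_finite_induct) (simp_all add: is_derivationD[of d])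

lemma derivation_power:
  "is_derivation d \<Longrightarrow> d (x ^ Suc k) = of_nat (Suc k) * x ^ k * d x"
  by (induction k) (simp_all add: is_derivationD[of d] algebra_simps)

lemma derivation_inverse:
  fixes x :: "'a::field"
  assumes d: "is_derivation d" and "x \<noteq> 0"
  shows "d (inverse x) = - d x * inverse x * inverse x"
proof -
  have "d x * inverse x + x * d (inverse x) = 0"
    using is_derivationD(2)[OF d, of x "inverse x"] is_derivationD(4)[OF d] \<open>x \<noteq> 0\<close> by simp
  then have "x * d (inverse x) = - (d x * inverse x)"
    by (metis add_eq_0_iff)
  moreover have "d (inverse x) = inverse x * (x * d (inverse x))"
    using \<open>x \<noteq> 0\<close> by simp
  ultimately show ?thesis by simp
qed


section \<open>Evaluation of polynomials and Laurent polynomials\<close>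

text \<open>The monomial case supplies \<open>m \<in> keys p\<close>, so that conditions on the
  support of \<open>p\<close> remain available in the induction.\<close>

lemma poly_mapping_induct [case_names single zero add]:
  fixes p :: "'a \<Rightarrow>\<^sub>0 'b::comm_monoid_add"
  assumes "\<And>m c. m \<in> keys p \<Longrightarrow> P (single m c)"
    and "P 0" "\<And>p q. P p \<Longrightarrow> P q \<Longrightarrow> P (p + q)"
  shows "P p"
proof -
  have "P (\<Sum>m\<in>A. single m (lookup p m))"
    if "A \<subseteq> keys p" for A
    using finite_subset[OF that finite_keys] that
    by (induction rule: finite_induct) (auto intro: assms)
  moreover have "(\<Sum>m\<in>keys p. single m (lookup p m)) = p"
    by (intro poly_mapping_eqI)
      (auto simp: lookup_sum lookup_single when_def in_keys_iff sum.delta)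
  ultimately show ?thesis by (metis order_refl)
qed

text \<open>\<^const>\<open>peval\<close> and \<^const>\<open>leval\<close> have this form, with \<open>E\<close> the evaluation of monomials.\<close>

definition gen_eval :: "('k::comm_ring_1 \<Rightarrow> 'a::comm_ring_1) \<Rightarrow> ('m \<Rightarrow> 'a) \<Rightarrow> ('m \<Rightarrow>\<^sub>0 'k) \<Rightarrow> 'a" where
  "gen_eval \<iota> E p = (\<Sum>m\<in>keys p. \<iota> (lookup p m) * E m)"

lemma gen_eval_superset:
  assumes "is_hom \<iota>" "finite M" "keys p \<subseteq> M"
  shows "gen_eval \<iota> E p = (\<Sum>m\<in>M. \<iota> (lookup p m) * E m)"
  unfolding gen_eval_def
  by (rule sum.mono_neutral_left) (use assms in \<open>auto simp: in_keys_iff is_homD[OF assms(1)]\<close>)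

lemma gen_eval_add:
  assumes "is_hom \<iota>"
  shows "gen_eval \<iota> E (p + q) = gen_eval \<iota> E p + gen_eval \<iota> E q"
proof -
  let ?M = "keys p \<union> keys q"
  have "keys (p + q) \<subseteq> ?M" by (rule Poly_Mapping.keys_add)
  then show ?thesis using assms
    by (simp add: gen_eval_superset[of \<iota> ?M] lookup_add distrib_right sum.distrib is_homD[OF assms])
qed

lemma gen_eval_0 [simp]: "gen_eval \<iota> E 0 = 0"
  by (simp add: gen_eval_def)

lemma gen_eval_single:
  assumes "is_hom \<iota>"
  shows "gen_eval \<iota> E (single m c) = \<iota> c * E m"
  using assms by (subst gen_eval_superset[of \<iota> "{m}"]) (auto simp: lookup_single)

lemma gen_eval_mult:
  assumes \<iota>: "is_hom \<iota>" and E: "\<And>m m'. E (m + m') = E m * E m'"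
  shows "gen_eval \<iota> E (p * q) = gen_eval \<iota> E p * gen_eval \<iota> E q"
proof (induction p rule: poly_mapping_induct)
  case (single m c)
  show ?case
  proof (induction q rule: poly_mapping_induct)
    case (single m' c')
    show ?case by (simp add: mult_single gen_eval_single[OF \<iota>] E is_homD[OF \<iota>] mult_ac)
  qed (simp_all only: gen_eval_add[OF \<iota>] gen_eval_0 distrib_left mult_zero_right)
qed (simp_all only: gen_eval_add[OF \<iota>] gen_eval_0 distrib_right mult_zero_left)

lemma is_hom_gen_eval:
  assumes \<iota>: "is_hom \<iota>" and E: "\<And>m m'. E (m + m') = E m * E m'" "E 0 = 1"
  shows "is_hom (gen_eval \<iota> E)"
  using gen_eval_single[OF \<iota>, of E 0 1]
  by (auto simp: is_hom_def gen_eval_add[OF \<iota>] gen_eval_mult[OF \<iota> E(1)] E is_homD[OF \<iota>])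

definition mono_eval :: "(nat \<Rightarrow> 'a::comm_ring_1) \<Rightarrow> (nat \<Rightarrow>\<^sub>0 nat) \<Rightarrow> 'a" where
  "mono_eval y m = (\<Prod>i\<in>keys m. y i ^ lookup m i)"

definition lmono_eval :: "(nat \<Rightarrow> 'a::field) \<Rightarrow> (nat \<Rightarrow>\<^sub>0 int) \<Rightarrow> 'a" where
  "lmono_eval y m = (\<Prod>i\<in>keys m. y i powi lookup m i)"

lemma peval_gen_eval: "peval \<iota> y = gen_eval \<iota> (mono_eval y)"
  by (simp add: fun_eq_iff peval_def gen_eval_def mono_eval_def)

lemma leval_gen_eval: "leval \<iota> y = gen_eval \<iota> (lmono_eval y)"
  by (simp add: fun_eq_iff leval_def gen_eval_def lmono_eval_def)

lemma mono_eval_superset: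
  assumes "finite A" "keys m \<subseteq> A"
  shows "mono_eval y m = (\<Prod>i\<in>A. y i ^ lookup m i)"
  unfolding mono_eval_def
  by (rule prod.mono_neutral_left) (use assms in \<open>auto simp: in_keys_iff\<close>)

lemma lmono_eval_superset:
  assumes "finite A" "keys m \<subseteq> A"
  shows "lmono_eval y m = (\<Prod>i\<in>A. y i powi lookup m i)"
  unfolding lmono_eval_def
  by (rule prod.mono_neutral_left) (use assms in \<open>auto simp: in_keys_iff\<close>)

lemma mono_eval_0 [simp]: "mono_eval y 0 = 1"
  by (simp add: mono_eval_def)

lemma lmono_eval_0 [simp]: "lmono_eval y 0 = 1"
  by (simp add: lmono_eval_def)

lemma mono_eval_single [simp]: "mono_eval y (single i k) = y i ^ k"
  by (subst mono_eval_superset[of "{i}"]) auto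

lemma lmono_eval_single [simp]: "lmono_eval y (single i k) = y i powi k"
  by (subst lmono_eval_superset[of "{i}"]) auto

lemma mono_eval_add: "mono_eval y (m + m') = mono_eval y m * mono_eval y m'"
proof -
  let ?M = "keys m \<union> keys m'"
  have "keys (m + m') \<subseteq> ?M" by (rule Poly_Mapping.keys_add)
  then show ?thesis
    by (simp add: mono_eval_superset[of ?M] lookup_add power_add prod.distrib)
qed

lemma lmono_eval_add:
  assumes y: "\<And>i. i \<in> keys m \<union> keys m' \<Longrightarrow> y i \<noteq> 0"
  shows "lmono_eval y (m + m') = lmono_eval y m * lmono_eval y m'"
proof -
  let ?M = "keys m \<union> keys m'"
  have *: "keys (m + m') \<subseteq> ?M" by (rule Poly_Mapping.keys_add)
  have fin: "finite ?M" by simp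
  have "lmono_eval y (m + m') =
      (\<Prod>i\<in>?M. y i powi lookup m i * y i powi lookup m' i)"
    using * y by (subst lmono_eval_superset[of ?M])
      (auto simp: lookup_add power_int_add intro!: prod.cong)
  then show ?thesis
    by (simp add: prod.distrib lmono_eval_superset[OF fin])
qed

lemma is_hom_peval: "is_hom \<iota> \<Longrightarrow> is_hom (peval \<iota> y)"
  unfolding peval_gen_eval by (rule is_hom_gen_eval) (auto simp: mono_eval_add)

lemma is_hom_leval: "is_hom \<iota> \<Longrightarrow> (\<And>i. y i \<noteq> 0) \<Longrightarrow> is_hom (leval \<iota> y)"
  unfolding leval_gen_eval by (rule is_hom_gen_eval) (auto simp: lmono_eval_add)

lemma peval_single: "is_hom \<iota> \<Longrightarrow> peval \<iota> y (single m c) = \<iota> c * mono_eval y m"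
  by (simp add: peval_gen_eval gen_eval_single)

lemma leval_single: "is_hom \<iota> \<Longrightarrow> leval \<iota> y (single m c) = \<iota> c * lmono_eval y m"
  by (simp add: leval_gen_eval gen_eval_single)

lemma peval_pvar [simp]: "is_hom \<iota> \<Longrightarrow> peval \<iota> y (pvar i) = y i"
  by (simp add: pvar_def peval_single is_homD[of \<iota>])

lemma peval_pconst [simp]: "is_hom \<iota> \<Longrightarrow> peval \<iota> y (pconst c) = \<iota> c"
  by (simp add: pconst_def peval_single)

lemma is_hom_pconst: "is_hom (pconst :: 'k::field \<Rightarrow> 'k mpoly)"
  by (simp add: is_hom_def pconst_def single_add mult_single)

lemmas pconst_simps [simp] = is_homD[OF is_hom_pconst]

lemma pconst_eq_iff [simp]: "pconst c = pconst d \<longleftrightarrow> c = d"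
  by (metis lookup_single_eq pconst_def)

lemma pconst_eq_0_iff [simp]: "pconst c = 0 \<longleftrightarrow> c = 0"
  using pconst_eq_iff[of c 0] unfolding pconst_simps .

lemma pconst_of_nat: "pconst (of_nat k) = of_nat k"
  by (induction k) auto

lemma pconst_of_int: "pconst (of_int k) = of_int k"
  by (cases k) (auto simp: pconst_of_nat simp del: of_nat_Suc)

lemma pconst_numeral: "pconst (numeral k) = numeral k"
  using pconst_of_nat[of "numeral k"] by simp

lemma is_hom_to_frac: "is_hom to_frac"
  by (simp add: is_hom_def to_frac_def One_fract_def)

lemmas to_frac_simps [simp] = is_homD[OF is_hom_to_frac]

lemma to_frac_eq_iff [simp]: "to_frac p = to_frac q \<longleftrightarrow> p = q"
  by (simp add: to_frac_def eq_fract)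

lemma to_frac_eq_0_iff [simp]: "to_frac p = 0 \<longleftrightarrow> p = 0"
  using to_frac_eq_iff[of p 0] unfolding to_frac_simps .

lemma is_hom_compose: "is_hom g \<Longrightarrow> is_hom h \<Longrightarrow> is_hom (\<lambda>x. g (h x))"
  by (simp add: is_hom_def)

lemma is_hom_fconst: "is_hom (fconst :: 'k::field \<Rightarrow> 'k mpoly fract)"
  unfolding fconst_def by (rule is_hom_compose[OF is_hom_to_frac is_hom_pconst])

lemmas fconst_simps [simp] = is_homD[OF is_hom_fconst]


section \<open>Subrings of polynomials\<close>

text \<open>Arbitrary index sets are allowed because \<open>polys (- {v})\<close> expresses
  independence of x_v. The coefficients form just a ring because \<open>clear_denominators\<close>
  takes them from \<open>'k poly\<close>.\<close>

definition polys :: "nat set \<Rightarrow> 'k::comm_ring_1 mpoly set" where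
  "polys V = {p. \<forall>m\<in>keys p. keys m \<subseteq> V}"

lemma poly_carrier_polys: "poly_carrier n = polys {1..n}"
  by (simp add: poly_carrier_def polys_def)

lemma polys_mono: "V \<subseteq> W \<Longrightarrow> polys V \<subseteq> polys W"
  by (auto simp: polys_def)

lemma polys_UNIV: "p \<in> polys UNIV"
  by (simp add: polys_def)

lemma polys_pconst [simp]: "pconst c \<in> polys V"
  by (auto simp: polys_def pconst_def)

lemma polys_pvar: "i \<in> V \<Longrightarrow> pvar i \<in> polys V"
  by (simp add: polys_def pvar_def)

lemma polys_0 [simp]: "0 \<in> polys V" and polys_1 [simp]: "1 \<in> polys V"
  by (simp_all add: polys_def)

lemma polys_add: "p \<in> polys V \<Longrightarrow> q \<in> polys V \<Longrightarrow> p + q \<in> polys V"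
  using Poly_Mapping.keys_add[of p q] unfolding polys_def by blast

lemma polys_mult:
  assumes "p \<in> polys V" "q \<in> polys V"
  shows "p * q \<in> polys V"
  unfolding polys_def
proof safe
  fix m i
  assume "m \<in> keys (p * q)" and i: "i \<in> keys m"
  then obtain a b where "m = a + b" "a \<in> keys p" "b \<in> keys q"
    using keys_mult[of p q] by blast
  moreover have "i \<in> keys a \<union> keys b"
    using Poly_Mapping.keys_add[of a b] i \<open>m = a + b\<close> by blast
  ultimately show "i \<in> V" using assms unfolding polys_def by blast
qed

lemma polys_uminus: "p \<in> polys V \<Longrightarrow> - p \<in> polys V"
  by (simp add: polys_def in_keys_iff)

lemma polys_diff: "p \<in> polys V \<Longrightarrow> q \<in> polys V \<Longrightarrow> p - q \<in> polys V"
  using polys_add[of p V "- q"] polys_uminus[of q V] by simp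

lemma polys_power: "p \<in> polys V \<Longrightarrow> p ^ k \<in> polys V"
  by (induction k) (auto intro: polys_mult)

lemma polys_prod: "(\<And>i. i \<in> A \<Longrightarrow> f i \<in> polys V) \<Longrightarrow> (\<Prod>i\<in>A. f i) \<in> polys V"
  by (induction A rule: infinite_finite_induct) (auto intro: polys_mult)

lemma polys_sum: "(\<And>i. i \<in> A \<Longrightarrow> f i \<in> polys V) \<Longrightarrow> (\<Sum>i\<in>A. f i) \<in> polys V"
  by (induction A rule: infinite_finite_induct) (auto intro: polys_add)

lemma polys_of_int [simp]: "of_int k \<in> (polys V :: 'k::field mpoly set)"
  by (metis pconst_of_int polys_pconst)

lemmas polys_intros = polys_add polys_mult polys_uminus polys_diff polys_power polys_prod polys_sum
  polys_pvar

lemma single_conv_mono_eval: "single m c = pconst c * mono_eval pvar m"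
proof -
  have pow: "single (single i k) (1::'a) = pvar i ^ k" for i k
  proof (induction k)
    case (Suc k)
    have "single (single i (Suc k)) (1::'a) =
        pvar i * single (single i k) 1"
      by (simp add: pvar_def mult_single flip: single_add)
    then show ?case using Suc by simp
  qed simp
  have "single m (1::'a) = mono_eval pvar m"
  proof (induction m rule: poly_mapping_induct)
    case (add p q)
    have "single (p + q) (1::'a) = single p 1 * single q 1"
      by (simp add: mult_single)
    then show ?case using add by (simp add: mono_eval_add)
  qed (simp_all add: pow)
  moreover have "single m c = pconst c * single m 1"
    by (simp add: pconst_def mult_single)
  ultimately show ?thesis by simp
qed

lemma polys_induct [consumes 1, case_names const var add mult]:
  assumes p: "p \<in> polys V"
    and const: "\<And>c. P (pconst c)" and var: "\<And>i. i \<in> V \<Longrightarrow> P (pvar i)"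
    and add: "\<And>p q. p \<in> polys V \<Longrightarrow> q \<in> polys V \<Longrightarrow> P p \<Longrightarrow> P q \<Longrightarrow> P (p + q)"
    and mult: "\<And>p q. p \<in> polys V \<Longrightarrow> q \<in> polys V \<Longrightarrow> P p \<Longrightarrow> P q \<Longrightarrow> P (p * q)"
  shows "P p"
proof -
  let ?Q = "\<lambda>p. p \<in> polys V \<and> P p"
  have 1: "?Q 1" using const[of 1] by simp
  have m: "?Q (p * q)" if "?Q p" "?Q q" for p q using that mult by (auto intro: polys_intros)
  have pow: "?Q (p ^ k)" if "?Q p" for p k by (induction k) (use 1 m that in auto)
  have prod: "?Q (\<Prod>i\<in>A. f i)" if "\<And>i. i \<in> A \<Longrightarrow> ?Q (f i)" for A and f :: "nat \<Rightarrow> 'a mpoly"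
    using that by (induction A rule: infinite_finite_induct) (use 1 m in auto)
  have "?Q p"
  proof (induction p rule: poly_mapping_induct)
    case (single m c)
    then have "keys m \<subseteq> V" using p by (auto simp: polys_def)
    then have "?Q (mono_eval pvar m)"
      unfolding mono_eval_def by (intro prod pow) (auto intro: var polys_intros)
    then show ?case unfolding single_conv_mono_eval using const by (intro m) auto
  next
    case zero
    show ?case using const[of 0] by simp
  qed (auto intro: add polys_intros)
  then show ?thesis ..
qed

lemma hom_eqI:
  assumes "is_hom g" "is_hom h" "\<And>c. g (pconst c) = h (pconst c)"
    and "\<And>i. i \<in> V \<Longrightarrow> g (pvar i) = h (pvar i)" and "p \<in> polys V"
  shows "g p = h p"
  using \<open>p \<in> polys V\<close> by (induction rule: polys_induct) 
    (use assms in \<open>simp_all add: is_homD[OF assms(1)] is_homD[OF assms(2)]\<close>)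

lemma peval_in_polys:
  assumes "p \<in> polys V" "\<And>i. i \<in> V \<Longrightarrow> y i \<in> polys W"
  shows "peval pconst y p \<in> polys W"
  using assms(1)
proof (induction rule: polys_induct)
qed (use assms in \<open>auto simp: is_homD[OF is_hom_peval[OF is_hom_pconst]] is_hom_pconst
    intro: polys_intros\<close>)

text \<open>Setting the variables outside \<open>V\<close> to 0 is a retraction that fixes
  \<open>p\<close> and \<open>f\<close>, so \<open>g\<close> and its image have the same product
  with \<open>p\<close>. Consequently divisibility among all polynomials agrees with divisibility
  inside F_n.\<close>

lemma polys_dvd_cofactor:
  fixes f g p :: "'a::field mpoly"
  assumes "p \<in> polys V" "f \<in> polys V" "p \<noteq> 0" "f = p * g"
  shows "g \<in> polys V"
proof -
  define \<rho> :: "'a mpoly \<Rightarrow> 'a mpoly"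
    where "\<rho> = peval pconst (\<lambda>i. if i \<in> V then pvar i else 0)"
  have \<rho>: "is_hom \<rho>" by (simp add: \<rho>_def is_hom_peval is_hom_pconst)
  have fix': "\<rho> q = q" if "q \<in> polys V" for q
    by (rule hom_eqI[OF \<rho> _ _ _ that, of "\<lambda>x. x"])
      (auto simp: \<rho>_def is_hom_pconst is_hom_def)
  have "p * g = p * \<rho> g"
    using assms fix'[of p] fix'[of f] by (simp add: is_homD[OF \<rho>])
  then have "g = \<rho> g" using \<open>p \<noteq> 0\<close> by simp
  moreover have "\<rho> g \<in> polys V"
    unfolding \<rho>_def by (rule peval_in_polys[OF polys_UNIV]) (auto intro: polys_intros)
  ultimately show ?thesis by simp
qed

lemma is_derivation_pderivative: "is_derivation (pderivative i)"
  by (simp add: is_derivation_def pderivative_add pderivative_mult)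

lemma pderivative_eq_0:
  assumes "p \<in> polys V" "i \<notin> V"
  shows "pderivative i p = 0"
  using assms
  by (induction rule: polys_induct)
    (auto simp: pderivative_pvar pderivative_add pderivative_mult)

lemma pderivative_polys: "p \<in> polys V \<Longrightarrow> pderivative i p \<in> polys V"
  by (induction rule: polys_induct)
    (auto simp: pderivative_pvar pderivative_add pderivative_mult intro: polys_intros)


section \<open>Prime elements that are linear in one variable\<close>

text \<open>Here \<open>(a x\<^sub>v - b)\<close> is the kernel of the substitution \<open>x\<^sub>v \<mapsto> b / a\<close>: pseudo-division by
  \<open>a x\<^sub>v - b\<close> reduces this to cancelling powers of \<open>a\<close>.\<close>

lemma linear_prime_elem:
  fixes a b :: "'k::field mpoly"
  assumes a: "a \<in> polys (- {v})" "a \<noteq> 0" and b: "b \<in> polys (- {v})"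
    and cancel: "\<And>q. a dvd b * q \<Longrightarrow> a dvd q"
  shows "prime_elem (a * pvar v - b)"
    and "\<And>r. r \<in> polys (- {v}) \<Longrightarrow> a * pvar v - b dvd r \<Longrightarrow> r = 0"
proof -
  define p where "p = a * pvar v - b"
  define ev where
    "ev = peval fconst (\<lambda>i. if i = v then to_frac b / to_frac a else to_frac (pvar i))"
  have ev: "is_hom ev" unfolding ev_def by (rule is_hom_peval[OF is_hom_fconst])
  note [simp] = is_homD[OF ev]
  have ev_const: "ev r = to_frac r" if "r \<in> polys (- {v})" for r
    by (rule hom_eqI[OF ev is_hom_to_frac _ _ that]) (auto simp: ev_def is_hom_fconst fconst_def)
  have ev_v: "ev (pvar v) = to_frac b / to_frac a"
    by (simp add: ev_def is_hom_fconst)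
  have ev_p: "ev p = 0"
    using a b by (simp add: p_def ev_v ev_const)
  have division: "\<exists>k q r. r \<in> polys (- {v}) \<and> a ^ k * f = p * q + r" for f
    using polys_UNIV[of f]
  proof (induction rule: polys_induct)
    case (const c)
    have "a ^ 0 * pconst c = p * 0 + pconst c" by simp
    then show ?case using polys_pconst by blast
  next
    case (var i)
    show ?case
    proof (cases "i = v")
      case True
      have "a ^ 1 * pvar v = p * 1 + b" by (simp add: p_def)
      then show ?thesis using b True by blast
    next
      case False
      have "a ^ 0 * pvar i = p * 0 + pvar i" by simp
      then show ?thesis using polys_pvar[of i "- {v}"] False by blast
    qed
  next
    case (add f g)
    then obtain k q r l q' r' where *: "r \<in> polys (- {v})" "r' \<in> polys (- {v})"
      "a ^ k * f = p * q + r" "a ^ l * g = p * q' + r'" by metis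
    have "a ^ (k + l) * (f + g) = a ^ l * (a ^ k * f) + a ^ k * (a ^ l * g)"
      by (simp add: power_add algebra_simps)
    also have "\<dots> = p * (a ^ l * q + a ^ k * q') + (a ^ l * r + a ^ k * r')"
      unfolding * by (simp add: algebra_simps)
    finally show ?case using * a
      by (intro exI[of _ "k + l"] exI[of _ "a ^ l * q + a ^ k * q'"] exI[of _ "a ^ l * r + a ^ k * r'"])
        (auto intro!: polys_intros)
  next
    case (mult f g)
    then obtain k q r l q' r' where *: "r \<in> polys (- {v})" "r' \<in> polys (- {v})"
      "a ^ k * f = p * q + r" "a ^ l * g = p * q' + r'" by metis
    have "a ^ (k + l) * (f * g) = (a ^ k * f) * (a ^ l * g)"
      by (simp add: power_add algebra_simps)
    also have "\<dots> = p * (q * (p * q' + r') + r * q') + r * r'"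
      unfolding * by (simp add: algebra_simps)
    finally show ?case using *
      by (intro exI[of _ "k + l"] exI[of _ "q * (p * q' + r') + r * q'"] exI[of _ "r * r'"])
        (auto intro!: polys_intros)
  qed
  \<comment> \<open>Isolating \<open>b * q\<close> in the equation exhibits a factor
    \<open>a\<close>; by \<open>cancel\<close> it already divides \<open>q\<close>, so one power of
    \<open>a\<close> can be removed.\<close>
  have cancel_power: "p dvd f" if "a ^ k * f = p * q" for k q f
    using that
  proof (induction k arbitrary: q)
    case (Suc k)
    have "b * q = a * (pvar v * q - a ^ k * f)"
      using Suc.prems by (simp add: p_def algebra_simps)
    then obtain q' where q': "q = a * q'" using cancel by (metis dvd_triv_left dvdE)
    have "a * (a ^ k * f) = a * (p * q')"
      using Suc.prems unfolding q' by (simp add: algebra_simps)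
    then have "a ^ k * f = p * q'" using a by simp
    then show ?case by (rule Suc.IH)
  qed simp
  \<comment> \<open>Since \<open>ev\<close> takes values in a field, this equivalence yields
    primality: 1 is not mapped to 0, and a product vanishes only if a factor does.\<close>
  have kernel: "p dvd f \<longleftrightarrow> ev f = 0" for f
  proof
    assume "ev f = 0"
    obtain k q r where r: "r \<in> polys (- {v})" and *: "a ^ k * f = p * q + r"
      using division by blast
    have "ev r = 0"
      using arg_cong[OF *, of ev] \<open>ev f = 0\<close> by (simp add: ev_p)
    then have "r = 0" using ev_const[OF r] by simp
    then show "p dvd f" using * cancel_power by auto
  qed (auto simp: ev_p)
  show "r = 0" if "r \<in> polys (- {v})" "a * pvar v - b dvd r" for r
    using that kernel[of r] ev_const[of r] by (simp add: p_def)
  have "pderivative v p = a"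
    using pderivative_eq_0[OF a(1), of v] pderivative_eq_0[OF b, of v]
    by (simp add: p_def is_derivationD[OF is_derivation_pderivative] pderivative_pvar)
  then have "p \<noteq> 0" using a by auto
  then show "prime_elem (a * pvar v - b)"
    unfolding prime_elem_def p_def[symmetric] by (auto simp: kernel)
qed


section \<open>Continuants\<close>

text \<open>\<open>cont a l\<close> is the continuant of the \<open>l - 1\<close> variables \<open>x\<^sub>a, \<dots>, x\<^sub>a\<^sub>+\<^sub>l\<^sub>-\<^sub>2\<close>; the shift by one
  makes room for the value \<open>0\<close> in front of the empty continuant \<open>1\<close>, as in \<open>z\<^sub>-\<^sub>1 = 0\<close>.\<close>

fun cont :: "nat \<Rightarrow> nat \<Rightarrow> 'k::field mpoly" where
  "cont a 0 = 0"
| "cont a (Suc 0) = 1"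
| "cont a (Suc (Suc l)) = cont a (Suc l) * pvar (a + l) - cont a l"

lemma z_cont: "z i = cont 1 (Suc i)"
  by (induction i rule: z.induct) auto

lemma cont_polys: "{a..<a + l - 1} \<subseteq> V \<Longrightarrow> cont a l \<in> polys V"
proof (induction a l rule: cont.induct)
  case (3 a l)
  have "{a..<a + Suc l - 1} \<subseteq> V" "{a..<a + l - 1} \<subseteq> V" "a + l \<in> V"
    using 3(3) by (auto simp: subset_iff)
  then show ?case using 3(1,2) by (auto intro!: polys_intros)
qed auto

lemma \<theta>_cont:
  "a + l \<le> n + 1 \<Longrightarrow> \<theta> n (cont a l) = (cont (Suc a) l :: 'k::field mpoly)"
proof (induction a l rule: cont.induct)
  case (3 a l)
  then show ?case by (simp add: \<theta>_def is_hom_pconst is_homD[OF is_hom_peval[OF is_hom_pconst]])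
qed (simp_all add: \<theta>_def is_homD[OF is_hom_peval[OF is_hom_pconst]])

lemma \<Omega>_cont:
  assumes "n \<ge> 3"
  shows "\<Omega> n = cont 1 n * pvar n - (cont 1 (n - 1) + cont 2 (n - 1))"
proof -
  have "n = Suc (Suc (n - 2))" using assms by simp
  then obtain m where n: "n = Suc (Suc m)" by blast
  show ?thesis using assms \<theta>_cont[of 1 "Suc m" n]
    by (simp add: \<Omega>_def z_cont n numeral_2_eq_2)
qed

text \<open>Continuants are symmetric under reversal of the variables, so the recursion also works
  at the left end; this is needed for brackets and derivatives involving x_1.\<close>

lemma cont_left:
  "cont a (Suc (Suc l)) = pvar a * cont (Suc a) (Suc l) - (cont (Suc (Suc a)) l :: 'k::field mpoly)"
proof (induction l rule: induct_nat_012)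
  case (ge2 l)
  have "cont a (Suc (Suc (Suc (Suc l)))) = cont a (Suc (Suc (Suc l))) * pvar (a + Suc (Suc l)) -
      (cont a (Suc (Suc l)) :: 'k mpoly)" by (rule cont.simps)
  then show ?case unfolding ge2 by (simp add: algebra_simps)
qed (simp_all add: algebra_simps)

text \<open>The left side is minus the determinant of a product of matrices with rows (x, -1) and
  (1, 0), each of determinant 1. Accordingly, appending a variable leaves it unchanged.\<close>

lemma cont_det:
  "cont a (Suc (Suc l)) * cont (Suc a) l - cont a (Suc l) * cont (Suc a) (Suc l) =
    (- 1 :: 'k::field mpoly)"
proof (induction l)
  case (Suc l)
  have "cont a (Suc (Suc (Suc l))) * cont (Suc a) (Suc l) -
      cont a (Suc (Suc l)) * cont (Suc a) (Suc (Suc l)) =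
    cont a (Suc (Suc l)) * cont (Suc a) l - cont a (Suc l) * (cont (Suc a) (Suc l) :: 'k mpoly)"
    by (simp add: algebra_simps)
  then show ?case unfolding Suc .
qed simp

section \<open>Degrees and primality of continuants\<close>

text \<open>Identifying all variables turns a continuant of k variables into the monic
  Chebyshev-type polynomial U_k(X/2) of degree k, so that non-divisibility follows by comparing
  degrees.\<close>

definition to_univ :: "'k::field mpoly \<Rightarrow> 'k poly" where
  "to_univ = peval (\<lambda>c. [:c:]) (\<lambda>_. [:0, 1:])"

lemma is_hom_const_poly: "is_hom (\<lambda>c::'k::field. [:c:])"
  by (simp add: is_hom_def)

lemma is_hom_to_univ: "is_hom to_univ"
  unfolding to_univ_def by (rule is_hom_peval[OF is_hom_const_poly])

lemmas to_univ_simps = is_homD[OF is_hom_to_univ]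

lemma to_univ_cont_rec:
  "to_univ (cont a (Suc (Suc l))) =
    pCons 0 (to_univ (cont a (Suc l))) - (to_univ (cont a l) :: 'k::field poly)"
  by (simp add: to_univ_simps) (simp add: to_univ_def is_hom_const_poly)

lemma to_univ_cont:
  "degree (to_univ (cont a (Suc l)) :: 'k::field poly) = l \<and>
    lead_coeff (to_univ (cont a (Suc l)) :: 'k poly) = 1"
proof (induction l rule: induct_nat_012)
  case (ge2 l)
  let ?p = "to_univ (cont a (Suc (Suc l))) :: 'k poly"
  let ?q = "to_univ (cont a (Suc l)) :: 'k poly"
  have p0: "?p \<noteq> 0" using ge2(2) by force
  then have d: "degree (pCons 0 ?p) = Suc (Suc l)" using ge2 by simp
  have lt: "degree (- ?q) < degree (pCons 0 ?p)" using d ge2 by simp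
  have eq: "to_univ (cont a (Suc (Suc (Suc l)))) = pCons 0 ?p + - ?q"
    by (simp only: to_univ_cont_rec[of a "Suc l"]) simp
  have "poly.coeff ?p (Suc l) = 1" using ge2(2) by metis
  then show ?case unfolding eq
    using degree_add_eq_left[OF lt] d lt
    by (simp add: coeff_eq_0 del: cont.simps(3))
qed (simp_all add: to_univ_cont_rec to_univ_simps del: cont.simps(3))

lemma to_univ_cont_indep: "to_univ (cont a l) = (to_univ (cont b l) :: 'k::field poly)"
  by (induction l rule: induct_nat_012)
    (simp_all only: to_univ_cont_rec, simp_all add: to_univ_simps)

lemma to_univ_cont_nz [simp]: "to_univ (cont a (Suc l)) \<noteq> (0 :: 'k::field poly)"
  using to_univ_cont[of a l, where 'k = 'k] by force

lemma cont_nz [simp]: "cont a (Suc l) \<noteq> (0 :: 'k::field mpoly)"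
  using to_univ_cont_nz[of a l, where 'k = 'k] to_univ_simps(4)[where 'a = 'k] by force

lemma cont_not_dvd:
  fixes f :: "'k::field mpoly"
  assumes "to_univ f \<noteq> 0" "degree (to_univ f) < l"
  shows "\<not> cont a (Suc l) dvd f"
proof
  assume "cont a (Suc l) dvd f"
  then obtain g where g: "to_univ f = to_univ (cont a (Suc l)) * to_univ g"
    by (auto simp: to_univ_simps elim!: dvdE)
  then have "degree (to_univ f) = l + degree (to_univ g)"
    using assms(1) to_univ_cont[of a l, where 'k = 'k]
    by (subst g, subst degree_mult_eq) auto
  then show False using assms(2) by simp
qed

text \<open>By induction: the continuant is linear in its last variable, its leading coefficient is
  the preceding continuant, a prime, and the constant term has too small a degree to be divisible by
  that prime.\<close>

lemma prime_elem_cont: "prime_elem (cont a (Suc (Suc l)) :: 'k::field mpoly)"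
proof (induction l)
  case 0
  show ?case
    using linear_prime_elem(1)[of "1::'k mpoly" a 0] by simp
next
  case (Suc l)
  have "to_univ (cont a (Suc l)) \<noteq> (0::'k poly)" "degree (to_univ (cont a (Suc l)) :: 'k poly) < Suc l"
    using to_univ_cont[of a l, where 'k = 'k] by auto
  then have "\<not> cont a (Suc (Suc l)) dvd (cont a (Suc l) :: 'k mpoly)" by (rule cont_not_dvd)
  then have "prime_elem (cont a (Suc (Suc l)) * pvar (a + Suc l) - (cont a (Suc l) :: 'k mpoly))"
    using Suc by (intro linear_prime_elem(1) cont_polys) (auto simp: prime_elem_dvd_mult_iff)
  then show ?case by simp
qed

text \<open>The common form of z_v - a and \<Omega> - a. For \<open>v \<ge> 2\<close> the leading
  coefficient is a prime of degree \<open>v - 1\<close>, so it cannot divide \<open>b\<close>; for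
  \<open>v = 1\<close> it is 1. The second claim later shows that such an element divides no
  monomial in z_1, ..., z_{v-1}.\<close>

lemma linear_over_cont_prime_elem:
  fixes b :: "'k::field mpoly"
  assumes "v \<ge> 1" "b \<in> polys (- {v})"
    and "v \<ge> 2 \<Longrightarrow> to_univ b \<noteq> 0 \<and> degree (to_univ b) < v - 1"
  shows "prime_elem (cont 1 v * pvar v - b)"
    and "r \<in> polys (- {v}) \<Longrightarrow> cont 1 v * pvar v - b dvd r \<Longrightarrow> r = 0"
proof -
  have a: "cont 1 v \<in> polys (- {v})" by (rule cont_polys) auto
  have nz: "cont 1 v \<noteq> (0 :: 'k mpoly)" using cont_nz[of 1 "v - 1"] assms(1) by simp
  have cancel: "cont 1 v dvd q" if "cont 1 v dvd b * q" for q
  proof (cases "v = 1")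
    case False
    then have "2 \<le> v" using assms(1) by simp
    then obtain l where v: "v = Suc (Suc l)"
      by (metis add_2_eq_Suc le_Suc_ex)
    have "\<not> cont 1 v dvd b" using assms(3) unfolding v by (intro cont_not_dvd) auto
    then show ?thesis
      using that prime_elem_cont[of 1 l] prime_elem_dvd_multD unfolding v by blast
  qed simp
  show "prime_elem (cont 1 v * pvar v - b)"
    and "r \<in> polys (- {v}) \<Longrightarrow> cont 1 v * pvar v - b dvd r \<Longrightarrow> r = 0"
    using linear_prime_elem[OF a nz assms(2) cancel] by blast+
qed

lemma to_univ_pconst [simp]: "to_univ (pconst c) = [:c:]"
  by (simp add: to_univ_def is_hom_const_poly)


section \<open>Brackets of continuants with variables\<close>

text \<open>The sign of the quadratic term of {x_i, x_j}. The parity of \<open>i + j\<close> is that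
  of the difference without its truncation.\<close>

definition eps :: "nat \<Rightarrow> nat \<Rightarrow> 'k::field mpoly" where
  "eps i j = (if i < j then 1 else if j < i then - 1 else 0) * (if odd (i + j) then 1 else - 1)"

text \<open>The bracket \<open>{x\<^sub>i, x\<^sub>j}\<close> without the wrap-around relation between \<open>x\<^sub>n\<close> and \<open>x\<^sub>1\<close>.\<close>

definition lin_coeff :: "nat \<Rightarrow> nat \<Rightarrow> 'k::field mpoly" where
  "lin_coeff i j = eps i j * pvar i * pvar j
     - (if j = Suc i then 1 else 0) + (if i = Suc j then 1 else 0)"

text \<open>For odd \<open>n\<close> the difference \<open>n - 1\<close> is even, so {x_1, x_n} = 1
  - x_1 x_n has the quadratic part prescribed by \<open>eps\<close>; the wrap-around relation
  deviates only by a constant.\<close>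

lemma bracket_coeff_lin:
  assumes "odd n" "n \<ge> 3" "i \<in> {1..n}" "j \<in> {1..n}"
  shows "bracket_coeff n i j = lin_coeff i j + (if i = 1 \<and> j = n then 1 else 0)
    - (if i = n \<and> j = 1 then 1 else 0)"
proof (cases i j rule: linorder_cases)
  case less
  then show ?thesis using assms
    by (auto simp: bracket_coeff_def bracket_coeff_less_def lin_coeff_def eps_def mult.commute)
next
  case greater
  then show ?thesis using assms
    by (auto simp: bracket_coeff_def bracket_coeff_less_def lin_coeff_def eps_def mult.commute)
qed (use assms in \<open>auto simp: bracket_coeff_def lin_coeff_def eps_def\<close>)

context
  fixes D :: "'k::field mpoly \<Rightarrow> 'k mpoly" and j :: nat
  assumes D: "is_derivation D"
begin

text \<open>\<open>D\<close> stands for the bracket with x_j, possibly corrected as described below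
  for j = 1 and j = n; here all variables lie to the left of x_j. The signs \<open>eps i j\<close>
  alternate in \<open>i\<close> and cancel along deleted adjacent pairs, leaving a weight only for
  an odd number \<open>l - 1\<close> of variables. If x_j is adjacent to the last variable, the
  constant in their bracket adds a shorter continuant.\<close>

lemma derivation_cont_right:
  assumes "\<And>i. a \<le> i \<Longrightarrow> i + 1 < a + l \<Longrightarrow> D (pvar i) = lin_coeff i j" "a + l \<le> Suc j"
  shows "D (cont a l) = (if even l then eps a j * cont a l * pvar j else 0)
    - (if Suc j = a + l then cont a (l - 1) else 0)"
  using assms
proof (induction a l rule: cont.induct)
  case (3 a l)
  have 1: "D (cont a (Suc l)) = (if odd l then eps a j * cont a (Suc l) * pvar j else 0)"
    using 3(1)[OF 3(3)] 3(4) by auto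
  have 2: "D (cont a l) = (if even l then eps a j * cont a l * pvar j else 0)"
    using 3(2)[OF 3(3)] 3(4) by auto
  have v: "D (pvar (a + l)) = lin_coeff (a + l) j" using 3(3) by simp
  have "D (cont a (Suc (Suc l))) =
      D (cont a (Suc l)) * pvar (a + l) + cont a (Suc l) * lin_coeff (a + l) j - D (cont a l)"
    by (simp add: is_derivationD[OF D] v)
  then show ?case unfolding 1 2 using "3.prems"(2)
    by (auto simp: lin_coeff_def eps_def algebra_simps)
qed (simp_all add: is_derivationD[OF D])

text \<open>Now x_j is one of the variables. The constants in its brackets with x_{j-1} and x_{j+1}
  correct the weights of the monomials from which x_j was deleted together with a neighbour, so all
  monomials again have a common weight.\<close>

lemma derivation_cont_middle:
  assumes "\<And>i. a \<le> i \<Longrightarrow> i + 1 < a + l \<Longrightarrow> D (pvar i) = lin_coeff i j" "a \<le> j" "Suc j < a + l"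
  shows "D (cont a l) =
    (if odd l then (if even (a + j) then - 1 else 1) * cont a l * pvar j else 0)"
  using assms
proof (induction a l rule: cont.induct)
  case (3 a l)
  have v: "D (pvar (a + l)) = lin_coeff (a + l) j" using 3(3) by simp
  have rec: "D (cont a (Suc (Suc l))) =
      D (cont a (Suc l)) * pvar (a + l) + cont a (Suc l) * lin_coeff (a + l) j - D (cont a l)"
    by (simp add: is_derivationD[OF D] v)
  \<comment> \<open>The variable appended last is x_j itself, its right neighbour, or one further
    right. In the first two cases a shorter continuant lies left of x_j, which is the situation of
    \<open>derivation_cont_right\<close>.\<close>
  consider "j = a + l" | "Suc j = a + l" | "Suc j < a + l" using 3(5) by linarith
  then show ?case
  proof cases
    case 1
    have A: "D (cont a (Suc l)) = (if odd l then eps a j * cont a (Suc l) * pvar j else 0) - cont a l"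
      using derivation_cont_right[of a "Suc l"] 3(3) 1 by simp
    have B: "D (cont a l) = (if even l then eps a j * cont a l * pvar j else 0)"
      using derivation_cont_right[of a l] 3(3) 1 by simp
    show ?thesis unfolding rec A B using 1
      by (cases "l = 0") (auto simp: lin_coeff_def eps_def algebra_simps)
  next
    case 2
    then obtain l' where l': "l = Suc l'" using 3(4) by (cases l) auto
    have A: "D (cont a (Suc l)) =
        (if even l then (if even (a + j) then - 1 else 1) * cont a (Suc l) * pvar j else 0)"
      using 3(1)[OF 3(3)] 3(4) 2 by auto
    have B: "D (cont a l) = (if even l then eps a j * cont a l * pvar j else 0) - cont a l'"
      using derivation_cont_right[of a l] 3(3) 2 l' by simp
    have "j = a + l'" using 2 l' by simp
    then show ?thesis unfolding rec A B using 2
      by (cases "l' = 0") (auto simp: l' lin_coeff_def eps_def algebra_simps)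
  next
    case 3
    have A: "D (cont a (Suc l)) =
        (if even l then (if even (a + j) then - 1 else 1) * cont a (Suc l) * pvar j else 0)"
      using "3.IH"(1)[OF "3.prems"(1)] "3.prems" 3 by auto
    have B: "D (cont a l) =
        (if odd l then (if even (a + j) then - 1 else 1) * cont a l * pvar j else 0)"
      using "3.IH"(2)[OF "3.prems"(1)] "3.prems" 3 by auto
    show ?thesis unfolding rec A B using 3
      by (auto simp: lin_coeff_def eps_def algebra_simps)
  qed
qed (simp_all add: is_derivationD[OF D])

lemma derivation_cont_left:
  assumes "\<And>i. a \<le> i \<Longrightarrow> i + 1 < a + l \<Longrightarrow> D (pvar i) = lin_coeff i j" "j < a"
  shows "D (cont a l) = (if even l then eps a j * cont a l * pvar j else 0)
    + (if a = Suc j then cont (Suc a) (l - 1) else 0)"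
  using assms
proof (induction a l rule: cont.induct)
  case (3 a l)
  have v: "D (pvar (a + l)) = lin_coeff (a + l) j" using 3(3) by simp
  have 1: "D (cont a (Suc l)) = (if odd l then eps a j * cont a (Suc l) * pvar j else 0)
      + (if a = Suc j then cont (Suc a) l else 0)"
    using 3(1)[OF 3(3)] 3(4) by auto
  have 2: "D (cont a l) = (if even l then eps a j * cont a l * pvar j else 0)
      + (if a = Suc j then cont (Suc a) (l - 1) else 0)"
    using 3(2)[OF 3(3)] 3(4) by auto
  have "D (cont a (Suc (Suc l))) =
      D (cont a (Suc l)) * pvar (a + l) + cont a (Suc l) * lin_coeff (a + l) j - D (cont a l)"
    by (simp add: is_derivationD[OF D] v)
  then show ?case unfolding 1 2 using "3.prems"(2)
    by (cases l) (auto simp: lin_coeff_def eps_def algebra_simps)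
qed (simp_all add: is_derivationD[OF D])

end


section \<open>The Poisson bracket\<close>

lemma bracket_coeff_antisym: "bracket_coeff n i j = - bracket_coeff n j i"
  by (auto simp: bracket_coeff_def)

lemma C_bracket_antisym: "C_bracket n f g = - C_bracket n g f"
proof -
  have "C_bracket n f g =
      (\<Sum>j\<in>{1..n}. \<Sum>i\<in>{1..n}. bracket_coeff n i j * pderivative i f * pderivative j g)"
    unfolding C_bracket_def by (rule sum.swap)
  also have "\<dots> = (\<Sum>j\<in>{1..n}. \<Sum>i\<in>{1..n}. - (bracket_coeff n j i * pderivative j g * pderivative i f))"
    by (intro sum.cong refl, subst bracket_coeff_antisym) (simp add: mult_ac)
  finally show ?thesis by (simp add: C_bracket_def sum_negf)
qed

lemma is_derivation_C_bracket_left: "is_derivation (\<lambda>f. C_bracket n f g)"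
  by (simp add: is_derivation_def C_bracket_mult_left)
    (simp add: C_bracket_def pderivative_add algebra_simps flip: sum.distrib)

lemma is_derivation_C_bracket_right: "is_derivation (\<lambda>g. C_bracket n f g)"
  by (simp add: is_derivation_def C_bracket_mult_right)
    (simp add: C_bracket_def pderivative_add algebra_simps flip: sum.distrib)

lemmas C_bracket_left = is_derivationD[OF is_derivation_C_bracket_left]
lemmas C_bracket_right = is_derivationD[OF is_derivation_C_bracket_right]

lemma C_bracket_pconst [simp]: "C_bracket n (pconst c) g = 0" "C_bracket n g (pconst c) = 0"
  by (simp_all add: C_bracket_def)

lemma bracket_coeff_less_polys:
  "i \<in> V \<Longrightarrow> j \<in> V \<Longrightarrow> bracket_coeff_less n i j \<in> (polys V :: 'k::field mpoly set)"
  unfolding bracket_coeff_less_def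
  by (auto intro!: polys_diff polys_mult polys_pvar polys_uminus)

lemma bracket_coeff_polys:
  "i \<in> V \<Longrightarrow> j \<in> V \<Longrightarrow> bracket_coeff n i j \<in> polys V"
  unfolding bracket_coeff_def by (auto intro!: bracket_coeff_less_polys polys_uminus)

lemma C_bracket_polys:
  assumes "f \<in> polys V" "g \<in> polys V"
  shows "C_bracket n f g \<in> polys V"
  unfolding C_bracket_def
proof (intro polys_sum)
  fix i j
  show "bracket_coeff n i j * pderivative i f * pderivative j g \<in> polys V"
  proof (cases "i \<in> V \<and> j \<in> V")
    case True
    then show ?thesis
      by (intro polys_mult bracket_coeff_polys pderivative_polys assms) auto
  next
    case False
    then have "pderivative i f = 0 \<or> pderivative j g = 0"
      using pderivative_eq_0[OF assms(1)] pderivative_eq_0[OF assms(2)] by blast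
    then show ?thesis by auto
  qed
qed

lemma derivation_eq_0:
  assumes D: "is_derivation D" and "f \<in> polys V"
    and "\<And>c. D (pconst c) = 0" "\<And>i. i \<in> V \<Longrightarrow> D (pvar i) = 0"
  shows "D f = 0"
  using assms(2) by (induction rule: polys_induct) (simp_all add: assms is_derivationD[OF D])

lemma cont_rec:
  assumes "2 \<le> l"
  shows "cont a l = cont a (l - 1) * pvar (a + l - 2) - (cont a (l - 2) :: 'a::field mpoly)"
    and "cont a l = pvar a * cont (a + 1) (l - 1) - (cont (a + 2) (l - 2) :: 'a mpoly)"
proof -
  obtain m where "l = Suc (Suc m)" using assms by (metis add_2_eq_Suc le_Suc_ex)
  then show "cont a l = cont a (l - 1) * pvar (a + l - 2) - (cont a (l - 2) :: 'a mpoly)"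
    "cont a l = pvar a * cont (a + 1) (l - 1) - (cont (a + 2) (l - 2) :: 'a mpoly)"
    using cont_left[of a m, where 'k = 'a] by (simp_all del: cont.simps(3)) simp
qed

text \<open>The monomials of a continuant arise from the full product by deleting adjacent pairs,
  and adjacent variables have opposite weights. So all monomials share the alternating sum of the
  weights, which is 0 or the weight of x_a.\<close>

lemma derivation_weight_cont:
  fixes D :: "'k::field mpoly \<Rightarrow> 'k mpoly"
  assumes D: "is_derivation D"
    and "\<And>i. a \<le> i \<Longrightarrow> i + 1 < a + l \<Longrightarrow> D (pvar i) = (if even i then 1 else - 1) * c * pvar i"
  shows "D (cont a l) = (if even l then (if even a then 1 else - 1) * c * cont a l else 0)"
  using assms(2)
proof (induction a l rule: cont.induct)
  case (3 a l)
  have v: "D (pvar (a + l)) = (if even (a + l) then 1 else - 1) * c * pvar (a + l)"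
    by (rule 3(3)) auto
  have "D (cont a (Suc (Suc l))) =
      D (cont a (Suc l)) * pvar (a + l) + cont a (Suc l) * D (pvar (a + l)) - D (cont a l)"
    by (simp add: is_derivationD[OF D])
  moreover have "D (cont a (Suc l)) =
      (if odd l then (if even a then 1 else - 1) * c * cont a (Suc l) else 0)"
    using 3(1)[OF 3(3)] by simp
  moreover have "D (cont a l) = (if even l then (if even a then 1 else - 1) * c * cont a l else 0)"
    using 3(2)[OF 3(3)] by simp
  ultimately show ?case unfolding v by (auto simp: algebra_simps)
qed (simp_all add: is_derivationD[OF D])

lemma pderivative_cont_left:
  "pderivative a (cont a (Suc (Suc l))) = (cont (Suc a) (Suc l) :: 'k::field mpoly)"
proof -
  have "pderivative a (cont (Suc a) (Suc l)) = (0 :: 'k mpoly)"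
    by (rule pderivative_eq_0[OF cont_polys[OF order_refl]]) auto
  moreover have "pderivative a (cont (Suc (Suc a)) l) = (0 :: 'k mpoly)"
    by (rule pderivative_eq_0[OF cont_polys[OF order_refl]]) auto
  ultimately show ?thesis
    unfolding cont_left by (simp add: is_derivationD[OF is_derivation_pderivative] pderivative_pvar)
qed

lemma pderivative_cont_right:
  "pderivative (a + l) (cont a (Suc (Suc l))) = (cont a (Suc l) :: 'k::field mpoly)"
proof -
  have "pderivative (a + l) (cont a (Suc l)) = (0 :: 'k mpoly)"
    by (rule pderivative_eq_0[OF cont_polys[OF order_refl]]) auto
  moreover have "pderivative (a + l) (cont a l) = (0 :: 'k mpoly)"
    by (rule pderivative_eq_0[OF cont_polys[OF order_refl]]) auto
  ultimately show ?thesis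
    by (simp add: is_derivationD[OF is_derivation_pderivative] pderivative_pvar)
qed

lemma polys_le: "f \<in> polys {1..m} \<Longrightarrow> m \<le> n \<Longrightarrow> f \<in> polys {1..n}"
  using polys_mono[of "{1..m}" "{1..n}"] by auto

lemma cont_in_F: "a \<ge> 1 \<Longrightarrow> a + l \<le> n + 2 \<Longrightarrow> cont a l \<in> polys {1..n}"
  by (rule cont_polys) auto

lemma z_in_F: "i \<le> n \<Longrightarrow> z i \<in> polys {1..n}"
  unfolding z_cont by (rule cont_in_F) auto

section \<open>Brackets of the z_i and centrality of \<Omega>\<close>

context
  fixes n :: nat
  assumes n3: "n \<ge> 3" and n_odd: "odd n"
begin

lemma C_bracket_lin:
  assumes "i \<in> {1..n}" "j \<in> {1..n}" "\<not> (i = 1 \<and> j = n)" "\<not> (i = n \<and> j = 1)"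
  shows "C_bracket n (pvar i) (pvar j) = lin_coeff i j"
  using assms by (simp add: C_bracket_pvar[OF assms(1,2)] bracket_coeff_lin[OF n_odd n3] del: One_nat_def)

text \<open>Correcting by a partial derivative hides the wrap-around relation.\<close>

lemma C_bracket_first:
  assumes "i \<in> {1..n}"
  shows "C_bracket n (pvar i) (pvar 1) + pderivative n (pvar i) = lin_coeff i 1"
  using assms n3 by (auto simp: C_bracket_pvar bracket_coeff_lin[OF n_odd n3] pderivative_pvar)

lemma C_bracket_last:
  assumes "i \<in> {1..n}"
  shows "C_bracket n (pvar i) (pvar n) - pderivative 1 (pvar i) = lin_coeff i n"
  using assms n3 by (auto simp: C_bracket_pvar bracket_coeff_lin[OF n_odd n3] pderivative_pvar)

lemma is_derivation_first: "is_derivation (\<lambda>f. C_bracket n f (pvar 1) + pderivative n f)"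
  and is_derivation_last: "is_derivation (\<lambda>f. C_bracket n f (pvar n) - pderivative 1 f)"
  by (simp_all add: is_derivation_def C_bracket_left pderivative_add pderivative_mult algebra_simps)

text \<open>Modulo z_i the bracket is -z_{i-1}; this drives the descent in
  \<open>z_descent\<close>.\<close>

lemma C_bracket_z_next:
  assumes "Suc i < n"
  shows "C_bracket n (cont 1 (Suc i)) (pvar (Suc i)) =
    (if odd i then pvar (Suc i) else 0) * cont 1 (Suc i) - (cont 1 i :: 'k::field mpoly)"
proof -
  have "C_bracket n (cont 1 (Suc i)) (pvar (Suc i)) =
      (if even (Suc i) then eps 1 (Suc i) * cont 1 (Suc i) * pvar (Suc i) else 0)
      - (if Suc (Suc i) = 1 + Suc i then cont 1 (Suc i - 1) else (0 :: 'k mpoly))"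
    using assms
    by (intro derivation_cont_right is_derivation_C_bracket_left C_bracket_lin) auto
  then show ?thesis by (cases "i = 0") (auto simp: eps_def mult_ac)
qed

text \<open>Here \<open>cont 2 (n - 1)\<close> is \<theta>(z_{n-2}); it comes from the wrap-around
  relation, as the derivative of z_{n-1} in x_1.\<close>

lemma C_bracket_z_last:
  "C_bracket n (cont 1 n) (pvar n) = cont 2 (n - 1) - (cont 1 (n - 1) :: 'k::field mpoly)"
proof -
  have "C_bracket n (cont 1 n) (pvar n) - pderivative 1 (cont 1 n) =
      (if even n then eps 1 n * cont 1 n * pvar n else 0)
      - (if Suc n = 1 + n then cont 1 (n - 1) else (0 :: 'k mpoly))"
    by (rule derivation_cont_right[OF is_derivation_last C_bracket_last]) auto
  moreover have "n = Suc (Suc (n - 2))" using n3 by simp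
  then have "pderivative 1 (cont 1 n) = (cont (Suc 1) (Suc (n - 2)) :: 'k mpoly)"
    using pderivative_cont_left[of 1 "n - 2"] by metis
  moreover have "Suc (n - 2) = n - 1" using n3 by simp
  ultimately show ?thesis using n_odd by (simp add: numeral_2_eq_2 algebra_simps)
qed

text \<open>Where z_{n-2} is a constant l with l^2 = 1, the bracket must vanish, which solves for
  x_n. This is the origin of the generator x_n - l \<theta>(z_{n-3}) of M_l.\<close>

lemma C_bracket_z_prev_last:
  "C_bracket n (cont 1 (n - 1)) (pvar n) =
    cont 2 (n - 2) - pvar n * (cont 1 (n - 1) :: 'k::field mpoly)"
proof -
  have "C_bracket n (cont 1 (n - 1)) (pvar n) - pderivative 1 (cont 1 (n - 1)) =
      (if even (n - 1) then eps 1 n * cont 1 (n - 1) * pvar n else 0)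
      - (if Suc n = 1 + (n - 1) then cont 1 (n - 1 - 1) else (0 :: 'k mpoly))"
    using n3 by (intro derivation_cont_right[OF is_derivation_last C_bracket_last]) auto
  moreover have "n - 1 = Suc (Suc (n - 3))" using n3 by simp
  then have "pderivative 1 (cont 1 (n - 1)) = (cont (Suc 1) (Suc (n - 3)) :: 'k mpoly)"
    using pderivative_cont_left[of 1 "n - 3"] by metis
  then have "pderivative 1 (cont 1 (n - 1)) = (cont 2 (n - 2) :: 'k mpoly)"
    using n3 by (simp add: Suc_diff_le numeral_2_eq_2 numeral_3_eq_3 Suc_diff_Suc)
  moreover have "eps 1 n = (- 1 :: 'k mpoly)" "even (n - 1)" "Suc n \<noteq> 1 + (n - 1)"
    using n_odd n3 by (auto simp: eps_def)
  ultimately show ?thesis by (simp add: algebra_simps)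
qed

text \<open>For odd \<open>i\<close> this says that z_i commutes with x_1, ..., x_i. The case
  \<open>i = n - 2\<close> is the centrality of z_{n-2} in F_{n-2} on which M_1 and M_{-1}
  rest.\<close>

lemma C_bracket_z_pvar:
  assumes "i < n" "1 \<le> j" "j \<le> i"
  shows "C_bracket n (cont 1 (Suc i)) (pvar j) =
    (if even i then (if even j then 1 else - 1) * cont 1 (Suc i) * pvar j else (0 :: 'k::field mpoly))"
proof -
  have "C_bracket n (cont 1 (Suc i)) (pvar j) =
      (if odd (Suc i) then (if even (1 + j) then - 1 else 1) * cont 1 (Suc i) * pvar j else (0 :: 'k mpoly))"
    using assms
    by (intro derivation_cont_middle is_derivation_C_bracket_left C_bracket_lin) auto
  then show ?thesis by auto
qed

lemma C_bracket_z_cont: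
  assumes "i < n" "1 \<le> a" "a + l \<le> i + 2"
  shows "C_bracket n (cont 1 (Suc i)) (cont a l) =
    (if even i \<and> even l then (if even a then 1 else - 1) * cont 1 (Suc i) * cont a l
     else (0 :: 'k::field mpoly))"
proof -
  let ?c = "if even i then cont 1 (Suc i) else (0 :: 'k mpoly)"
  have "C_bracket n (cont 1 (Suc i)) (cont a l) =
      (if even l then (if even a then 1 else - 1) * ?c * cont a l else 0)"
    using assms
    by (intro derivation_weight_cont is_derivation_C_bracket_right, subst C_bracket_z_pvar) auto
  then show ?thesis by simp
qed

lemma C_bracket_z:
  assumes "i < n" "j < n" "1 \<le> i" "1 \<le> j"
  shows "C_bracket n (z i) (z j) = of_int (\<Lambda> i j) * z i * (z j :: 'k::field mpoly)"
proof -
  have *: "C_bracket n (z i) (z j) = of_int (\<Lambda> i j) * z i * (z j :: 'k mpoly)"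
    if "j \<le> i" "i < n" for i j
    using that C_bracket_z_cont[of i 1 "Suc j"] unfolding z_cont
    by (cases "i = j") (auto simp: \<Lambda>_def simp del: cont.simps)
  show ?thesis
  proof (cases "j \<le> i")
    case False
    then have "C_bracket n (z j) (z i) = of_int (\<Lambda> j i) * z j * (z i :: 'k mpoly)"
      using assms by (intro *) auto
    moreover have "\<Lambda> j i = - \<Lambda> i j" using False by (auto simp: \<Lambda>_def)
    ultimately show ?thesis using C_bracket_antisym[of n "z i :: 'k mpoly" "z j"] by (simp add: mult_ac)
  qed (use * assms in auto)
qed

text \<open>This is the trace of the product of the matrices with rows (x_i, -1) and (1, 0), a
  cyclically symmetric form of \<Omega>.\<close>

lemma \<Omega>_cont_diff: "\<Omega> n = cont 1 (Suc n) - (cont 2 (n - 1) :: 'k::field mpoly)"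
proof -
  obtain m where n: "n = Suc m" using n3 by (cases n) auto
  show ?thesis by (simp add: \<Omega>_cont[OF n3]) (simp add: n)
qed

text \<open>For an inner x_j both continuants in \<open>\<Omega>_cont_diff\<close> have an odd
  number of variables, so both brackets vanish. For x_n and x_1 the two brackets are equal, namely
  \<open>cont 2 n\<close> and \<open>- cont 1 n\<close>, and cancel.\<close>

lemma C_bracket_\<Omega>_pvar:
  assumes "j \<in> {1..n}"
  shows "C_bracket n (\<Omega> n) (pvar j) = (0 :: 'k::field mpoly)"
proof -
  have split: "C_bracket n (\<Omega> n) (pvar j) =
      C_bracket n (cont 1 (Suc n)) (pvar j) - (C_bracket n (cont 2 (n - 1)) (pvar j) :: 'k mpoly)"
    by (simp only: \<Omega>_cont_diff C_bracket_left)
  have *: "even (n - 1)" "Suc n = 2 + (n - 1)" "Suc 1 = 2" "Suc (n - 1) = n" "1 + (n - 1) = n"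
    "n - 1 - 1 = n - 2" "2 + n - 2 = n" "Suc 2 = 3" "1 + 2 = 3" "1 + 1 = 2"
    using n_odd n3 by auto
  consider "j = n" | "j = 1" | "1 < j" "j < n" using assms by force
  then show ?thesis
  proof cases
    case 1
    have "C_bracket n (cont 1 (Suc n)) (pvar n) - pderivative 1 (cont 1 (Suc n)) =
        (if odd (Suc n) then (if even (1 + n) then - 1 else 1) * cont 1 (Suc n) * pvar n
         else (0 :: 'k mpoly))"
      using n3 by (intro derivation_cont_middle[OF is_derivation_last C_bracket_last]) auto
    moreover have "pderivative 1 (cont 1 (Suc n)) = (cont 2 n :: 'k mpoly)"
      using pderivative_cont_left[of 1 "n - 1"] unfolding * .
    ultimately have A: "C_bracket n (cont 1 (Suc n)) (pvar n) = (cont 2 n :: 'k mpoly)"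
      using n_odd by (simp del: cont.simps)
    have B: "C_bracket n (cont 2 (n - 1)) (pvar n) =
        (if even (n - 1) then eps 2 n * cont 2 (n - 1) * pvar n else 0)
        - (if Suc n = 2 + (n - 1) then cont 2 (n - 1 - 1) else (0 :: 'k mpoly))"
      using n3
      by (intro derivation_cont_right is_derivation_C_bracket_left C_bracket_lin) auto
    moreover have "eps 2 n = (1 :: 'k mpoly)" using n_odd n3 by (auto simp: eps_def)
    moreover have "cont 2 n = cont 2 (n - 1) * pvar n - (cont 2 (n - 1 - 1) :: 'k mpoly)"
      using cont_rec(1)[of n 2] n3 unfolding * by simp
    ultimately have B: "C_bracket n (cont 2 (n - 1)) (pvar n) = (cont 2 n :: 'k mpoly)"
      unfolding B if_P[OF *(1)] if_P[OF *(2)] by simp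
    show ?thesis using split unfolding 1 A B by simp
  next
    case 2
    have "C_bracket n (cont 1 (Suc n)) (pvar 1) + pderivative n (cont 1 (Suc n)) =
        (if odd (Suc n) then (if even (1 + 1 :: nat) then - 1 else 1) * cont 1 (Suc n) * pvar 1
         else (0 :: 'k mpoly))"
      using n3 by (intro derivation_cont_middle[OF is_derivation_first C_bracket_first]) auto
    moreover have "pderivative n (cont 1 (Suc n)) = (cont 1 n :: 'k mpoly)"
      using pderivative_cont_right[of 1 "n - 1"] unfolding * .
    ultimately have A: "C_bracket n (cont 1 (Suc n)) (pvar 1) = - (cont 1 n :: 'k mpoly)"
      using n_odd by (simp del: cont.simps add: eq_neg_iff_add_eq_0)
    have B: "C_bracket n (cont 2 (n - 1)) (pvar 1) =
        (if even (n - 1) then eps 2 1 * cont 2 (n - 1) * pvar 1 else 0)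
        + (if 2 = Suc 1 then cont (Suc 2) (n - 1 - 1) else (0 :: 'k mpoly))"
      using n3
      by (intro derivation_cont_left is_derivation_C_bracket_left C_bracket_lin) auto
    moreover have "cont 1 n = pvar 1 * cont 2 (n - 1) - (cont (Suc 2) (n - 1 - 1) :: 'k mpoly)"
      using cont_rec(2)[of n 1] n3 unfolding * by simp
    moreover have "eps 2 1 = (- 1 :: 'k mpoly)" by (simp add: eps_def)
    ultimately have B: "C_bracket n (cont 2 (n - 1)) (pvar 1) = - (cont 1 n :: 'k mpoly)"
      unfolding B if_P[OF *(1)] if_P[OF *(3)[symmetric]] by simp
    show ?thesis using split unfolding 2 A B by simp
  next
    case 3
    have "C_bracket n (cont 1 (Suc n)) (pvar j) =
        (if odd (Suc n) then (if even (1 + j) then - 1 else 1) * cont 1 (Suc n) * pvar j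
         else (0 :: 'k mpoly))"
      using 3 by (intro derivation_cont_middle is_derivation_C_bracket_left C_bracket_lin) auto
    moreover have "C_bracket n (cont 2 (n - 1)) (pvar j) =
        (if odd (n - 1) then (if even (2 + j) then - 1 else 1) * cont 2 (n - 1) * pvar j
         else (0 :: 'k mpoly))"
      using 3 by (intro derivation_cont_middle is_derivation_C_bracket_left C_bracket_lin) auto
    ultimately show ?thesis using n_odd unfolding split by simp
  qed
qed

lemma C_bracket_\<Omega>:
  assumes "f \<in> polys {1..n}"
  shows "C_bracket n (\<Omega> n) f = (0 :: 'k::field mpoly)" "C_bracket n f (\<Omega> n) = (0 :: 'k mpoly)"
proof -
  show 1: "C_bracket n (\<Omega> n) f = 0"
    by (rule derivation_eq_0[OF is_derivation_C_bracket_right assms])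
      (auto simp: C_bracket_\<Omega>_pvar)
  show "C_bracket n f (\<Omega> n) = 0"
    using 1 C_bracket_antisym[of n f "\<Omega> n"] by simp
qed

lemma \<Omega>_in_F: "\<Omega> n \<in> polys {1..n}"
  unfolding \<Omega>_cont_diff using n3 by (intro polys_diff cont_in_F) auto

lemma log_canonical_ygen: "log_canonical n \<Lambda> (ygen n :: nat \<Rightarrow> 'k::field mpoly) (C_bracket n)"
  unfolding log_canonical_def
proof (intro ballI)
  fix i j
  assume ij: "i \<in> {1..n}" "j \<in> {1..n}"
  have in_F: "(ygen n k :: 'k mpoly) \<in> polys {1..n}" if "k \<in> {1..n}" for k
    using that by (cases "k = n") (simp_all add: ygen_def z_in_F \<Omega>_in_F del: One_nat_def)
  show "C_bracket n (ygen n i) (ygen n j) = of_int (\<Lambda> i j) * ygen n i * (ygen n j :: 'k mpoly)"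
  proof (cases "i = n \<or> j = n")
    case True
    \<comment> \<open>The last row and column of the matrix vanish because \<open>n\<close> is odd
      and is the largest index.\<close>
    then have "\<Lambda> i j = 0" using ij n_odd by (auto simp: \<Lambda>_def)
    moreover have "C_bracket n (ygen n i) (ygen n j) = (0 :: 'k mpoly)"
      using True C_bracket_\<Omega>(1)[OF in_F[OF ij(2)]] C_bracket_\<Omega>(2)[OF in_F[OF ij(1)]]
      by (auto simp: ygen_def)
    ultimately show ?thesis by simp
  next
    case False
    then show ?thesis using ij C_bracket_z[of i j] by (simp add: ygen_def)
  qed
qed

end


declare One_nat_def [simp del]

section \<open>Poisson ideals of \<open>F\<^sub>n\<close>\<close>

lemma FC_simps [simp]:
  "carrier (FC n) = polys {1..n}" "x \<otimes>\<^bsub>FC n\<^esub> y = x * y" "x \<oplus>\<^bsub>FC n\<^esub> y = x + y"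
  "\<one>\<^bsub>FC n\<^esub> = 1" "\<zero>\<^bsub>FC n\<^esub> = 0" "bracket (FC n) = C_bracket n"
  by (simp_all add: FC_def with_bracket_def ring.extend_def F_def poly_carrier_polys)

lemma F_simps [simp]:
  "carrier (F n) = polys {1..n}" "x \<otimes>\<^bsub>F n\<^esub> y = x * y" "x \<oplus>\<^bsub>F n\<^esub> y = x + y"
  "\<one>\<^bsub>F n\<^esub> = 1" "\<zero>\<^bsub>F n\<^esub> = 0"
  by (simp_all add: F_def poly_carrier_polys)

lemma cring_FC: "cring (FC n :: 'k::field mpoly poisson_ring)"
proof (intro cringI abelian_groupI comm_monoidI)
  show "\<exists>y\<in>carrier (FC n). y \<oplus>\<^bsub>FC n\<^esub> x = \<zero>\<^bsub>FC n\<^esub>" if "x \<in> carrier (FC n)" for x :: "'k mpoly"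
    using that by (intro bexI[of _ "- x"]) (auto intro: polys_intros)
qed (auto simp: algebra_simps intro: polys_intros)

lemma cring_F: "cring (F n :: 'k::field mpoly ring)"
proof (intro cringI abelian_groupI comm_monoidI)
  show "\<exists>y\<in>carrier (F n). y \<oplus>\<^bsub>F n\<^esub> x = \<zero>\<^bsub>F n\<^esub>" if "x \<in> carrier (F n)" for x :: "'k mpoly"
    using that by (intro bexI[of _ "- x"]) (auto intro: polys_intros)
qed (auto simp: algebra_simps intro: polys_intros)

lemma FC_a_inv: "x \<in> polys {1..n} \<Longrightarrow> \<ominus>\<^bsub>FC n\<^esub> x = - x"
proof -
  interpret cring "FC n :: 'a mpoly poisson_ring" by (rule cring_FC)
  show "\<ominus>\<^bsub>FC n\<^esub> x = - x" if "x \<in> polys {1..n}"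
    using that by (intro minus_equality) (auto intro: polys_intros)
qed

definition pideal :: "nat \<Rightarrow> 'k::field mpoly set \<Rightarrow> bool" where
  "pideal n I \<longleftrightarrow> I \<subseteq> polys {1..n} \<and> 0 \<in> I \<and> (\<forall>a\<in>I. \<forall>b\<in>I. a + b \<in> I) \<and>
     (\<forall>a\<in>I. \<forall>r\<in>polys {1..n}. r * a \<in> I) \<and> (\<forall>a\<in>I. \<forall>b\<in>polys {1..n}. C_bracket n a b \<in> I)"

lemma pidealD:
  assumes "pideal n I"
  shows "a \<in> I \<Longrightarrow> a \<in> polys {1..n}" "0 \<in> I" "a \<in> I \<Longrightarrow> b \<in> I \<Longrightarrow> a + b \<in> I"
    "a \<in> I \<Longrightarrow> r \<in> polys {1..n} \<Longrightarrow> r * a \<in> I" "a \<in> I \<Longrightarrow> r \<in> polys {1..n} \<Longrightarrow> a * r \<in> I"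
    "a \<in> I \<Longrightarrow> r \<in> polys {1..n} \<Longrightarrow> C_bracket n a r \<in> I"
    "a \<in> I \<Longrightarrow> - a \<in> I" "a \<in> I \<Longrightarrow> b \<in> I \<Longrightarrow> a - b \<in> I"
    "a \<in> I \<Longrightarrow> r \<in> polys {1..n} \<Longrightarrow> C_bracket n r a \<in> I"
proof -
  show s: "a \<in> I \<Longrightarrow> a \<in> polys {1..n}" "0 \<in> I" "a \<in> I \<Longrightarrow> b \<in> I \<Longrightarrow> a + b \<in> I"
    and m: "a \<in> I \<Longrightarrow> r \<in> polys {1..n} \<Longrightarrow> r * a \<in> I"
    and c: "a \<in> I \<Longrightarrow> r \<in> polys {1..n} \<Longrightarrow> C_bracket n a r \<in> I" for a b r
    using assms by (auto simp: pideal_def)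
  show "a \<in> I \<Longrightarrow> r \<in> polys {1..n} \<Longrightarrow> a * r \<in> I" using m[of a r] by (simp add: mult.commute)
  show u: "a \<in> I \<Longrightarrow> - a \<in> I" for a using m[of a "- 1"] by (simp add: polys_uminus)
  show "a \<in> I \<Longrightarrow> b \<in> I \<Longrightarrow> a - b \<in> I" using s(3)[of a "- b"] u[of b] by simp
  show "a \<in> I \<Longrightarrow> r \<in> polys {1..n} \<Longrightarrow> C_bracket n r a \<in> I"
    using u[OF c, of a r] C_bracket_antisym[of n r a] by simp
qed

lemma pideal_sum:
  "pideal n I \<Longrightarrow> (\<And>i. i \<in> A \<Longrightarrow> f i \<in> I) \<Longrightarrow> (\<Sum>i\<in>A. f i) \<in> I"
  by (induction A rule: infinite_finite_induct) (auto intro: pidealD(2,3))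

lemma poisson_ideal_FC_iff: "poisson_ideal I (FC n) \<longleftrightarrow> pideal n I"
proof
  assume "poisson_ideal I (FC n)"
  then have "ideal I (FC n)" and b: "\<forall>a\<in>I. \<forall>b\<in>carrier (FC n). bracket (FC n) a b \<in> I"
    by (auto simp: poisson_ideal_def)
  interpret ideal I "FC n" by fact
  show "pideal n I"
    using b additive_subgroup.a_closed[OF additive_subgroup_axioms] additive_subgroup.a_subset[OF additive_subgroup_axioms]
      additive_subgroup.zero_closed[OF additive_subgroup_axioms] I_l_closed
    by (auto simp: pideal_def)
next
  assume I: "pideal n I"
  interpret cring "FC n" by (rule cring_FC)
  have "ideal I (FC n)"
  proof (intro idealI)
    show "subgroup I (add_monoid (FC n))"
    proof (rule group.subgroupI[OF a_group])
      show "inv\<^bsub>add_monoid (FC n)\<^esub> a \<in> I" if "a \<in> I" for a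
        using pidealD[OF I] that FC_a_inv[of a n] by (simp add: a_inv_def)
    qed (use pidealD[OF I] in auto)
  qed (use pidealD[OF I] in \<open>auto intro: ring_axioms\<close>)
  then show "poisson_ideal I (FC n)"
    using pidealD(6)[OF I] by (auto simp: poisson_ideal_def)
qed

lemma ideal_FC_principal:
  assumes "p \<in> polys {1..n}"
  shows "PIdl\<^bsub>FC n\<^esub> p = {f \<in> polys {1..n}. p dvd f}"
proof (cases "p = 0")
  case False
  show ?thesis
    using polys_dvd_cofactor[OF assms _ False] assms
    by (auto simp: cgenideal_def mult.commute intro: polys_intros elim!: dvdE)
qed (auto simp: cgenideal_def intro: exI[of _ 0])

lemma primeideal_FC_iff:
  assumes "pideal n P"
  shows "primeideal P (FC n) \<longleftrightarrow>
    1 \<notin> P \<and> (\<forall>a\<in>polys {1..n}. \<forall>b\<in>polys {1..n}. a * b \<in> P \<longrightarrow> a \<in> P \<or> b \<in> P)"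
proof -
  have id: "ideal P (FC n)" using assms poisson_ideal_FC_iff by (auto simp: poisson_ideal_def)
  have one: "P = polys {1..n} \<longleftrightarrow> 1 \<in> P"
    using pidealD(1,4)[OF assms, of 1] pidealD(1)[OF assms] by force
  show ?thesis
    using id one cring_FC[of n]
    by (auto simp: primeideal_def primeideal_axioms_def)
qed


subsection \<open>Radicals\<close>

text \<open>The exponent 0 does no harm: it requires 1 to be in the ideal, which is then
  everything.\<close>

definition rad :: "nat \<Rightarrow> 'k::field mpoly set \<Rightarrow> 'k mpoly set" where
  "rad n I = {f \<in> polys {1..n}. \<exists>k. f ^ k \<in> I}"

text \<open>If \<open>f\<^sup>k \<in> I\<close>, then applying the derivation \<open>D\<close> repeatedly shows
  \<open>f\<^sup>k\<^sup>-\<^sup>j (D f)\<^sup>2\<^sup>j \<in> I\<close>; this needs characteristic \<open>0\<close>.\<close>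

lemma derivation_power_in_ideal:
  fixes I :: "'k::field_char_0 mpoly set"
  assumes I: "pideal n I" and g: "g \<in> polys {1..n}" and f: "f \<in> polys {1..n}" and "f ^ k \<in> I"
  shows "C_bracket n f g ^ (2 * k) \<in> I"
proof -
  define D where "D = (\<lambda>f. C_bracket n f g)"
  have D: "is_derivation D" unfolding D_def by (rule is_derivation_C_bracket_left)
  have DI: "D a \<in> I" if "a \<in> I" for a using that g pidealD[OF I] by (simp add: D_def)
  have Dp: "D a \<in> polys {1..n}" if "a \<in> polys {1..n}" for a
    using that g C_bracket_polys by (simp add: D_def)
  have "f ^ (k - j) * D f ^ (2 * j) \<in> I" if "j \<le> k" for j
    using that
  proof (induction j)
    case (Suc j)
    define i where "i = k - Suc j"
    have i: "k - j = Suc i" using Suc.prems by (simp add: i_def)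
    have IH: "f ^ Suc i * D f ^ (2 * j) \<in> I" using Suc i by simp
    \<comment> \<open>\<open>s\<close> is the derivative of the second factor; \<open>j = 0\<close>
      is separate because \<open>2 * j - 1\<close> truncates.\<close>
    define s where "s = (if j = 0 then 0 else of_nat (2 * j) * D f ^ (2 * j - 1) * D (D f))"
    have s: "D (D f ^ (2 * j)) = s"
      using derivation_power[OF D, of "D f" "2 * j - 1"]
      by (cases j) (auto simp: s_def is_derivationD[OF D])
    \<comment> \<open>Differentiating the induction hypothesis and multiplying by \<open>D f\<close>
      trades one \<open>f\<close> for two factors \<open>D f\<close>; the subtracted product is a
      multiple of the hypothesis. The coefficient \<open>Suc i\<close> is then divided out.\<close>
    have "D (f ^ Suc i * D f ^ (2 * j)) * D f - f ^ Suc i * s * D f =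
        of_nat (Suc i) * (f ^ i * D f ^ (2 * Suc j))"
      by (simp only: is_derivationD(2)[OF D] derivation_power[OF D] s)
        (simp add: algebra_simps power2_eq_square)
    moreover have "f ^ Suc i * s * D f \<in> I"
    proof (cases j)
      case 0
      then show ?thesis using pidealD(2)[OF I] by (simp add: s_def)
    next
      case (Suc j')
      have eq: "f ^ Suc i * s * D f = (pconst (of_nat (2 * j)) * D (D f)) * (f ^ Suc i * D f ^ (2 * j))"
        by (simp add: s_def Suc pconst_of_nat del: of_nat_Suc of_nat_mult of_nat_add) 
      show ?thesis unfolding eq
        by (rule pidealD(4)[OF I IH polys_mult[OF polys_pconst Dp[OF Dp[OF f]]]])
    qed
    ultimately have *: "of_nat (Suc i) * (f ^ i * D f ^ (2 * Suc j)) \<in> I"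
      using DI[OF IH] Dp[OF f] pidealD[OF I] by metis
    have "pconst (1 / of_nat (Suc i)) * (of_nat (Suc i) * (f ^ i * D f ^ (2 * Suc j))) =
        pconst (1 / of_nat (Suc i) * of_nat (Suc i)) * (f ^ i * D f ^ (2 * Suc j))"
      by (simp only: pconst_simps pconst_of_nat mult.assoc)
    also have "\<dots> = f ^ i * D f ^ (2 * Suc j)" by (simp del: of_nat_Suc)
    finally show ?case using pidealD(4)[OF I * polys_pconst] i_def by metis
  qed (use assms in simp)
  from this[of k] show ?thesis by (simp add: D_def)
qed

lemma pideal_rad:
  fixes I :: "'k::field_char_0 mpoly set"
  assumes I: "pideal n I"
  shows "pideal n (rad n I)"
  unfolding pideal_def
proof (intro conjI ballI)
  show "rad n I \<subseteq> polys {1..n}" by (auto simp: rad_def)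
  have "0 ^ 1 \<in> I" using pidealD(2)[OF I] by simp
  then have "\<exists>k. 0 ^ k \<in> I" by blast
  then show "0 \<in> rad n I" by (simp only: rad_def mem_Collect_eq polys_0 simp_thms)
next
  fix a b :: "'k mpoly" assume a: "a \<in> rad n I" and b: "b \<in> rad n I"
  obtain k l where k: "a ^ k \<in> I" and l: "b ^ l \<in> I" and p: "a \<in> polys {1..n}" "b \<in> polys {1..n}"
    using a b by (auto simp: rad_def)
  have "(a + b) ^ (k + l) = (\<Sum>i\<le>k + l. of_nat (k + l choose i) * a ^ i * b ^ (k + l - i))"
    by (rule binomial_ring)
  also have "\<dots> \<in> I"
  proof (rule pideal_sum[OF I])
    fix i assume "i \<in> {..k + l}"
    have c: "of_nat (k + l choose i) \<in> (polys {1..n} :: 'k mpoly set)"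
      unfolding pconst_of_nat[symmetric] by (rule polys_pconst)
    show "of_nat (k + l choose i) * a ^ i * b ^ (k + l - i) \<in> I"
    proof (cases "k \<le> i")
      case True
      then have "a ^ i = a ^ k * a ^ (i - k)" by (simp flip: power_add)
      then have "a ^ i \<in> I" using k p pidealD(5)[OF I] polys_power by metis
      then show ?thesis using c p by (intro pidealD(4,5)[OF I] polys_power) auto
    next
      case False
      then have "b ^ (k + l - i) = b ^ l * b ^ (k - i)" by (simp add: add.commute flip: power_add)
      then have "b ^ (k + l - i) \<in> I" using l p pidealD(5)[OF I] polys_power by metis
      then show ?thesis using c p by (intro pidealD(4)[OF I] polys_mult polys_power) auto
    qed
  qed
  finally show "a + b \<in> rad n I" using p by (auto simp: rad_def intro: polys_intros)
next
  fix a r :: "'k mpoly" assume a: "a \<in> rad n I" and r: "r \<in> polys {1..n}"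
  then obtain k where "a \<in> polys {1..n}" "a ^ k \<in> I" by (auto simp: rad_def)
  moreover from this have "(r * a) ^ k \<in> I"
    unfolding power_mult_distrib using r by (intro pidealD(4)[OF I] polys_power)
  ultimately show "r * a \<in> rad n I" using r by (auto simp: rad_def intro: polys_mult)
next
  fix a g :: "'k mpoly" assume a: "a \<in> rad n I" and g: "g \<in> polys {1..n}"
  then obtain k where "a \<in> polys {1..n}" "a ^ k \<in> I" by (auto simp: rad_def)
  then show "C_bracket n a g \<in> rad n I"
    using derivation_power_in_ideal[OF I g] g by (auto simp: rad_def intro: C_bracket_polys)
qed

lemma rad_power:
  assumes "f \<in> polys {1..n}" "f ^ k \<in> rad n I"
  shows "f \<in> rad n I"
  using assms by (auto simp: rad_def simp flip: power_mult)

lemma one_in_rad: "1 \<in> rad n I \<longleftrightarrow> 1 \<in> I"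
  by (auto simp: rad_def)


section \<open>Separating eigenvectors in Poisson ideals\<close>

lemma derivation_of_nat: "is_derivation d \<Longrightarrow> d (of_nat k) = 0"
  by (induction k) (simp_all add: is_derivationD[of d])

lemma derivation_of_int: "is_derivation d \<Longrightarrow> d (of_int k) = 0"
  by (cases k) (simp_all add: is_derivationD[of d] derivation_of_nat del: of_nat_Suc)

text \<open>A sum of simultaneous eigenvectors with distinct eigenvalues is taken apart by the
  operators \<open>D\<^sub>i - \<chi>\<^sub>i y\<^sub>i\<close>, as for linear independence of eigenvectors; since the
  eigenvalues are multiples of \<open>y\<^sub>i\<close>, monomials in the \<open>y\<^sub>i\<close> appear.\<close>

lemma eigenvector_separation:
  fixes I :: "'a::comm_ring_1 set" and d :: "nat \<Rightarrow> 'a \<Rightarrow> 'a" and L :: "nat \<Rightarrow> nat \<Rightarrow> int"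
  assumes der: "\<And>i. i \<in> N \<Longrightarrow> is_derivation (d i)"
    and diff: "\<And>a b. a \<in> I \<Longrightarrow> b \<in> I \<Longrightarrow> a - b \<in> I"
    and scale: "\<And>a i k. a \<in> I \<Longrightarrow> i \<in> N \<Longrightarrow> of_int k * y i * a \<in> I"
    and dI: "\<And>a i. a \<in> I \<Longrightarrow> i \<in> N \<Longrightarrow> d i a \<in> I"
    and dy: "\<And>i j. i \<in> N \<Longrightarrow> j \<in> N \<Longrightarrow> d i (y j) = of_int (L j i) * y j * y i"
    and "finite M" "(\<Sum>m\<in>M. f m) \<in> I" "m0 \<in> M"
    and "\<And>m i. m \<in> M \<Longrightarrow> i \<in> N \<Longrightarrow> d i (f m) = of_int (\<chi> m i) * y i * f m"
    and "\<And>m. m \<in> M \<Longrightarrow> m \<noteq> m0 \<Longrightarrow> \<exists>i\<in>N. \<chi> m i \<noteq> \<chi> m0 i"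
  shows "\<exists>e k. k \<noteq> 0 \<and> keys e \<subseteq> N \<and> of_int k * mono_eval y e * f m0 \<in> I"
  using assms(6-)
proof (induction "card M" arbitrary: M f \<chi>)
  case (Suc l)
  show ?case
  proof (cases "M = {m0}")
    case True
    have "of_int 1 * mono_eval y 0 * f m0 \<in> I" using Suc.prems(2) True by simp
    then show ?thesis by (intro exI[of _ 0] exI[of _ 1]) auto
  next
    case False
    then obtain m1 where m1: "m1 \<in> M" "m1 \<noteq> m0" using Suc.prems(3) by blast
    obtain i where i: "i \<in> N" "\<chi> m1 i \<noteq> \<chi> m0 i" using Suc.prems(5)[OF m1] by blast
    define f' where "f' = (\<lambda>m. of_int (\<chi> m i - \<chi> m1 i) * (y i * f m))"
    have "d i (\<Sum>m\<in>M. f m) - of_int (\<chi> m1 i) * y i * (\<Sum>m\<in>M. f m) = (\<Sum>m\<in>M. f' m)"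
      using Suc.prems(4)[OF _ i(1)]
      by (simp add: derivation_sum[OF der[OF i(1)]] sum_distrib_left f'_def left_diff_distrib
          mult.assoc sum_subtractf cong: sum.cong)
    also have "\<dots> = (\<Sum>m\<in>M - {m1}. f' m)"
      using Suc.prems(1) m1 by (simp add: sum.remove[of M m1] f'_def)
    finally have sum: "(\<Sum>m\<in>M - {m1}. f' m) \<in> I"
      using dI[OF Suc.prems(2) i(1)] scale[OF Suc.prems(2) i(1)] diff by metis
    \<comment> \<open>The extra factor \<open>y i\<close> shifts the eigenvalues by
      \<open>L i j\<close>, by the same amount for every \<open>m\<close>, so distinct ones stay
      distinct.\<close>
    have eig: "d j (f' m) = of_int (\<chi> m j + L i j) * y j * f' m" if "m \<in> M - {m1}" "j \<in> N" for m j
      using that Suc.prems(4)[of m j] dy[OF that(2) i(1)] derivation_of_int[OF der[OF that(2)]]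
      unfolding f'_def is_derivationD(2)[OF der[OF that(2)]]
      by (simp add: algebra_simps del: of_int_diff)
    have "\<exists>e k. k \<noteq> 0 \<and> keys e \<subseteq> N \<and> of_int k * mono_eval y e * f' m0 \<in> I"
    proof (rule Suc.hyps(1)[of "M - {m1}" f' "\<lambda>m j. \<chi> m j + L i j"])
      show "l = card (M - {m1})" using Suc.hyps(2) Suc.prems(1) m1 by simp
    qed (use Suc.prems m1 sum eig in auto)
    then obtain e k where e: "k \<noteq> 0" "keys e \<subseteq> N" "of_int k * mono_eval y e * f' m0 \<in> I"
      by blast
    let ?e = "e + single i 1" and ?k = "k * (\<chi> m0 i - \<chi> m1 i)"
    have "of_int ?k * mono_eval y ?e * f m0 = of_int k * mono_eval y e * f' m0"
      by (simp add: f'_def mono_eval_add mult_ac)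
    moreover have "keys ?e \<subseteq> N"
      using Poly_Mapping.keys_add[of e "single i 1"] e(2) i(1) by auto
    ultimately show ?thesis using e i(2)
      by (intro exI[of _ ?e] exI[of _ ?k]) auto
  qed
qed auto

text \<open>The matrix is triangular after separating parities. Column \<open>j + 1\<close> with
  \<open>j\<close> odd involves only odd indices up to \<open>j\<close>, so the odd entries vanish
  by ascending induction; column \<open>j - 1\<close> with \<open>j\<close> even involves only even
  indices from \<open>j\<close> on, so the even entries vanish by descending induction. Evenness of
  \<open>r\<close> keeps \<open>j + 1\<close> in range.\<close>

lemma \<Lambda>_nondegenerate:
  fixes v :: "nat \<Rightarrow> int"
  assumes "even r" and v: "\<And>i. i \<in> {1..r} \<Longrightarrow> (\<Sum>j\<in>{1..r}. v j * \<Lambda> j i) = 0" and "j \<in> {1..r}"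
  shows "v j = 0"
proof (cases "odd j")
  case True
  then show ?thesis using \<open>j \<in> {1..r}\<close>
  proof (induction j rule: less_induct)
    case (less j)
    have i: "j + 1 \<in> {1..r}" using less.prems \<open>even r\<close> by (cases "j = r") auto
    have "0 = (\<Sum>j'\<in>{1..r}. v j' * \<Lambda> j' (j + 1))" using v[OF i] by simp
    also have "\<dots> = (\<Sum>j'\<in>{j}. v j' * \<Lambda> j' (j + 1))"
    proof (rule sum.mono_neutral_right)
      show "\<forall>j'\<in>{1..r} - {j}. v j' * \<Lambda> j' (j + 1) = 0"
      proof
        fix j' assume "j' \<in> {1..r} - {j}"
        then show "v j' * \<Lambda> j' (j + 1) = 0"
          using less by (cases "j' < j \<and> odd j'") (auto simp: \<Lambda>_def)
      qed
    qed (use less.prems in auto)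
    finally show ?case using less.prems by (simp add: \<Lambda>_def)
  qed
next
  case False
  then show ?thesis using \<open>j \<in> {1..r}\<close>
  proof (induction "r - j" arbitrary: j rule: less_induct)
    case less
    have i: "j - 1 \<in> {1..r}" using less.prems by (cases "j = 1") auto
    have "0 = (\<Sum>j'\<in>{1..r}. v j' * \<Lambda> j' (j - 1))" using v[OF i] by simp
    also have "(\<Sum>j'\<in>{1..r}. v j' * \<Lambda> j' (j - 1)) = (\<Sum>j'\<in>{j}. v j' * \<Lambda> j' (j - 1))"
    proof (rule sum.mono_neutral_right)
      show "\<forall>j'\<in>{1..r} - {j}. v j' * \<Lambda> j' (j - 1) = 0"
      proof
        fix j' assume j': "j' \<in> {1..r} - {j}"
        show "v j' * \<Lambda> j' (j - 1) = 0"
        proof (cases "j < j' \<and> even j'")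
          case True
          then have "r - j' < r - j" using j' by auto
          then show ?thesis using less.hyps[of j'] True j' by auto
        qed (use j' less.prems i in \<open>auto simp: \<Lambda>_def\<close>)
      qed
    qed (use less.prems in auto)
    finally have "v j * \<Lambda> j (j - 1) = 0" by simp
    moreover have "odd (j - 1)" "j - 1 < j" "\<not> j < j - 1" using less.prems by auto
    ultimately show ?case using less.prems i by (auto simp: \<Lambda>_def)
  qed
qed

lemma derivation_prod_eigen:
  assumes D: "is_derivation d" and "\<And>i. i \<in> A \<Longrightarrow> d (f i) = of_int (k i) * a * f i"
  shows "d (\<Prod>i\<in>A. f i) = of_int (\<Sum>i\<in>A. k i) * a * (\<Prod>i\<in>A. f i)"
  using assms(2)
  by (induction A rule: infinite_finite_induct) (simp_all add: is_derivationD[OF D] algebra_simps)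

lemma derivation_power_eigen:
  assumes D: "is_derivation d" and "d x = of_int k * a * x"
  shows "d (x ^ p) = of_int (int p * k) * a * x ^ p"
  by (induction p) (simp_all add: is_derivationD[OF D] assms(2) algebra_simps)

lemma derivation_mono_eval:
  assumes D: "is_derivation d" and "finite A" "keys m \<subseteq> A"
    and "\<And>i. i \<in> A \<Longrightarrow> d (y i) = of_int (k i) * a * y i"
  shows "d (mono_eval y m) = of_int (\<Sum>i\<in>A. int (lookup m i) * k i) * a * mono_eval y m"
  unfolding mono_eval_superset[OF assms(2,3)]
  using derivation_prod_eigen[OF D derivation_power_eigen[OF D assms(4)]] .

lemma mono_eval_z_polys:
  assumes "keys e \<subseteq> {1..r}"
  shows "mono_eval z e \<in> polys {1..r}"
  unfolding mono_eval_def
proof (intro polys_prod polys_power)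
  fix i assume "i \<in> keys e"
  then have "i \<le> r" using assms by auto
  then show "z i \<in> polys {1..r}" unfolding z_cont by (intro cont_polys) auto
qed

context
  fixes n :: nat
  assumes n3: "n \<ge> 3" and n_odd: "odd n"
begin

text \<open>Coefficients \<open>b k\<close> that commute with the z_i leave the monomials
  eigenvectors, and nondegeneracy of \<Lambda> lets the eigenvalues determine the exponents. The
  coefficients will be scalars in \<open>monomial_in_pideal\<close> and polynomials in \<Omega> in
  \<open>\<Omega>_minus_in_prime\<close>.\<close>

lemma z_separation:
  fixes b :: "(nat \<Rightarrow>\<^sub>0 nat) \<Rightarrow> 'k::field_char_0 mpoly"
  assumes I: "pideal n I" and r: "even r" "r < n" and M: "finite M"
    and keys: "\<And>k. k \<in> M \<Longrightarrow> keys k \<subseteq> {1..r}"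
    and b: "\<And>k i. k \<in> M \<Longrightarrow> i \<in> {1..r} \<Longrightarrow> C_bracket n (b k) (z i) = 0"
    and sum: "(\<Sum>k\<in>M. b k * mono_eval z k) \<in> I" and "k0 \<in> M"
  shows "\<exists>e. keys e \<subseteq> {1..r} \<and> b k0 * mono_eval z e \<in> I"
proof -
  have z_F: "z i \<in> polys {1..n}" if "i \<in> {1..r}" for i
    using that r by (intro z_in_F) auto
  define \<chi> where "\<chi> = (\<lambda>k i. \<Sum>j\<in>{1..r}. int (lookup k j) * \<Lambda> j i)"
  have "\<exists>e k. k \<noteq> 0 \<and> keys e \<subseteq> {1..r} \<and>
      of_int k * mono_eval z e * (b k0 * mono_eval z k0) \<in> I"
  proof (rule eigenvector_separation[where d = "\<lambda>i f. C_bracket n f (z i)" and L = \<Lambda> and \<chi> = \<chi>])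
    show "C_bracket n (z j) (z i) = of_int (\<Lambda> j i) * z j * (z i :: 'k mpoly)"
      if "i \<in> {1..r}" "j \<in> {1..r}" for i j
      using that r by (intro C_bracket_z[OF n3 n_odd]) auto
    show "C_bracket n (b k * mono_eval z k) (z i) = of_int (\<chi> k i) * z i * (b k * mono_eval z k)"
      if "k \<in> M" "i \<in> {1..r}" for k i
    proof -
      have "C_bracket n (z j) (z i) = of_int (\<Lambda> j i) * z i * (z j :: 'k mpoly)"
        if "j \<in> {1..r}" for j
        using that \<open>i \<in> {1..r}\<close> r C_bracket_z[OF n3 n_odd, of j i, where 'k = 'k]
        by (simp add: mult_ac)
      then have "C_bracket n (mono_eval z k) (z i) = of_int (\<chi> k i) * z i * (mono_eval z k :: 'k mpoly)"
        unfolding \<chi>_def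
        by (intro derivation_mono_eval[OF is_derivation_C_bracket_left _ keys[OF \<open>k \<in> M\<close>]]) auto
      then show ?thesis using b[OF that] by (simp add: C_bracket_mult_left mult_ac)
    qed
    show "\<exists>i\<in>{1..r}. \<chi> k i \<noteq> \<chi> k0 i" if "k \<in> M" "k \<noteq> k0" for k
    proof (rule ccontr)
      assume "\<not> ?thesis"
      then have 0: "(\<Sum>j\<in>{1..r}. (int (lookup k j) - int (lookup k0 j)) * \<Lambda> j i) = 0"
        if "i \<in> {1..r}" for i
        using that by (simp add: \<chi>_def left_diff_distrib sum_subtractf)
      have "lookup k j = lookup k0 j" for j
      proof (cases "j \<in> {1..r}")
        case True
        then show ?thesis using \<Lambda>_nondegenerate[OF r(1) 0 True] by simp
      next
        case False
        then have "j \<notin> keys k" "j \<notin> keys k0"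
          using keys \<open>k \<in> M\<close> \<open>k0 \<in> M\<close> by blast+
        then show ?thesis by (simp add: in_keys_iff)
      qed
      then show False using \<open>k \<noteq> k0\<close> poly_mapping_eqI by blast
    qed
    show "of_int k * z i * a \<in> I" if "a \<in> I" "i \<in> {1..r}" for a i k
      using that by (intro pidealD(4)[OF I] polys_mult polys_of_int z_F)
    show "C_bracket n a (z i) \<in> I" if "a \<in> I" "i \<in> {1..r}" for a i
      using that by (intro pidealD(6)[OF I] z_F)
  qed (use pidealD[OF I] M sum \<open>k0 \<in> M\<close> in \<open>auto intro: is_derivation_C_bracket_left\<close>)
  then obtain e k where e: "k \<noteq> 0" "keys e \<subseteq> {1..r}"
    "of_int k * mono_eval z e * (b k0 * mono_eval z k0) \<in> I" by blast
  \<comment> \<open>Characteristic 0 makes the nonzero integer a unit, and the two monomials merge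
    into one.\<close>
  have "pconst (1 / of_int k) * (of_int k * mono_eval z e * (b k0 * mono_eval z k0)) =
      pconst (1 / of_int k * of_int k) * (mono_eval z e * (b k0 * mono_eval z k0))"
    by (simp only: pconst_simps pconst_of_int mult.assoc)
  also have "\<dots> = b k0 * mono_eval z (e + k0)"
    using e(1) by (simp add: mono_eval_add mult_ac)
  finally have "b k0 * mono_eval z (e + k0) \<in> I"
    using pidealD(4)[OF I e(3) polys_pconst] by metis
  moreover have "keys (e + k0) \<subseteq> {1..r}"
    using Poly_Mapping.keys_add[of e k0] e(2) keys[OF \<open>k0 \<in> M\<close>] by blast
  ultimately show ?thesis by blast
qed

end


section \<open>Clearing denominators\<close>

definition upoly :: "'k::field mpoly \<Rightarrow> 'k poly \<Rightarrow> 'k mpoly" where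
  "upoly c p = poly (map_poly pconst p) c"

lemma upoly_0 [simp]: "upoly c 0 = 0"
  by (simp add: upoly_def)

lemma upoly_pCons [simp]: "upoly c (pCons a p) = pconst a + c * upoly c p"
  by (simp add: upoly_def map_poly_pCons)

lemma upoly_add: "upoly c (p + q) = upoly c p + upoly c q"
  by (induction p q rule: poly_induct2) (simp_all add: algebra_simps)

lemma upoly_smult: "upoly c (smult a p) = pconst a * upoly c p"
  by (induction p) (simp_all add: algebra_simps)

lemma upoly_mult: "upoly c (p * q) = upoly c p * upoly c q"
  by (induction p) (simp_all add: upoly_add upoly_smult algebra_simps)

lemma is_hom_upoly: "is_hom (upoly c)"
  by (simp add: is_hom_def upoly_add upoly_mult one_pCons)

lemma upoly_polys: "c \<in> polys V \<Longrightarrow> upoly c p \<in> polys V"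
  by (induction p) (auto intro: polys_add polys_mult)

lemma upoly_dvd: "c - pconst a dvd upoly c p - pconst (poly p a)"
proof (induction p)
  case (pCons b p)
  have "upoly c (pCons b p) - pconst (poly (pCons b p) a) =
      (c - pconst a) * upoly c p + pconst a * (upoly c p - pconst (poly p a))"
    by (simp add: algebra_simps)
  then show ?case using pCons by (simp only:) auto
qed simp

lemma derivation_upoly:
  assumes D: "is_derivation D" and "\<And>a. D (pconst a) = 0" "D c = 0"
  shows "D (upoly c p) = 0"
  by (induction p) (simp_all add: is_derivationD[OF D] assms)

text \<open>An element of K[c][z_1, z_2, ...]. Keeping \<open>c\<close> in the coefficients allows
  replacing it there by a scalar without touching the monomials in the z_i.\<close>

abbreviation (input) zeval :: "'k::field mpoly \<Rightarrow> 'k poly mpoly \<Rightarrow> 'k mpoly" where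
  "zeval c \<equiv> gen_eval (upoly c) (mono_eval z)"

lemma is_hom_zeval: "is_hom (zeval c)"
  by (rule is_hom_gen_eval[OF is_hom_upoly]) (auto simp: mono_eval_add)

lemma zeval_single: "zeval c (single k p) = upoly c p * mono_eval z k"
  by (rule gen_eval_single[OF is_hom_upoly])

text \<open>The exponent vector of z_i. As z_0 = 1 is not among the generators, it gets the empty
  exponent.\<close>

definition z_exp :: "nat \<Rightarrow> nat \<Rightarrow>\<^sub>0 nat" where
  "z_exp i = (if i = 0 then 0 else single i 1)"

lemma mono_eval_z_exp: "mono_eval z (z_exp i) = cont 1 (Suc i)"
  by (simp add: z_exp_def z_cont)

lemma keys_z_exp: "i \<le> r \<Longrightarrow> keys (z_exp i) \<subseteq> {1..r}"
  by (simp add: z_exp_def)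

lemma single_polys: "keys k \<subseteq> V \<Longrightarrow> single k c \<in> polys V"
  by (auto simp: polys_def)

text \<open>From z_{i-1} x_i = z_i + z_{i-2}, every x_i with \<open>i < m\<close> becomes polynomial
  in the z's after multiplication by one of them; x_m is recovered from \<open>c\<close>, whose
  leading coefficient in x_m is z_{m-1}. The property is stable under sums and products.\<close>

lemma clear_denominators:
  fixes c f :: "'k::field mpoly"
  assumes m: "1 \<le> m" and c: "cont 1 m * pvar m - c \<in> polys {1..m - 1}" and "f \<in> polys {1..m}"
  shows "\<exists>e P. keys e \<subseteq> {1..m - 1} \<and> P \<in> polys {1..m - 1} \<and>
    mono_eval z e * f = zeval c P"
proof -
  note zeval = is_homD[OF is_hom_zeval[of c]]
  define Q where "Q = (\<lambda>f. \<exists>e P. keys e \<subseteq> {1..m - 1} \<and> P \<in> polys {1..m - 1} \<and>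
    mono_eval z e * f = zeval c P)"
  have QI: "Q f" if "keys e \<subseteq> {1..m - 1}" "P \<in> polys {1..m - 1}"
    "mono_eval z e * f = zeval c P" for f e P
    using that by (auto simp: Q_def)
  have keys_add': "keys (e + e') \<subseteq> {1..m - 1}"
    if "keys e \<subseteq> {1..m - 1}" "keys e' \<subseteq> {1..m - 1}" for e e' :: "nat \<Rightarrow>\<^sub>0 nat"
    using that Poly_Mapping.keys_add[of e e'] by blast
  have const: "Q (pconst a)" for a
    by (rule QI[of 0 "single 0 [:a:]"]) (auto intro: single_polys simp: zeval_single)
  have add: "Q (f + g)" if fg: "Q f" "Q g" for f g
  proof -
    obtain e P e' P' where *: "keys e \<subseteq> {1..m - 1}" "P \<in> polys {1..m - 1}"
      "mono_eval z e * f = zeval c P" "keys e' \<subseteq> {1..m - 1}" "P' \<in> polys {1..m - 1}"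
      "mono_eval z e' * g = zeval c P'" using fg unfolding Q_def by metis
    have "mono_eval z (e + e') * (f + g) =
        mono_eval z e' * (mono_eval z e * f) + mono_eval z e * (mono_eval z e' * g)"
      by (simp add: mono_eval_add algebra_simps)
    also have "\<dots> = zeval c (single e' 1 * P + single e 1 * P')"
      unfolding * by (simp add: zeval zeval_single is_homD[OF is_hom_upoly])
    finally show ?thesis using *
      by (intro QI[of "e + e'" "single e' 1 * P + single e 1 * P'"]
          keys_add' polys_add polys_mult single_polys)
  qed
  have mult: "Q (f * g)" if fg: "Q f" "Q g" for f g
  proof -
    obtain e P e' P' where *: "keys e \<subseteq> {1..m - 1}" "P \<in> polys {1..m - 1}"
      "mono_eval z e * f = zeval c P" "keys e' \<subseteq> {1..m - 1}" "P' \<in> polys {1..m - 1}"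
      "mono_eval z e' * g = zeval c P'" using fg unfolding Q_def by metis
    have "mono_eval z (e + e') * (f * g) = (mono_eval z e * f) * (mono_eval z e' * g)"
      by (simp add: mono_eval_add algebra_simps)
    also have "\<dots> = zeval c (P * P')" unfolding * by (simp add: zeval)
    finally show ?thesis using *
      by (intro QI[of "e + e'" "P * P'"] keys_add' polys_mult)
  qed
  have var: "Q (pvar i)" if i: "i \<in> {1..m - 1}" for i
  proof -
    \<comment> \<open>The term z_{i-2} is dropped for \<open>i = 1\<close>, where it would be z_{-1}
      = 0.\<close>
    let ?P = "single (z_exp i) 1 +
      (if i = 1 then 0 else single (z_exp (i - 2)) 1) :: 'k poly mpoly"
    have "mono_eval z (z_exp (i - 1)) * pvar i = cont 1 i * (pvar i :: 'k mpoly)"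
      using i by (simp add: mono_eval_z_exp)
    also have "\<dots> = cont 1 (Suc i) + cont 1 (i - 1)"
      using cont_rec(1)[of "Suc i" 1, where 'a = 'k] i by simp
    also have "\<dots> = zeval c ?P"
    proof (cases "i = 1")
      case False
      then have "i - 1 = Suc (i - 2)" using i by auto
      then show ?thesis using False
        by (simp add: zeval zeval_single is_homD[OF is_hom_upoly] mono_eval_z_exp del: cont.simps)
    qed (simp add: zeval zeval_single is_homD[OF is_hom_upoly] mono_eval_z_exp)
    finally have "mono_eval z (z_exp (i - 1)) * pvar i = zeval c ?P" .
    moreover have "i - 1 \<le> m - 1" "i - 2 \<le> m - 1" "i \<le> m - 1" using i by auto
    ultimately show ?thesis
      by (intro QI[of "z_exp (i - 1)" ?P])
        (auto intro!: polys_add single_polys keys_z_exp simp del: atLeastAtMost_iff)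
  qed
  have small: "Q h" if "h \<in> polys {1..m - 1}" for h
    using that by (induction rule: polys_induct) (auto intro: const var add mult)
  have "Q (cont 1 m * pvar m - c)" by (rule small[OF c])
  then obtain e P where e: "keys e \<subseteq> {1..m - 1}" "P \<in> polys {1..m - 1}"
    "mono_eval z e * (cont 1 m * pvar m - c) = zeval c P" unfolding Q_def by metis
  \<comment> \<open>z_{m-1} x_m is \<open>c\<close> plus an element free of x_m; the coefficient
    \<open>[:0, 1:]\<close> represents \<open>c\<close>.\<close>
  have "Q (pvar m)"
  proof (rule QI[of "e + z_exp (m - 1)" "single e [:0, 1:] + P"])
    have "mono_eval z (e + z_exp (m - 1)) * pvar m =
        mono_eval z e * (cont 1 m * pvar m - c) + mono_eval z e * c"
      using m by (simp add: mono_eval_add mono_eval_z_exp algebra_simps)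
    also have "\<dots> = zeval c (single e [:0, 1:] + P)"
      unfolding e(3) by (simp add: zeval zeval_single)
    finally show "mono_eval z (e + z_exp (m - 1)) * pvar m = \<dots>" .
  qed (intro keys_add' polys_add single_polys keys_z_exp order_refl e)+
  then have "Q (pvar i)" if "i \<in> {1..m}" for i
    using that var[of i] by (cases "i = m") auto
  then have "Q f" using \<open>f \<in> polys {1..m}\<close>
    by (induction rule: polys_induct[OF \<open>f \<in> polys {1..m}\<close>]) (auto intro: const add mult)
  then show ?thesis by (simp add: Q_def)
qed


text \<open>Oddness excludes \<open>m = 2\<close>, where z_2 + 1 = x_1 x_2 is reducible. For
  \<open>m \<ge> 3\<close> the constant term specialises to degree \<open>m - 2 \<ge> 1\<close>, so
  adding the scalar cannot make it vanish.\<close>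

lemma prime_elem_z:
  fixes a :: "'k::field"
  assumes "odd m"
  shows "prime_elem (cont 1 (Suc m) - pconst a)"
    and "r \<in> polys (- {m}) \<Longrightarrow> cont 1 (Suc m) - pconst a dvd r \<Longrightarrow> r = 0"
proof -
  let ?b = "cont 1 (m - 1) + pconst a"
  have m: "1 \<le> m" using assms by (cases m) auto
  have eq: "cont 1 (Suc m) - pconst a = cont 1 m * pvar m - ?b"
    using cont_rec(1)[of "Suc m" 1, where 'a = 'k] m by simp
  have poly: "?b \<in> polys (- {m})"
    by (intro polys_add polys_pconst cont_polys) auto
  have nz: "to_univ ?b \<noteq> 0 \<and> degree (to_univ ?b) < m - 1" if "m \<ge> 2"
  proof -
    have "m \<noteq> 2" using assms by auto
    then have "m - 1 = Suc (m - 2)" "m - 2 \<ge> 1" using that by auto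
    then obtain l where l: "m - 1 = Suc l" "l \<ge> 1" by blast
    have "degree (to_univ (cont 1 (Suc l)) :: 'k poly) = l"
      using to_univ_cont[of 1 l, where 'k = 'k] by simp
    then have "degree (to_univ ?b) = l"
      using l by (simp add: to_univ_simps degree_add_eq_left del: cont.simps)
    then show ?thesis using l by auto
  qed
  show "prime_elem (cont 1 (Suc m) - pconst a)"
    and "r \<in> polys (- {m}) \<Longrightarrow> cont 1 (Suc m) - pconst a dvd r \<Longrightarrow> r = 0"
    unfolding eq using linear_over_cont_prime_elem(1)[of m ?b] linear_over_cont_prime_elem(2)[of m ?b r]
      m poly nz by auto
qed

context
  fixes n :: nat
  assumes n3: "n \<ge> 3" and n_odd: "odd n"
begin

section \<open>Poisson prime ideals of \<open>F\<^sub>n\<close>\<close>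

text \<open>Clear denominators in \<open>f\<close> over K[c] and replace \<open>c\<close> by
  \<open>a\<close>: the result is in the ideal and is a scalar combination of monomials in the z_i.
  It is nonzero since c - a divides neither \<open>f\<close> nor a monomial, so separation extracts
  a monomial. The uses are \<open>m = n\<close> with \<Omega> and \<open>m = n - 2\<close> with
  z_{n-2}.\<close>

lemma monomial_in_pideal:
  fixes I :: "'k::field_char_0 mpoly set"
  assumes I: "pideal n I" and m: "odd m" "m \<le> n"
    and c: "c \<in> polys {1..m}" "cont 1 m * pvar m - c \<in> polys {1..m - 1}"
    and prime: "prime_elem (c - pconst a)"
    and coprime: "\<And>r. r \<in> polys (- {m}) \<Longrightarrow> c - pconst a dvd r \<Longrightarrow> r = 0"
    and c_I: "c - pconst a \<in> I" and f: "f \<in> I" "f \<in> polys {1..m}" "\<not> c - pconst a dvd f"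
  shows "\<exists>e. keys e \<subseteq> {1..m - 1} \<and> mono_eval z e \<in> I"
proof -
  let ?p = "c - pconst a"
  have "1 \<le> m" using m by (cases m) auto
  have in_F': "g \<in> polys {1..n}" if "g \<in> polys {1..m - 1}" for g :: "'k mpoly"
    using that by (rule polys_le) (use m in linarith)
  obtain e P where e: "keys e \<subseteq> {1..m - 1}" and P: "P \<in> polys {1..m - 1}"
    and *: "mono_eval z e * f = zeval c P"
    using clear_denominators[OF \<open>1 \<le> m\<close> c(2) f(2)] by blast
  have keys: "keys k \<subseteq> {1..m - 1}" if "k \<in> keys P" for k
    using that P by (auto simp: polys_def)
  define b where "b = (\<lambda>k. poly (lookup P k) a)"
  define M where "M = {k \<in> keys P. b k \<noteq> 0}"
  \<comment> \<open>\<open>g\<close> is the reduction of \<open>zeval c P\<close> under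
    \<open>c\<close> = \<open>a\<close>.\<close>
  define g where "g = (\<Sum>k\<in>keys P. pconst (b k) * mono_eval z k)"
  have g_M: "g = (\<Sum>k\<in>M. pconst (b k) * mono_eval z k)"
    unfolding g_def by (rule sum.mono_neutral_right) (auto simp: M_def)
  have "zeval c P - g = (\<Sum>k\<in>keys P.
      (upoly c (lookup P k) - pconst (b k)) * mono_eval z k)"
    by (simp add: gen_eval_def g_def left_diff_distrib sum_subtractf)
  also have "?p dvd \<dots>"
    by (intro dvd_sum dvd_mult2) (simp add: b_def upoly_dvd)
  finally have dvd: "?p dvd mono_eval z e * f - g" unfolding * .
  have e_poly: "mono_eval z e \<in> polys {1..m - 1}" by (rule mono_eval_z_polys[OF e])
  have ef: "mono_eval z e * f \<in> I" using pidealD(4)[OF I f(1)] in_F'[OF e_poly] by blast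
  have g_poly: "g \<in> polys {1..n}"
    unfolding g_def using mono_eval_z_polys[OF keys] in_F'
    by (intro polys_sum polys_mult polys_pconst) auto
  obtain h where h: "mono_eval z e * f - g = ?p * h" using dvd by (elim dvdE)
  have "h \<in> polys {1..n}"
    using polys_dvd_cofactor[OF _ _ _ h] prime c_I pidealD(1)[OF I] ef g_poly
    by (auto intro: polys_diff simp: prime_elem_def)
  then have "mono_eval z e * f - g \<in> I" unfolding h using c_I pidealD(5)[OF I] by blast
  then have "mono_eval z e * f - (mono_eval z e * f - g) \<in> I" using ef pidealD(8)[OF I] by blast
  then have g_I: "g \<in> I" by simp
  \<comment> \<open>Otherwise the prime c - a divides z^e \<open>f\<close>, hence z^e, which is
    nonzero and free of x_m.\<close>
  have "M \<noteq> {}"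
  proof
    assume "M = {}"
    then have "?p dvd mono_eval z e * f" using dvd g_M by simp
    then have dvd_e: "?p dvd mono_eval z e" using f(3) prime prime_elem_dvd_multD by blast
    have "m - 1 < m" using \<open>1 \<le> m\<close> by simp
    then have "{1..m - 1} \<subseteq> - {m}" by auto
    then have "mono_eval z e \<in> (polys (- {m}) :: 'k mpoly set)"
      using e_poly polys_mono[of "{1..m - 1}" "- {m}"] by blast
    then have "mono_eval z e = (0 :: 'k mpoly)" using dvd_e by (rule coprime)
    then show False by (simp add: mono_eval_def z_cont)
  qed
  then obtain k0 where k0: "k0 \<in> M" by blast
  have "\<exists>e. keys e \<subseteq> {1..m - 1} \<and> pconst (b k0) * mono_eval z e \<in> I"
  proof (rule z_separation[OF n3 n_odd I, where M = M and b = "\<lambda>k. pconst (b k)"])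
    show "m - 1 < n" using m n3 by linarith
  qed (use m k0 g_I keys in \<open>auto simp: g_M M_def\<close>)
  then obtain e' where e': "keys e' \<subseteq> {1..m - 1}" "pconst (b k0) * mono_eval z e' \<in> I"
    by blast
  have "pconst (1 / b k0) * (pconst (b k0) * mono_eval z e') = pconst (1 / b k0 * b k0) * mono_eval z e'"
    by (simp only: pconst_simps mult.assoc)
  also have "\<dots> = mono_eval z e'" using k0 by (simp add: M_def)
  finally have "mono_eval z e' \<in> I" using pidealD(4)[OF I e'(2) polys_pconst] by metis
  then show ?thesis using e'(1) by blast
qed

lemma z_descent:
  assumes I: "pideal n I"
  shows "Suc i < n \<Longrightarrow> cont 1 (Suc i) \<in> I \<Longrightarrow> 1 \<in> I"
proof (induction i)
  case (Suc i)
  \<comment> \<open>\<open>u\<close> is the coefficient of z_{i+1} in {z_{i+1}, x_{i+2}}; removing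
    that multiple leaves -z_i.\<close>
  define u where "u = (if odd (Suc i) then pvar (Suc (Suc i)) else 0 :: 'a mpoly)"
  have F: "pvar (Suc (Suc i)) \<in> polys {1..n}" "u \<in> polys {1..n}"
    using Suc.prems by (auto simp: u_def intro!: polys_pvar)
  have "u * cont 1 (Suc (Suc i)) - C_bracket n (cont 1 (Suc (Suc i))) (pvar (Suc (Suc i))) \<in> I"
    using F Suc.prems by (intro pidealD(8)[OF I] pidealD(4)[OF I] pidealD(6)[OF I])
  also have "u * cont 1 (Suc (Suc i)) - C_bracket n (cont 1 (Suc (Suc i))) (pvar (Suc (Suc i)))
      = cont 1 (Suc i)"
    using C_bracket_z_next[OF n3 n_odd Suc.prems(1), where 'k = 'a]
    by (simp add: u_def del: cont.simps)
  finally show ?case using Suc by simp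
qed simp

text \<open>If u a is in R, the square of u {a, g} equals {u a, g} u {a, g} - u a {u, g} {a, g},
  which is in R, so u {a, g} is in R. Colon ideals thus allow cancellation in radical ideals that
  are not prime.\<close>

lemma pideal_colon:
  fixes R :: "'k::field mpoly set"
  assumes R: "pideal n R" and rad: "\<And>f. f \<in> polys {1..n} \<Longrightarrow> f ^ 2 \<in> R \<Longrightarrow> f \<in> R"
    and u: "u \<in> polys {1..n}"
  shows "pideal n {f \<in> polys {1..n}. u * f \<in> R}"
  unfolding pideal_def
proof (intro conjI ballI)
  fix a g :: "'k mpoly" assume "a \<in> {f \<in> polys {1..n}. u * f \<in> R}" and g: "g \<in> polys {1..n}"
  then have a: "a \<in> polys {1..n}" "u * a \<in> R" by auto
  have br: "C_bracket n a g \<in> polys {1..n}" "C_bracket n u g \<in> polys {1..n}"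
    using a g u by (auto intro: C_bracket_polys)
  have "C_bracket n (u * a) g * (u * C_bracket n a g) - (u * a) * (C_bracket n u g * C_bracket n a g) \<in> R"
    by (rule pidealD(8)[OF R pidealD(5)[OF R pidealD(6)[OF R a(2) g] polys_mult[OF u br(1)]]
          pidealD(5)[OF R a(2) polys_mult[OF br(2,1)]]])
  also have "C_bracket n (u * a) g * (u * C_bracket n a g) - (u * a) * (C_bracket n u g * C_bracket n a g)
      = (u * C_bracket n a g)^2"
    by (simp add: C_bracket_mult_left power2_eq_square algebra_simps)
  finally have "u * C_bracket n a g \<in> R" by (rule rad[OF polys_mult[OF u br(1)]])
  then show "C_bracket n a g \<in> {f \<in> polys {1..n}. u * f \<in> R}" using br by simp
next
  fix a r :: "'k mpoly" assume "a \<in> {f \<in> polys {1..n}. u * f \<in> R}" and r: "r \<in> polys {1..n}"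
  then show "r * a \<in> {f \<in> polys {1..n}. u * f \<in> R}"
    using pidealD(4)[OF R, of "u * a" r] by (auto simp: mult_ac intro: polys_mult)
qed (use pidealD(2,3)[OF R] in \<open>auto simp: distrib_left intro: polys_add\<close>)

text \<open>If u z_i is in R with \<open>i < n - 1\<close>, then z_i lies in the colon ideal of u,
  and the descent puts 1 there, so u is in R. This cancels every factor of the monomial except the
  power of z_{n-1}.\<close>

lemma z_last_in_radical:
  fixes R :: "'k::field mpoly set"
  assumes R: "pideal n R" and rad: "\<And>f k. f \<in> polys {1..n} \<Longrightarrow> f ^ k \<in> R \<Longrightarrow> f \<in> R"
    and one: "1 \<notin> R" and e: "keys e \<subseteq> {1..n - 1}" "mono_eval z e \<in> R"
  shows "cont 1 n \<in> R"
proof -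
  have cancel1: "u \<in> R" if u: "u \<in> polys {1..n}" "u * z i \<in> R" and i: "i < n - 1" for u i
  proof -
    let ?C = "{f \<in> polys {1..n}. u * f \<in> R}"
    have C: "pideal n ?C" using pideal_colon[OF R _ u(1)] rad by blast
    have "cont 1 (Suc i) \<in> polys {1..n}" using i by (intro cont_in_F) auto
    then have "cont 1 (Suc i) \<in> ?C" using u by (simp add: z_cont del: cont.simps)
    then have "1 \<in> ?C" using z_descent[OF C, of i] i by simp
    then show ?thesis by simp
  qed
  have cancel: "u \<in> R" if "u \<in> polys {1..n}" "u * z i ^ k \<in> R" "i < n - 1" for u i k
    using that
  proof (induction k)
    case (Suc k)
    have "u * z i ^ k \<in> polys {1..n}"
      using Suc.prems by (intro polys_mult polys_power z_in_F) auto
    moreover have "u * z i ^ k * z i \<in> R" using Suc.prems(2) by (simp add: mult_ac)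
    ultimately have "u * z i ^ k \<in> R" using cancel1 Suc.prems(3) by blast
    then show ?case using Suc by blast
  qed simp
  have cancel_prod: "u \<in> R" if "u \<in> polys {1..n}" "u * (\<Prod>i\<in>A. z i ^ k i) \<in> R" "A \<subseteq> {..<n - 1}"
    "finite A" for u A k
    using that(4,1,2,3)
  proof (induction A arbitrary: u rule: finite_induct)
    case (insert i A)
    have zi: "z i \<in> polys {1..n}" using insert.prems(3) by (intro z_in_F) auto
    have "(u * z i ^ k i) * (\<Prod>i\<in>A. z i ^ k i) \<in> R"
      using insert.prems(2) insert.hyps by (simp add: mult_ac)
    then have "u * z i ^ k i \<in> R"
      using insert.IH[of "u * z i ^ k i"] insert.prems zi by (auto intro: polys_mult polys_power)
    then show ?case using cancel insert.prems by auto
  qed simp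
  define k where "k = lookup e"
  have "{1..n - 1} = insert (n - 1) {1..<n - 1}" using n3 by auto
  then have "mono_eval z e = z (n - 1) ^ k (n - 1) * (\<Prod>i\<in>{1..<n - 1}. z i ^ k i :: 'k mpoly)"
    using mono_eval_superset[OF _ e(1), of z] by (simp add: k_def)
  moreover have zn: "z (n - 1) \<in> (polys {1..n} :: 'k mpoly set)" by (intro z_in_F) auto
  ultimately have "z (n - 1) ^ k (n - 1) \<in> R"
    using e(2) by (intro cancel_prod[of "z (n - 1) ^ k (n - 1)" k "{1..<n - 1}"] polys_power) auto
  then have "z (n - 1) \<in> R" using rad zn by blast
  then show ?thesis using n3 by (simp add: z_cont)
qed

lemma z_last_consequences:
  assumes I: "pideal n I" and z: "cont 1 n \<in> I"
  shows "cont 2 (n - 1) - cont 1 (n - 1) \<in> I" "cont 1 (n - 1) ^ 2 - 1 \<in> I"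
    "\<Omega> n + 2 * cont 1 (n - 1) \<in> I"
proof -
  have x: "pvar n \<in> polys {1..n}" using n3 by (intro polys_pvar) auto
  have F: "cont 1 (n - 1) \<in> polys {1..n}" "cont 2 (n - 1) \<in> polys {1..n}" "cont 2 (n - 2) \<in> polys {1..n}"
    using n3 by (auto intro!: cont_in_F)
  show 1: "cont 2 (n - 1) - cont 1 (n - 1) \<in> I"
    using pidealD(6)[OF I z x] C_bracket_z_last[OF n3 n_odd] by metis
  have det: "cont 1 n * cont 2 (n - 2) - cont 1 (n - 1) * cont 2 (n - 1) = (- 1 :: 'a mpoly)"
  proof -
    have *: "Suc (Suc (n - 2)) = n" "Suc (n - 2) = n - 1" "Suc (n - 1) = n" "Suc 1 = 2" using n3 by auto
    show ?thesis using cont_det[of 1 "n - 2", where 'k = 'a] unfolding * .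
  qed
  have "cont 1 n * cont 2 (n - 2) - (cont 2 (n - 1) - cont 1 (n - 1)) * cont 1 (n - 1) \<in> I"
    by (rule pidealD(8)[OF I pidealD(5)[OF I z F(3)] pidealD(5)[OF I 1 F(1)]])
  also have "cont 1 n * cont 2 (n - 2) - (cont 2 (n - 1) - cont 1 (n - 1)) * cont 1 (n - 1) =
      (cont 1 n * cont 2 (n - 2) - cont 1 (n - 1) * cont 2 (n - 1)) + cont 1 (n - 1) ^ 2"
    by (simp add: algebra_simps power2_eq_square)
  finally show "cont 1 (n - 1) ^ 2 - 1 \<in> I" unfolding det by simp
  have "cont 1 n * pvar n - (cont 2 (n - 1) - cont 1 (n - 1)) \<in> I"
    by (rule pidealD(8)[OF I pidealD(5)[OF I z x] 1])
  then show "\<Omega> n + 2 * cont 1 (n - 1) \<in> I"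
    unfolding \<Omega>_cont[OF n3] by (simp add: algebra_simps)
qed

text \<open>The two continuants in the constant term specialise to the same monic polynomial p of
  degree \<open>n - 2 \<ge> 1\<close>, so the term specialises to 2 p + a. Characteristic 0 keeps
  the 2 from lowering its degree.\<close>

lemma prime_elem_\<Omega>:
  fixes a :: "'k::field_char_0"
  shows "prime_elem (\<Omega> n - pconst a)"
    and "r \<in> polys (- {n}) \<Longrightarrow> \<Omega> n - pconst a dvd r \<Longrightarrow> r = 0"
proof -
  let ?b = "cont 1 (n - 1) + cont 2 (n - 1) + pconst a"
  have eq: "\<Omega> n - pconst a = cont 1 n * pvar n - ?b"
    by (simp add: \<Omega>_cont[OF n3])
  obtain l where l: "n - 1 = Suc l" "l \<ge> 1" using n3 by (cases "n - 1") auto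
  have poly: "?b \<in> polys (- {n})"
    using n3 by (intro polys_add polys_pconst cont_polys) auto
  let ?p = "to_univ (cont 1 (Suc l)) :: 'k poly"
  have "to_univ (cont 2 (Suc l)) = ?p" by (rule to_univ_cont_indep)
  then have "to_univ ?b = ?p + ?p + [:a:]"
    unfolding l by (simp only: to_univ_simps to_univ_pconst)
  also have "?p + ?p = smult 2 ?p" by (intro poly_eqI) (simp only: coeff_add coeff_smult mult_2)
  finally have ub: "to_univ ?b = smult 2 ?p + [:a:]" .
  have d: "degree (smult 2 ?p) = l" using to_univ_cont[of 1 l, where 'k = 'k] by simp
  then have "degree (to_univ ?b) = l"
    unfolding ub using l by (subst degree_add_eq_left) auto
  then have nz: "to_univ ?b \<noteq> 0 \<and> degree (to_univ ?b) < n - 1" using l by auto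
  show "prime_elem (\<Omega> n - pconst a)"
    and "r \<in> polys (- {n}) \<Longrightarrow> \<Omega> n - pconst a dvd r \<Longrightarrow> r = 0"
    unfolding eq using linear_over_cont_prime_elem(1)[of n ?b] linear_over_cont_prime_elem(2)[of n ?b r]
      n3 poly nz by auto
qed

lemma \<Omega>_linear: "cont 1 n * pvar n - \<Omega> n \<in> (polys {1..n - 1} :: 'k::field mpoly set)"
proof -
  have eq: "cont 1 n * pvar n - \<Omega> n = cont 1 (n - 1) + (cont 2 (n - 1) :: 'k mpoly)"
    by (simp add: \<Omega>_cont[OF n3])
  show ?thesis unfolding eq using n3 by (intro polys_add cont_polys) auto
qed

lemma pideal_\<Omega>_monomial:
  fixes I :: "'k::field_char_0 mpoly set"
  assumes "pideal n I" "\<Omega> n - pconst a \<in> I" "f \<in> I" "\<not> \<Omega> n - pconst a dvd f"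
  shows "\<exists>e. keys e \<subseteq> {1..n - 1} \<and> mono_eval z e \<in> I"
proof (rule monomial_in_pideal[OF assms(1) n_odd order_refl, where c = "\<Omega> n" and a = a and f = f])
  show "r = 0" if "r \<in> polys (- {n})" "\<Omega> n - pconst a dvd r" for r
    using prime_elem_\<Omega>(2)[OF that] .
qed (use assms pidealD(1)[OF assms(1,3)] in
    \<open>auto intro: \<Omega>_in_F[OF n3 n_odd] \<Omega>_linear prime_elem_\<Omega>(1)\<close>)

lemma pideal_\<Omega>_special:
  fixes I :: "'k::field_char_0 mpoly set"
  assumes I: "pideal n I" "1 \<notin> I" "\<Omega> n - pconst a \<in> I" "f \<in> I" "\<not> \<Omega> n - pconst a dvd f"
  shows "a = 2 \<or> a = - 2"
proof (rule ccontr)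
  assume a: "\<not> ?thesis"
  let ?R = "rad n I" and ?t = "cont 1 (n - 1) :: 'k mpoly"
  have R: "pideal n ?R" by (rule pideal_rad[OF I(1)])
  have sub: "f \<in> ?R" if "f \<in> I" for f
  proof -
    have "f ^ 1 \<in> I" using that by simp
    then show ?thesis using pidealD(1)[OF I(1) that] unfolding rad_def by blast
  qed
  obtain e where e: "keys e \<subseteq> {1..n - 1}" "mono_eval z e \<in> I"
    using pideal_\<Omega>_monomial[OF I(1,3-)] by blast
  have z: "cont 1 n \<in> ?R"
    using z_last_in_radical[OF R rad_power _ e(1)] sub[OF e(2)] I(2) by (simp add: one_in_rad)
  have t: "?t \<in> polys {1..n}" using n3 by (intro cont_in_F) auto
  have "(\<Omega> n + 2 * ?t) - (\<Omega> n - pconst a) \<in> ?R"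
    using z_last_consequences(3)[OF R z] sub[OF I(3)] pidealD(8)[OF R] by blast
  then have "2 * ?t + pconst a \<in> ?R" by (simp add: add.commute)
  \<comment> \<open>With t = z_{n-2}, both 2 t + a and t^2 - 1 are in the radical. The product a^2 -
    4 t^2 plus 4 (t^2 - 1) is the scalar a^2 - 4.\<close>
  then have "(2 * ?t + pconst a) * (pconst a - pconst 2 * ?t) \<in> ?R"
    by (rule pidealD(5)[OF R]) (intro polys_diff polys_mult polys_pconst t)
  then have "(2 * ?t + pconst a) * (pconst a - pconst 2 * ?t) + pconst 4 * (?t ^ 2 - 1) \<in> ?R"
    by (intro pidealD(3)[OF R] pidealD(4)[OF R z_last_consequences(2)[OF R z]] polys_pconst)
  also have "(2 * ?t + pconst a) * (pconst a - pconst 2 * ?t) + pconst 4 * (?t ^ 2 - 1) = pconst (a^2 - 4)"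
    by (simp add: algebra_simps power2_eq_square pconst_numeral)
  finally have "pconst (1 / (a^2 - 4)) * pconst (a^2 - 4) \<in> ?R"
    by (intro pidealD(4)[OF R] polys_pconst)
  also have "pconst (1 / (a^2 - 4)) * pconst (a^2 - 4) = pconst (1 / (a^2 - 4) * (a^2 - 4))"
    by (simp only: pconst_simps)
  also have "a^2 - 4 = (a - 2) * (a + 2)" by (simp add: algebra_simps power2_eq_square)
  then have "a^2 - 4 \<noteq> 0" using a eq_neg_iff_add_eq_0[of a 2] by auto
  then have "1 / (a^2 - 4) * (a^2 - 4) = 1" by simp
  finally show False using I(2) by (simp add: one_in_rad)
qed

text \<open>Separation extracts a polynomial in \<Omega> times a monomial. Primality discards the
  monomial, as none is in P, and then selects a linear factor of the polynomial.\<close>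

lemma \<Omega>_minus_in_prime:
  fixes P :: "'k::{alg_closed_field, field_char_0} mpoly set"
  assumes P: "pideal n P" "1 \<notin> P" "f \<in> P" "f \<noteq> 0"
    and prime: "\<And>a b. a \<in> polys {1..n} \<Longrightarrow> b \<in> polys {1..n} \<Longrightarrow> a * b \<in> P \<Longrightarrow> a \<in> P \<or> b \<in> P"
    and no_mono: "\<And>e. keys e \<subseteq> {1..n - 1} \<Longrightarrow> mono_eval z e \<notin> P"
  shows "\<exists>a. \<Omega> n - pconst a \<in> P"
proof -
  obtain e Q where e: "keys e \<subseteq> {1..n - 1}" and Q: "Q \<in> polys {1..n - 1}"
    and *: "mono_eval z e * f = zeval (\<Omega> n) Q"
    using clear_denominators[OF _ \<Omega>_linear pidealD(1)[OF P(1,3)]] n3 by auto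
  have mono_F: "mono_eval z e \<in> (polys {1..n} :: 'k mpoly set)"
    if "keys e \<subseteq> {1..n - 1}" for e
    using mono_eval_z_polys[OF that] by (rule polys_le) simp
  have "mono_eval z e * f \<noteq> 0"
    using P(4) by (simp add: mono_eval_def z_cont)
  then have "zeval (\<Omega> n) Q \<noteq> 0" unfolding * .
  then have "Q \<noteq> 0" by auto
  then obtain k0 where k0: "k0 \<in> keys Q" by (auto simp: poly_mapping_eq_iff fun_eq_iff in_keys_iff)
  have "mono_eval z e * f \<in> P" using P(3) mono_F[OF e] by (intro pidealD(4)[OF P(1)])
  then have sum: "(\<Sum>k\<in>keys Q. upoly (\<Omega> n) (lookup Q k) * mono_eval z k) \<in> P"
    unfolding * by (simp add: gen_eval_def)
  have "\<exists>e. keys e \<subseteq> {1..n - 1} \<and>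
      upoly (\<Omega> n) (lookup Q k0) * mono_eval z e \<in> P"
  proof (rule z_separation[OF n3 n_odd P(1), where M = "keys Q"
        and b = "\<lambda>k. upoly (\<Omega> n) (lookup Q k)"])
    show "keys k \<subseteq> {1..n - 1}" if "k \<in> keys Q" for k
      using that Q by (auto simp: polys_def)
    show "C_bracket n (upoly (\<Omega> n) (lookup Q k)) (z i) = 0" if "i \<in> {1..n - 1}" for k i
      using that
      by (intro derivation_upoly[OF is_derivation_C_bracket_left])
        (auto intro!: C_bracket_\<Omega>(1)[OF n3 n_odd] z_in_F)
  qed (use n3 n_odd k0 sum in auto)
  moreover have U: "upoly (\<Omega> n) p \<in> (polys {1..n} :: 'k mpoly set)" for p
    by (rule upoly_polys[OF \<Omega>_in_F[OF n3 n_odd]])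
  ultimately have "upoly (\<Omega> n) (lookup Q k0) \<in> P"
    using prime no_mono mono_F by blast
  moreover have "lookup Q k0 \<noteq> 0" using k0 by (simp add: in_keys_iff)
  ultimately obtain p where "p \<noteq> 0" "upoly (\<Omega> n) p \<in> P" by blast
  then show ?thesis
  proof (induction "degree p" arbitrary: p rule: less_induct)
    case less
    show ?case
    proof (cases "degree p = 0")
      case True
      then obtain c where p: "p = [:c:]" by (metis degree_eq_zeroE)
      then have "pconst (1 / c) * pconst c \<in> P" using less.prems by (intro pidealD(4)[OF P(1)]) auto
      moreover have "pconst (1 / c) * pconst c = pconst (1 / c * c)" by (simp only: pconst_simps)
      ultimately have "1 \<in> P" using less.prems p by simp
      then show ?thesis using P(2) by blast
    next
      case False
      then obtain a where "poly p a = 0" using alg_closed_imp_poly_has_root[of p] by auto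
      then obtain q where q: "p = [:- a, 1:] * q" by (metis dvdE poly_eq_0_iff_dvd)
      have "(\<Omega> n - pconst a) * upoly (\<Omega> n) q \<in> P"
        using less.prems(2) unfolding q upoly_mult by (simp add: add.commute)
      then have "\<Omega> n - pconst a \<in> P \<or> upoly (\<Omega> n) q \<in> P"
        using prime U \<Omega>_in_F[OF n3 n_odd] by (blast intro: polys_diff polys_pconst)
      moreover have "q \<noteq> 0" using less.prems(1) q by auto
      moreover from this have "degree q < degree p"
        unfolding q by (subst degree_mult_eq) auto
      ultimately show ?thesis using less.hyps by blast
    qed
  qed
qed

lemma poisson_prime_cases:
  fixes P :: "'k::{alg_closed_field, field_char_0} mpoly set"
  assumes P: "pideal n P" "1 \<notin> P" "P \<noteq> {0}"
    and prime: "\<And>a b. a \<in> polys {1..n} \<Longrightarrow> b \<in> polys {1..n} \<Longrightarrow> a * b \<in> P \<Longrightarrow> a \<in> P \<or> b \<in> P"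
  shows "(\<exists>a. P = {f \<in> polys {1..n}. \<Omega> n - pconst a dvd f}) \<or> cont 1 n \<in> P"
proof (cases "\<exists>e. keys e \<subseteq> {1..n - 1} \<and> mono_eval z e \<in> P")
  case True
  have "f \<in> P" if "f \<in> polys {1..n}" "f ^ k \<in> P" for f k
    using that by (induction k) (use prime P(2) in \<open>auto intro: polys_power\<close>)
  then show ?thesis using True z_last_in_radical[OF P(1) _ P(2)] by blast
next
  case False
  obtain f where "f \<in> P" "f \<noteq> 0" using P(3) pidealD(2)[OF P(1)] by blast
  then obtain a where a: "\<Omega> n - pconst a \<in> P"
    using \<Omega>_minus_in_prime[OF P(1,2) _ _ prime] False by blast
  have "P = {f \<in> polys {1..n}. \<Omega> n - pconst a dvd f}"
  proof (intro equalityI subsetI)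
    fix f assume "f \<in> P"
    then show "f \<in> {f \<in> polys {1..n}. \<Omega> n - pconst a dvd f}"
      using pideal_\<Omega>_monomial[OF P(1) a] False pidealD(1)[OF P(1)] by blast
  next
    fix f assume f: "f \<in> {f \<in> polys {1..n}. \<Omega> n - pconst a dvd f}"
    then obtain g where g: "f = (\<Omega> n - pconst a) * g" by (auto elim: dvdE)
    have "g \<in> polys {1..n}"
      using polys_dvd_cofactor[OF pidealD(1)[OF P(1) a] _ _ g] f prime_elem_\<Omega>(1)[of a]
      by (auto simp: prime_elem_def)
    then show "f \<in> P" unfolding g using a by (intro pidealD(5)[OF P(1)])
  qed
  then show ?thesis by blast
qed

end


section \<open>The ideals \<open>M\<^sub>1\<close> and \<open>M\<^sub>-\<^sub>1\<close>\<close>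

text \<open>The substitution in \<open>M_ideal\<close>, with \<theta>(z_{n-3}) written as a
  continuant. Its values lie in F_{n-2} inside F_n, so it is a retraction.\<close>

definition M_hom :: "nat \<Rightarrow> 'k::field \<Rightarrow> 'k mpoly \<Rightarrow> 'k mpoly" where
  "M_hom n l = peval pconst (\<lambda>i. if i = n - 1 then pconst l * cont 1 (n - 2)
     else if i = n then pconst l * cont 2 (n - 2) else pvar i)"

lemma is_hom_M_hom: "is_hom (M_hom n l)"
  unfolding M_hom_def by (rule is_hom_peval[OF is_hom_pconst])

lemma M_hom_pvar:
  "M_hom n l (pvar i) = (if i = n - 1 then pconst l * cont 1 (n - 2)
     else if i = n then pconst l * cont 2 (n - 2) else pvar i)"
  by (simp add: M_hom_def is_hom_pconst)

lemma M_hom_pconst [simp]: "M_hom n l (pconst c) = pconst c"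
  by (simp add: M_hom_def is_hom_pconst)

context
  fixes n :: nat
  assumes n3: "n \<ge> 3" and n_odd: "odd n"
begin

lemma M_hom_polys:
  assumes "f \<in> polys {1..n}"
  shows "M_hom n l f \<in> polys {1..n - 2}"
  unfolding M_hom_def
proof (rule peval_in_polys[OF assms])
  fix i assume "i \<in> {1..n}"
  then have "i = n - 1 \<or> i = n \<or> i \<in> {1..n - 2}" by auto
  then show "(if i = n - 1 then pconst l * cont 1 (n - 2)
     else if i = n then pconst l * cont 2 (n - 2) else pvar i) \<in> polys {1..n - 2}"
    using n3 by (auto intro!: polys_mult polys_pvar cont_polys)
qed

lemma M_hom_id:
  assumes "f \<in> polys {1..n - 2}"
  shows "M_hom n l f = f"
  by (rule hom_eqI[OF is_hom_M_hom _ _ _ assms, of "\<lambda>x. x"])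
    (use n3 in \<open>auto simp: is_hom_def M_hom_pvar\<close>)

lemma ideal_F_principal:
  assumes "p \<in> polys {1..m}" "p \<noteq> 0"
  shows "PIdl\<^bsub>F m\<^esub> p = {f \<in> polys {1..m}. p dvd f}"
  using polys_dvd_cofactor[OF assms(1) _ assms(2)] assms
  by (auto simp: cgenideal_def mult.commute intro: polys_intros elim!: dvdE)

lemma M_ideal_iff:
  "M_ideal n l = {f \<in> polys {1..n}. cont 1 (n - 1) - pconst (l :: 'k::field) dvd M_hom n l f}"
proof -
  let ?p = "cont 1 (n - 1) - pconst l :: 'k mpoly" and ?F = "F (n - 2) :: 'k mpoly ring"
  have idx: "Suc (n - 2) = n - 1" "Suc (n - 3) = n - 2" using n3 by auto
  have z: "z (n - 2) = (cont 1 (n - 1) :: 'k mpoly)" "z (n - 3) = (cont 1 (n - 2) :: 'k mpoly)"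
    by (simp_all only: z_cont idx)
  have \<theta>: "\<theta> n (cont 1 (n - 2)) = (cont 2 (n - 2) :: 'k mpoly)"
    using \<theta>_cont[of 1 "n - 2" n, where 'k = 'k] by (simp add: numeral_2_eq_2 One_nat_def)
  have p: "?p \<in> polys {1..n - 2}" using n3 by (intro polys_diff polys_pconst cont_polys) auto
  have "odd (n - 2)" using n3 n_odd by simp
  then have "?p \<noteq> 0" using prime_elem_z(1)[of "n - 2" l] n3 n_odd
    by (auto simp: idx prime_elem_def)
  then have J: "PIdl\<^bsub>?F\<^esub> ?p = {f \<in> polys {1..n - 2}. ?p dvd f}" by (rule ideal_F_principal[OF p])
  interpret R: cring ?F by (rule cring_F)
  interpret I: ideal "PIdl\<^bsub>?F\<^esub> ?p" ?F by (rule R.cgenideal_ideal) (simp add: p)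
  have coset: "PIdl\<^bsub>?F\<^esub> ?p +>\<^bsub>?F\<^esub> g = PIdl\<^bsub>?F\<^esub> ?p \<longleftrightarrow> ?p dvd g" if "g \<in> polys {1..n - 2}" for g
    using that I.a_rcos_const[of g] I.a_rcos_self[of g] by (auto simp: J)
  show ?thesis
    unfolding M_ideal_def Let_def z \<theta> M_hom_def[symmetric]
    using coset[OF M_hom_polys] by (auto simp: a_kernel_def' FactRing_def)
qed

context
  fixes l :: "'k::field_char_0"
  assumes l: "l * l = 1"
begin

abbreviation (input) "m_hom \<equiv> M_hom n l"
abbreviation (input) "m_gen \<equiv> cont 1 (n - 1) - pconst l :: 'k mpoly"

lemmas m_hom_simps = is_homD[OF is_hom_M_hom[of n l]]

lemma prime_elem_m_gen: "prime_elem m_gen"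
proof -
  have "odd (n - 2)" "Suc (n - 2) = n - 1" using n3 n_odd by auto
  then show ?thesis using prime_elem_z(1)[of "n - 2" l] n3 n_odd by metis
qed

lemma m_gen_poly: "m_gen \<in> polys {1..n - 2}"
  using n3 by (intro polys_diff polys_pconst cont_polys) auto

text \<open>n - 2 is odd, so z_{n-2} commutes with every variable it involves. Therefore multiples
  of \<open>m_gen\<close> in F_{n-2} stay multiples under brackets with F_{n-2}.\<close>

lemma m_gen_central:
  assumes "u \<in> polys {1..n - 2}"
  shows "C_bracket n m_gen u = 0"
proof (rule derivation_eq_0[OF is_derivation_C_bracket_right assms])
  fix i assume i: "i \<in> {1..n - 2}"
  have *: "Suc (n - 2) = n - 1" "odd (n - 2)" using n3 n_odd by auto
  have "C_bracket n (cont 1 (Suc (n - 2))) (pvar i) = (0 :: 'k mpoly)"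
    using C_bracket_z_pvar[OF n3 n_odd, of "n - 2" i, where 'k = 'k] i n3 *(2) by (simp del: cont.simps)
  then show "C_bracket n m_gen (pvar i) = 0" by (simp only: * C_bracket_left C_bracket_pconst) simp
qed simp

text \<open>\<open>l\<close> is its own inverse; expressions l z_{n-2} - 1 are what the substitution
  produces in the computations below.\<close>

lemma m_gen_smult: "pconst l * cont 1 (n - 1) - 1 = pconst l * m_gen"
  using l by (simp add: right_diff_distrib flip: pconst_simps(3))

section \<open>The substitution is a Poisson map modulo z_{n-2} - l\<close>

text \<open>The failure of \<open>m_hom\<close> to preserve brackets. It is additive and satisfies a
  Leibniz rule twisted by \<open>m_hom\<close>, so divisibility by \<open>m_gen\<close> can be
  tested on variables.\<close>

definition defect :: "'k mpoly \<Rightarrow> 'k mpoly \<Rightarrow> 'k mpoly" where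
  "defect f g = m_hom (C_bracket n f g) - C_bracket n (m_hom f) (m_hom g)"

lemma defect_antisym: "defect f g = - defect g f"
  using C_bracket_antisym[of n f g] C_bracket_antisym[of n "m_hom f" "m_hom g"]
  by (simp add: defect_def m_hom_simps)

lemma defect_step:
  "defect (f + g) h = defect f h + defect g h"
  "defect (f * g) h = defect f h * m_hom g + m_hom f * defect g h"
  "defect (pconst c) h = 0"
  by (simp_all add: defect_def m_hom_simps C_bracket_left algebra_simps)

lemma defect_induct:
  assumes "f \<in> polys {1..n}" "\<And>i. i \<in> {1..n} \<Longrightarrow> m_gen dvd defect (pvar i) h"
  shows "m_gen dvd defect f h"
  using assms(1) by (induction rule: polys_induct) (simp_all add: defect_step assms(2))

lemma defect_pvar_small:
  assumes "i \<in> {1..n - 2}" "j \<in> {1..n - 2}"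
  shows "defect (pvar i) (pvar j) = 0"
  using assms by (simp add: defect_def M_hom_id polys_pvar C_bracket_polys)

text \<open>For \<open>i \<le> n - 3\<close>, x_{n-1} and its image z_{n-3} (up to \<open>l\<close>)
  have the same weight with respect to x_i, and nothing remains. For the neighbour
  \<open>i = n - 2\<close> the constants and the recursion leave 1 - l z_{n-2}.\<close>

lemma defect_pred:
  assumes i: "i \<in> {1..n - 2}"
  shows "m_gen dvd defect (pvar (n - 1)) (pvar i)"
proof -
  have idx: "Suc (n - 3) = n - 2" using n3 by simp
  have x: "m_hom (pvar i) = pvar i" using i by (intro M_hom_id polys_pvar)
  have y: "m_hom (pvar (n - 1)) = pconst l * cont 1 (n - 2)" by (simp add: M_hom_pvar)
  have B: "C_bracket n (pvar (n - 1)) (pvar i) = (lin_coeff (n - 1) i :: 'k mpoly)"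
    using i n3 by (intro C_bracket_lin[OF n3 n_odd]) auto
  have A: "defect (pvar (n - 1)) (pvar i) =
      m_hom (lin_coeff (n - 1) i) - pconst l * C_bracket n (cont 1 (n - 2)) (pvar i)"
    by (simp add: defect_def x y B C_bracket_left)
  show ?thesis
  proof (cases "i = n - 2")
    case True
    have odd: "odd (n - 1 + (n - 2))" using n3 n_odd by simp
    have *: "i < n - 1" "n - 1 = Suc i" "Suc (n - 1) \<noteq> i" using True n3 by auto
    then have L: "lin_coeff (n - 1) i = 1 - pvar (n - 1) * (pvar i :: 'k mpoly)"
      using odd by (simp add: lin_coeff_def eps_def True)
    have "C_bracket n (cont 1 (n - 2)) (pvar i) = - (cont 1 (n - 3) :: 'k mpoly)"
      using C_bracket_z_next[OF n3 n_odd, of "n - 3", where 'k = 'k] n3 n_odd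
      unfolding idx True by simp
    then have "defect (pvar (n - 1)) (pvar i) =
        - (pconst l * (cont 1 (n - 2) * pvar i - cont 1 (n - 3)) - 1)"
      unfolding A L by (simp add: m_hom_simps x y algebra_simps)
    also have "cont 1 (n - 2) * pvar i - cont 1 (n - 3) = (cont 1 (n - 1) :: 'k mpoly)"
    proof -
      have "n - 1 - 1 = n - 2" "n - 1 - 2 = n - 3" "1 + (n - 1) - 2 = n - 2" using n3 by auto
      then show ?thesis using cont_rec(1)[of "n - 1" 1, where 'a = 'k] n3 True by simp
    qed
    finally show ?thesis unfolding m_gen_smult by simp
  next
    case False
    then have i': "1 \<le> i" "i \<le> n - 3" using i n3 by auto
    have even: "even (n - 1)" "even (n - 3)" using n_odd n3 by auto
    have *: "i < n - 1" "\<not> n - 1 < i" "n - 1 \<noteq> Suc i" "i \<noteq> Suc (n - 1)" using i' n3 by auto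
    have "lin_coeff (n - 1) i = (if even i then 1 else - 1) * pvar (n - 1) * (pvar i :: 'k mpoly)"
      using * n_odd by (simp add: lin_coeff_def eps_def)
    moreover have "C_bracket n (cont 1 (n - 2)) (pvar i) =
        (if even i then 1 else - 1) * cont 1 (n - 2) * (pvar i :: 'k mpoly)"
      using C_bracket_z_pvar[OF n3 n_odd, of "n - 3" i, where 'k = 'k] i' even(2) n3
      unfolding idx by simp
    ultimately have "defect (pvar (n - 1)) (pvar i) = 0"
      unfolding A by (simp add: m_hom_simps x y)
    then show ?thesis by simp
  qed
qed

text \<open>The mirror image: only \<open>i = 1\<close>, adjacent to x_n through the wrap-around
  relation, leaves something, namely l z_{n-2} - 1.\<close>

lemma defect_last:
  assumes i: "i \<in> {1..n - 2}"
  shows "m_gen dvd defect (pvar n) (pvar i)"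
proof -
  have x: "m_hom (pvar i) = pvar i" using i by (intro M_hom_id polys_pvar)
  have y: "m_hom (pvar n) = pconst l * cont 2 (n - 2)" using n3 by (simp add: M_hom_pvar)
  have odd: "odd (n - 2)" using n3 n_odd by auto
  have lin: "C_bracket n (pvar k) (pvar i) = (lin_coeff k i :: 'k mpoly)" if "2 \<le> k" "k + 1 < 2 + (n - 2)" for k
    using that i by (intro C_bracket_lin[OF n3 n_odd]) auto
  have iF: "n \<in> {1..n}" "i \<in> {1..n}" using i n3 by auto
  have A: "defect (pvar n) (pvar i) =
      m_hom (bracket_coeff n n i) - pconst l * C_bracket n (cont 2 (n - 2)) (pvar i)"
    by (simp add: defect_def x y C_bracket_pvar[OF iF] C_bracket_left)
  show ?thesis
  proof (cases "i = 1")
    case True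
    have L: "bracket_coeff n n i = pvar n * pvar 1 - (1 :: 'k mpoly)"
      using n3 n_odd by (simp add: bracket_coeff_def bracket_coeff_less_def True)
    have B: "C_bracket n (cont 2 (n - 2)) (pvar i) =
        (if even (n - 2) then eps 2 i * cont 2 (n - 2) * pvar i else 0)
        + (if 2 = Suc i then cont (Suc 2) (n - 2 - 1) else (0 :: 'k mpoly))"
      by (rule derivation_cont_left[OF is_derivation_C_bracket_left lin]) (auto simp: True)
    have *: "2 = Suc i" "Suc 2 = 3" "n - 2 - 1 = n - 3" using True by auto
    have "C_bracket n (cont 2 (n - 2)) (pvar i) = (cont 3 (n - 3) :: 'k mpoly)"
      using B odd unfolding if_P[OF *(1)] *(2,3) by simp
    then have "defect (pvar n) (pvar i) =
        pconst l * (pvar 1 * cont 2 (n - 2) - cont 3 (n - 3)) - 1"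
      unfolding A L using x y True by (simp add: m_hom_simps algebra_simps)
    also have "pvar 1 * cont 2 (n - 2) - cont 3 (n - 3) = (cont 1 (n - 1) :: 'k mpoly)"
    proof -
      have "n - 1 - 1 = n - 2" "n - 1 - 2 = n - 3" "1 + 1 = (2::nat)" "1 + 2 = (3::nat)" by auto
      then show ?thesis using cont_rec(2)[of "n - 1" 1, where 'a = 'k] n3 by simp
    qed
    finally show ?thesis unfolding m_gen_smult by simp
  next
    case False
    have *: "i < n" "\<not> n < i" "n \<noteq> Suc i" "i \<noteq> Suc n" "1 < i" using i n3 False by auto
    have "bracket_coeff n n i = (if even i then - 1 else 1) * pvar n * (pvar i :: 'k mpoly)"
      using bracket_coeff_lin[OF n_odd n3, of n i, where 'a = 'k] i * n_odd
      by (simp add: lin_coeff_def eps_def)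
    moreover have "C_bracket n (cont 2 (n - 2)) (pvar i) =
        (if odd (n - 2) then (if even (2 + i) then - 1 else 1) * cont 2 (n - 2) * pvar i
         else (0 :: 'k mpoly))"
      using * i n3
      by (intro derivation_cont_middle[OF is_derivation_C_bracket_left lin]) auto
    ultimately have "defect (pvar n) (pvar i) = 0"
      unfolding A using odd by (simp add: m_hom_simps x y)
    then show ?thesis by simp
  qed
qed

text \<open>By the determinant identity the bracket of z_{n-3} with \<theta>(z_{n-3}) is their
  product minus 1, exactly the shape of {x_{n-1}, x_n}; the scalars contribute l^2 = 1.\<close>

lemma defect_pred_last: "defect (pvar (n - 1)) (pvar n) = 0"
proof -
  have y: "m_hom (pvar (n - 1)) = pconst l * cont 1 (n - 2)" "m_hom (pvar n) = pconst l * cont 2 (n - 2)"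
    using n3 by (simp_all add: M_hom_pvar)
  have "bracket_coeff n (n - 1) n = pvar (n - 1) * pvar n - (1 :: 'k mpoly)"
    using n3 by (simp add: bracket_coeff_def bracket_coeff_less_def)
  then have B: "C_bracket n (pvar (n - 1)) (pvar n) = pvar (n - 1) * pvar n - (1 :: 'k mpoly)"
    using n3 by (subst C_bracket_pvar) auto
  have idx: "Suc (n - 3) = n - 2" "Suc (n - 2) = n - 1" "Suc 1 = 2" using n3 by auto
  have even: "even (n - 3)" "odd (n - 4)" if "n \<ge> 5" using n3 n_odd that by auto
  have "C_bracket n (cont 1 (n - 2)) (cont 2 (n - 2)) = cont 2 (n - 3) * (cont 1 (n - 1) :: 'k mpoly)"
  \<comment> \<open>For \<open>n = 3\<close> both continuants are 1, and the recursion used below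
    does not apply.\<close>
  proof (cases "n = 3")
    case True
    then show ?thesis by (simp add: C_bracket_left cont.simps(2)[folded One_nat_def])
  next
    case False
    then have n5: "n \<ge> 5" using n3 n_odd by (cases "n = 4") auto
    have rec: "cont 2 (n - 2) = cont 2 (n - 3) * pvar (n - 2) - (cont 2 (n - 4) :: 'k mpoly)"
    proof -
      have "n - 2 - 1 = n - 3" "n - 2 - 2 = n - 4" "2 + (n - 2) - 2 = n - 2" using n5 by auto
      then show ?thesis using cont_rec(1)[of "n - 2" 2, where 'a = 'k] n5 by simp
    qed
    have 1: "C_bracket n (cont 1 (n - 2)) (cont 2 (n - 3)) = cont 1 (n - 2) * (cont 2 (n - 3) :: 'k mpoly)"
      using C_bracket_z_cont[OF n3 n_odd, of "n - 3" 2 "n - 3", where 'k = 'k] n5 even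
      unfolding idx by simp
    have 2: "C_bracket n (cont 1 (n - 2)) (cont 2 (n - 4)) = (0 :: 'k mpoly)"
      using C_bracket_z_cont[OF n3 n_odd, of "n - 3" 2 "n - 4", where 'k = 'k] n5 even
      unfolding idx by simp
    have 3: "C_bracket n (cont 1 (n - 2)) (pvar (n - 2)) = - (cont 1 (n - 3) :: 'k mpoly)"
      using C_bracket_z_next[OF n3 n_odd, of "n - 3", where 'k = 'k] n5 even
      unfolding idx by simp
    have 4: "cont 1 (n - 1) = cont 1 (n - 2) * pvar (n - 2) - (cont 1 (n - 3) :: 'k mpoly)"
    proof -
      have "n - 1 - 1 = n - 2" "n - 1 - 2 = n - 3" "1 + (n - 1) - 2 = n - 2" using n3 by auto
      then show ?thesis using cont_rec(1)[of "n - 1" 1, where 'a = 'k] n3 by simp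
    qed
    show ?thesis unfolding rec C_bracket_right 1 2 3 4 by (simp add: algebra_simps)
  qed
  moreover have "cont 1 (n - 1) * cont 2 (n - 3) - cont 1 (n - 2) * cont 2 (n - 2) = (- 1 :: 'k mpoly)"
    using cont_det[of 1 "n - 3", where 'k = 'k] unfolding idx .
  ultimately have C: "C_bracket n (cont 1 (n - 2)) (cont 2 (n - 2)) =
      cont 1 (n - 2) * cont 2 (n - 2) - (1 :: 'k mpoly)"
    by (simp add: algebra_simps)
  have ll: "pconst l * pconst l = (1 :: 'k mpoly)"
    using l by (simp flip: pconst_simps(3))
  have "defect (pvar (n - 1)) (pvar n) =
      (pconst l * pconst l) * (cont 1 (n - 2) * cont 2 (n - 2)) - 1
      - (pconst l * pconst l) * C_bracket n (cont 1 (n - 2)) (cont 2 (n - 2))"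
    by (simp add: defect_def y B m_hom_simps C_bracket_left C_bracket_right mult_ac)
  then show ?thesis unfolding ll C by simp
qed

lemma defect_dvd:
  assumes "f \<in> polys {1..n}" "g \<in> polys {1..n}"
  shows "m_gen dvd defect f g"
proof -
  have split: "i \<in> {1..n - 2} \<or> i = n - 1 \<or> i = n" if "i \<in> {1..n}" for i
    using that by auto
  have self: "defect h h = 0" for h
  proof -
    have "C_bracket n f f = 0" for f :: "'k mpoly"
    proof -
      have "C_bracket n f f + C_bracket n f f = 0"
        by (subst (2) C_bracket_antisym) simp
      then have "pconst 2 * C_bracket n f f = 0" by (simp only: pconst_numeral mult_2)
      then show ?thesis by simp
    qed
    then show ?thesis by (simp add: defect_def m_hom_simps)
  qed
  have sym: "m_gen dvd defect a b" if "m_gen dvd defect b a" for a b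
    using that defect_antisym[of a b] by simp
  have gens: "m_gen dvd defect (pvar i) (pvar j)" if "i \<in> {1..n}" "j \<in> {1..n}" for i j
    using split[OF that(1)] split[OF that(2)]
      defect_pvar_small[of i j] defect_pred[of i] defect_pred[of j] defect_last[of i] defect_last[of j]
      sym[of "pvar (n - 1)" "pvar i"] sym[of "pvar n" "pvar i"] sym[of "pvar n" "pvar (n - 1)"]
      sym[of "pvar i" "pvar (n - 1)"] sym[of "pvar i" "pvar n"]
      defect_pred_last self
    by (elim disjE) (auto simp del: atLeastAtMost_iff)
  have "m_gen dvd defect (pvar j) f" if "j \<in> {1..n}" for j
    by (rule sym, rule defect_induct[OF assms(1) gens[OF _ that]])
  then show ?thesis
    by (intro sym[of g f] defect_induct[OF assms(2)])
qed

lemma M_ideal_memI: "f \<in> polys {1..n} \<Longrightarrow> m_gen dvd m_hom f \<Longrightarrow> f \<in> M_ideal n l"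
  by (simp add: M_ideal_iff)

text \<open>The image of {a, g} is the defect plus the bracket of the images. The image of a is
  \<open>m_gen * h\<close>, and centrality lets \<open>m_gen\<close> be pulled out of its
  bracket.\<close>

lemma pideal_M: "pideal n (M_ideal n l)"
  unfolding pideal_def
proof (intro conjI ballI)
  fix a g :: "'k mpoly" assume a: "a \<in> M_ideal n l" and g: "g \<in> polys {1..n}"
  have aF: "a \<in> polys {1..n}" using a by (simp add: M_ideal_iff)
  obtain h where h: "m_hom a = m_gen * h" using a by (auto simp: M_ideal_iff elim: dvdE)
  have "C_bracket n (m_hom a) (m_hom g) = m_gen * C_bracket n h (m_hom g)"
    unfolding h C_bracket_mult_left using m_gen_central[OF M_hom_polys[OF g]] by simp
  then have "m_gen dvd defect a g + C_bracket n (m_hom a) (m_hom g)"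
    using defect_dvd[OF aF g] by simp
  then show "C_bracket n a g \<in> M_ideal n l"
    using aF g by (intro M_ideal_memI C_bracket_polys) (auto simp: defect_def)
qed (auto simp: M_ideal_iff m_hom_simps intro: polys_add polys_mult)

lemma M_prime:
  "1 \<notin> M_ideal n l"
  "a \<in> polys {1..n} \<Longrightarrow> b \<in> polys {1..n} \<Longrightarrow> a * b \<in> M_ideal n l \<Longrightarrow> a \<in> M_ideal n l \<or> b \<in> M_ideal n l"
  using prime_elem_m_gen by (auto simp: M_ideal_iff m_hom_simps prime_elem_def)

lemma M_nonzero: "M_ideal n l \<noteq> {0}"
proof -
  have "m_gen \<in> M_ideal n l"
    using m_gen_poly M_hom_id[OF m_gen_poly] by (intro M_ideal_memI polys_le[OF m_gen_poly]) auto
  moreover have "m_gen \<noteq> 0" using prime_elem_m_gen by (simp add: prime_elem_def)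
  ultimately show ?thesis by blast
qed

lemma z_last_in_M: "cont 1 n \<in> M_ideal n l"
proof (rule M_ideal_memI)
  show "cont 1 n \<in> polys {1..n}" by (rule cont_in_F) auto
  have rec: "cont 1 n = cont 1 (n - 1) * pvar (n - 1) - (cont 1 (n - 2) :: 'k mpoly)"
    using cont_rec(1)[of n 1, where 'a = 'k] n3 by (simp flip: One_nat_def)
  have "cont 1 (n - 1) \<in> (polys {1..n - 2} :: 'k mpoly set)"
    "cont 1 (n - 2) \<in> (polys {1..n - 2} :: 'k mpoly set)"
    using n3 by (auto intro!: cont_polys)
  then have "m_hom (cont 1 n) = cont 1 (n - 1) * (pconst l * cont 1 (n - 2)) - cont 1 (n - 2)"
    unfolding rec by (simp add: m_hom_simps M_hom_id M_hom_pvar)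
  also have "\<dots> = (pconst l * cont 1 (n - 1) - 1) * cont 1 (n - 2)" by (simp add: algebra_simps)
  finally show "m_gen dvd m_hom (cont 1 n)" unfolding m_gen_smult by simp
qed

lemma \<Omega>_in_M: "\<Omega> n + pconst (2 * l) \<in> M_ideal n l"
proof -
  have "m_gen \<in> M_ideal n l"
    using m_gen_poly M_hom_id[OF m_gen_poly] by (intro M_ideal_memI polys_le[OF m_gen_poly]) auto
  then have "pconst 2 * m_gen \<in> M_ideal n l" by (rule pidealD(4)[OF pideal_M _ polys_pconst])
  then have "(\<Omega> n + 2 * cont 1 (n - 1)) - pconst 2 * m_gen \<in> M_ideal n l"
    using z_last_consequences(3)[OF n3 n_odd pideal_M z_last_in_M] pidealD(8)[OF pideal_M] by blast
  then show ?thesis by (simp add: algebra_simps pconst_numeral)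
qed

text \<open>Unlike \<open>M\<^sub>l\<close>, a principal ideal \<open>(\<Omega> - a)\<close> contains no nonzero polynomial free of \<open>x\<^sub>n\<close>.\<close>

lemma M_not_principal: "M_ideal n l \<noteq> {f \<in> polys {1..n}. \<Omega> n - pconst a dvd f}"
proof
  assume eq: "M_ideal n l = {f \<in> polys {1..n}. \<Omega> n - pconst a dvd f}"
  have "\<Omega> n - pconst a dvd cont 1 n" using z_last_in_M eq by auto
  moreover have "cont 1 n \<in> (polys (- {n}) :: 'k mpoly set)" by (rule cont_polys) auto
  ultimately have "cont 1 n = (0 :: 'k mpoly)" using prime_elem_\<Omega>(2)[OF n3 n_odd] by blast
  then show False using cont_nz[of 1 "n - 1", where 'k = 'k] n3 by simp
qed

text \<open>P contains the two remaining generators of M_l, from z_{n-1} and from the bracket of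
  \<open>m_gen\<close> with x_n, so each \<open>f\<close> is congruent to \<open>m_hom f\<close>. It
  remains to see that \<open>m_gen\<close> divides every element of P in F_{n-2}.\<close>

lemma prime_over_z_last_eq_M:
  fixes P :: "'k mpoly set"
  assumes P: "pideal n P" "1 \<notin> P"
    and prime: "\<And>a b. a \<in> polys {1..n} \<Longrightarrow> b \<in> polys {1..n} \<Longrightarrow> a * b \<in> P \<Longrightarrow> a \<in> P \<or> b \<in> P"
    and z: "cont 1 n \<in> P" and pP: "m_gen \<in> P"
  shows "P = M_ideal n l"
proof -
  have ll: "pconst l * pconst l = (1 :: 'k mpoly)"
    using l by (simp flip: pconst_simps(3))
  have F: "pvar n \<in> (polys {1..n} :: 'k mpoly set)" "pvar (n - 1) \<in> (polys {1..n} :: 'k mpoly set)"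
    using n3 by (auto intro!: polys_pvar)
  have rec: "cont 1 n = cont 1 (n - 1) * pvar (n - 1) - (cont 1 (n - 2) :: 'k mpoly)"
    using cont_rec(1)[of n 1, where 'a = 'k] n3 by (simp flip: One_nat_def)
  have "pconst l * cont 1 n - m_gen * (pconst l * pvar (n - 1)) \<in> P"
    by (intro pidealD(8)[OF P(1)] pidealD(4)[OF P(1) z] pidealD(5)[OF P(1) pP] polys_mult F polys_pconst)
  also have "pconst l * cont 1 n - m_gen * (pconst l * pvar (n - 1)) =
      (pconst l * pconst l) * pvar (n - 1) - pconst l * cont 1 (n - 2)"
    unfolding rec by (simp add: algebra_simps)
  finally have g1: "pvar (n - 1) - pconst l * cont 1 (n - 2) \<in> P" unfolding ll by simp
  have "C_bracket n m_gen (pvar n) \<in> P" by (rule pidealD(6)[OF P(1) pP F(1)])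
  then have "- pconst l * (C_bracket n m_gen (pvar n) + m_gen * pvar n) \<in> P"
    by (intro pidealD(4)[OF P(1)] pidealD(3)[OF P(1)] pidealD(5)[OF P(1) pP] polys_uminus F polys_pconst)
  also have "- pconst l * (C_bracket n m_gen (pvar n) + m_gen * pvar n) =
      (pconst l * pconst l) * pvar n - pconst l * cont 2 (n - 2)"
    using C_bracket_z_prev_last[OF n3 n_odd, where 'k = 'k]
    by (simp add: C_bracket_left algebra_simps)
  finally have g2: "pvar n - pconst l * cont 2 (n - 2) \<in> P" unfolding ll by simp
  have m_hom_F: "m_hom f \<in> polys {1..n}" if "f \<in> polys {1..n}" for f
    using M_hom_polys[OF that] by (rule polys_le) simp
  have mod: "f - m_hom f \<in> P" if "f \<in> polys {1..n}" for f
    using that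
  proof (induction rule: polys_induct)
    case (const c)
    then show ?case using pidealD(2)[OF P(1)] by simp
  next
    case (var i)
    then show ?case using g1 g2 pidealD(2)[OF P(1)] n3 by (simp add: M_hom_pvar)
  next
    case (add f g)
    then have "(f - m_hom f) + (g - m_hom g) \<in> P" using pidealD(3)[OF P(1)] by blast
    then show ?case by (simp add: m_hom_simps algebra_simps)
  next
    case (mult f g)
    then have "f * (g - m_hom g) + (f - m_hom f) * m_hom g \<in> P"
      using m_hom_F by (intro pidealD(3)[OF P(1)] pidealD(4)[OF P(1)] pidealD(5)[OF P(1)])
    then show ?case by (simp add: m_hom_simps algebra_simps)
  qed
  \<comment> \<open>A prime containing such a monomial contains some z_i with
    \<open>1 \<le> i \<le> n - 3\<close>, and the descent would give 1.\<close>
  have no_mono: "mono_eval z e \<notin> P" if "keys e \<subseteq> {1..n - 2 - 1}" for e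
  proof
    assume "mono_eval z e \<in> P"
    have zF: "z i \<in> (polys {1..n} :: 'k mpoly set)" if "i \<le> n" for i using that by (rule z_in_F)
    have *: "\<exists>i\<in>A. z i \<in> P" if "(\<Prod>i\<in>A. z i ^ k i) \<in> P" "A \<subseteq> {..n}" "finite A" for A k
      using that(3,1,2)
    proof (induction A rule: finite_induct)
      case (insert i A)
      have "z i ^ k i \<in> P \<or> (\<Prod>i\<in>A. z i ^ k i) \<in> P"
        using insert by (intro prime) (auto intro!: polys_power polys_prod zF)
      moreover have "z i \<in> P" if "z i ^ j \<in> P" for j
        using that by (induction j) (use prime P(2) insert.prems(2) in \<open>auto intro: polys_power zF\<close>)
      ultimately show ?case using insert by auto
    qed (use P(2) in simp)
    have "{1..n - 2 - 1} \<subseteq> {..n}" by auto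
    then have "keys e \<subseteq> {..n}" using that by blast
    then obtain i where "i \<in> keys e" "z i \<in> P"
      using *[of "lookup e" "keys e"] finite_keys[of e] \<open>mono_eval z e \<in> P\<close>
      unfolding mono_eval_def by blast
    moreover from this have "i \<in> {1..n - 2 - 1}" using that by blast
    ultimately have "1 \<in> P" using z_descent[OF n3 n_odd P(1), of i] by (auto simp: z_cont)
    then show False using P(2) by simp
  qed
  have Suc: "Suc (n - 2) = n - 1" "odd (n - 2)" using n3 n_odd by auto
  show ?thesis
  proof (intro equalityI subsetI)
    fix f assume f: "f \<in> P"
    have fF: "f \<in> polys {1..n}" using pidealD(1)[OF P(1) f] .
    have "f - (f - m_hom f) \<in> P" using f mod[OF fF] pidealD(8)[OF P(1)] by blast
    then have m_hom_f: "m_hom f \<in> P" by simp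
    have "m_gen dvd m_hom f"
    proof (rule ccontr)
      assume "\<not> m_gen dvd m_hom f"
      \<comment> \<open>The second use of the monomial argument, in F_{n-2} with z_{n-2} in place of
        \<Omega>.\<close>
      have "\<exists>e. keys e \<subseteq> {1..n - 2 - 1} \<and> mono_eval z e \<in> P"
      proof (rule monomial_in_pideal[OF n3 n_odd P(1), where c = "cont 1 (n - 1)" and a = l and f = "m_hom f"])
        show "cont 1 (n - 1) \<in> (polys {1..n - 2} :: 'k mpoly set)" using n3 by (intro cont_polys) auto
        have "n - 1 - 1 = n - 2" "n - 1 - 2 = n - 3" "1 + (n - 1) - 2 = n - 2" "2 \<le> n - 1" using n3 by auto
        then have "cont 1 (n - 2) * pvar (n - 2) - cont 1 (n - 1) = (cont 1 (n - 3) :: 'k mpoly)"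
          using cont_rec(1)[of "n - 1" 1, where 'a = 'k] by simp
        then show "cont 1 (n - 2) * pvar (n - 2) - cont 1 (n - 1) \<in> (polys {1..n - 2 - 1} :: 'k mpoly set)"
          using n3 by (auto intro!: cont_polys)
        show "r = 0" if "r \<in> polys (- {n - 2})" "m_gen dvd r" for r
          using prime_elem_z(2)[OF Suc(2), of _ l] that(1) that(2) unfolding Suc(1) by blast
      qed (use Suc m_hom_f M_hom_polys[OF fF] prime_elem_m_gen pP \<open>\<not> m_gen dvd m_hom f\<close> in auto)
      then show False using no_mono by blast
    qed
    then show "f \<in> M_ideal n l" by (rule M_ideal_memI[OF fF])
  next
    fix f assume f: "f \<in> M_ideal n l"
    then have fF: "f \<in> polys {1..n}" by (simp add: M_ideal_iff)
    obtain h where h: "m_hom f = m_gen * h" using f by (auto simp: M_ideal_iff elim: dvdE)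
    have "h \<in> polys {1..n - 2}"
      using polys_dvd_cofactor[OF m_gen_poly M_hom_polys[OF fF] _ h] prime_elem_m_gen by (simp add: prime_elem_def)
    then have "h \<in> polys {1..n}" by (rule polys_le) simp
    then have "m_hom f \<in> P" unfolding h using pP by (intro pidealD(5)[OF P(1)])
    then have "(f - m_hom f) + m_hom f \<in> P" using mod[OF fF] pidealD(3)[OF P(1)] by blast
    then show "f \<in> P" by simp
  qed
qed

end

end


section \<open>Quotients\<close>

lemma with_bracket_simps [simp]:
  "carrier (with_bracket R b) = carrier R" "monoid.mult (with_bracket R b) = monoid.mult R"
  "one (with_bracket R b) = one R" "ring.zero (with_bracket R b) = ring.zero R"
  "add (with_bracket R b) = add R" "bracket (with_bracket R b) = b"
  by (simp_all add: with_bracket_def ring.extend_def)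

lemma ring_with_bracket:
  assumes "ring R"
  shows "ring (with_bracket R b)"
proof -
  interpret ring R by fact
  have "\<exists>y\<in>carrier R. y \<oplus>\<^bsub>R\<^esub> x = \<zero>\<^bsub>R\<^esub>" if "x \<in> carrier R" for x
    using that l_neg a_inv_closed by blast
  then show ?thesis
    by (intro ringI abelian_groupI monoidI) (auto simp: a_ac m_assoc l_distr r_distr)
qed

lemma ideal_with_bracket:
  assumes "ideal I R"
  shows "ideal I (with_bracket R b)"
proof -
  interpret ideal I R by fact
  have "subgroup I (add_monoid R)" by (rule additive_subgroup.a_subgroup[OF additive_subgroup_axioms])
  then have "subgroup I (add_monoid (with_bracket R b))"
    by (simp add: subgroup_def m_inv_def)
  then show ?thesis
    by (intro idealI ring_with_bracket ring_axioms) (auto intro: I_l_closed I_r_closed)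
qed

lemma mem_coset_FC: "y \<in> J +>\<^bsub>FC n\<^esub> x \<longleftrightarrow> y - x \<in> J"
proof
  assume "y - x \<in> J"
  then have "(y - x) \<oplus>\<^bsub>FC n\<^esub> x \<in> J +>\<^bsub>FC n\<^esub> x" unfolding a_r_coset_def' by blast
  then show "y \<in> J +>\<^bsub>FC n\<^esub> x" by simp
qed (auto simp: a_r_coset_def')

context
  fixes n :: nat and J :: "'k::field mpoly set"
  assumes J: "pideal n J"
begin

abbreviation (input) "coset \<equiv> \<lambda>x. J +>\<^bsub>FC n\<^esub> x"

lemma coset_eq_iff: "coset x = coset y \<longleftrightarrow> x - y \<in> J"
proof
  assume "coset x = coset y"
  moreover have "x \<in> coset x" using pidealD(2)[OF J] by (simp add: mem_coset_FC)
  ultimately show "x - y \<in> J" by (simp add: mem_coset_FC)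
next
  assume *: "x - y \<in> J"
  show "coset x = coset y"
  proof (rule Set.set_eqI)
    fix u
    have "u - y = (u - x) + (x - y)" "u - x = (u - y) - (x - y)" by simp_all
    then show "u \<in> coset x \<longleftrightarrow> u \<in> coset y"
      using * pidealD(3,8)[OF J] unfolding mem_coset_FC by metis
  qed
qed

lemma coset_0: "coset 0 = J"
  by (rule Set.set_eqI) (simp add: mem_coset_FC)

lemma carrier_poisson_quot: "carrier (poisson_quot (FC n) J) = coset ` polys {1..n}"
  by (auto simp: poisson_quot_def FactRing_def A_RCOSETS_def')

lemma zero_poisson_quot: "\<zero>\<^bsub>poisson_quot (FC n) J\<^esub> = J"
  by (simp add: poisson_quot_def FactRing_def)

lemma ideal_J: "ideal J (FC n)"
  using J poisson_ideal_FC_iff by (auto simp: poisson_ideal_def)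

lemma add_poisson_quot:
  "x \<in> polys {1..n} \<Longrightarrow> y \<in> polys {1..n} \<Longrightarrow>
    coset x \<oplus>\<^bsub>poisson_quot (FC n) J\<^esub> coset y = coset (x + y)"
  using abelian_subgroup.a_rcos_sum[OF ideal.axioms(1)[OF ideal_J, THEN abelian_subgroupI3], of x y]
    cring_FC[of n] cring.axioms(1) ring.is_abelian_group
  by (auto simp: poisson_quot_def FactRing_def)

lemma mult_poisson_quot:
  "x \<in> polys {1..n} \<Longrightarrow> y \<in> polys {1..n} \<Longrightarrow>
    coset x \<otimes>\<^bsub>poisson_quot (FC n) J\<^esub> coset y = coset (x * y)"
  using ideal.rcoset_mult_add[OF ideal_J, of x y]
  by (simp add: poisson_quot_def FactRing_def)

lemma bracket_poisson_quot:
  assumes "x \<in> polys {1..n}" "y \<in> polys {1..n}"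
  shows "bracket (poisson_quot (FC n) J) (coset x) (coset y) = coset (C_bracket n x y)"
proof -
  have "coset (C_bracket n a b) = coset (C_bracket n x y)" if "a \<in> coset x" "b \<in> coset y" for a b
  proof -
    have 1: "a - x \<in> J" "b - y \<in> J" using that by (simp_all add: mem_coset_FC)
    have "b = (b - y) + y" by simp
    then have b: "b \<in> polys {1..n}"
      using pidealD(1)[OF J 1(2)] assms(2) polys_add by metis
    \<comment> \<open>This sum is the difference of the brackets of two pairs of representatives, so
      the union defining the quotient bracket is a single coset.\<close>
    have "C_bracket n (a - x) b + C_bracket n x (b - y) \<in> J"
      using 1 b assms by (intro pidealD(3)[OF J] pidealD(6)[OF J] pidealD(9)[OF J])
    then show ?thesis by (simp add: coset_eq_iff C_bracket_left C_bracket_right)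
  qed
  moreover have "x \<in> coset x" "y \<in> coset y" using pidealD(2)[OF J] by (simp_all add: mem_coset_FC)
  ultimately have "(\<Union>a\<in>coset x. \<Union>b\<in>coset y. coset (C_bracket n a b)) = coset (C_bracket n x y)"
    by blast
  then show ?thesis by (simp add: poisson_quot_def)
qed

lemma poisson_ideal_coset_image:
  assumes I: "pideal n I"
  shows "poisson_ideal (coset ` I) (poisson_quot (FC n) J)"
  unfolding poisson_ideal_def
proof (intro conjI ballI)
  have "ideal I (FC n)" using I poisson_ideal_FC_iff by (auto simp: poisson_ideal_def)
  then have "ideal (coset ` I) (FC n Quot J)"
    using ring.ring_ideal_imp_quot_ideal[OF cring.axioms(1)[OF cring_FC] ideal_J] by blast
  then show "ideal (coset ` I) (poisson_quot (FC n) J)"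
    by (simp add: poisson_quot_def ideal_with_bracket)
  fix X Y assume "X \<in> coset ` I" "Y \<in> carrier (poisson_quot (FC n) J)"
  then obtain a b where ab: "a \<in> I" "b \<in> polys {1..n}" "X = coset a" "Y = coset b"
    by (auto simp: carrier_poisson_quot)
  then show "bracket (poisson_quot (FC n) J) X Y \<in> coset ` I"
    using pidealD(1)[OF I ab(1)] pidealD(6)[OF I ab(1,2)] by (simp add: bracket_poisson_quot)
qed

lemma pideal_coset_vimage:
  assumes K: "poisson_ideal K (poisson_quot (FC n) J)"
  shows "pideal n {x \<in> polys {1..n}. coset x \<in> K}"
proof -
  interpret K: ideal K "poisson_quot (FC n) J" using K by (simp add: poisson_ideal_def)
  note zero = additive_subgroup.zero_closed[OF K.additive_subgroup_axioms]
    and add = additive_subgroup.a_closed[OF K.additive_subgroup_axioms]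
  have br: "bracket (poisson_quot (FC n) J) X Y \<in> K"
    if "X \<in> K" "Y \<in> carrier (poisson_quot (FC n) J)" for X Y
    using K that by (auto simp: poisson_ideal_def)
  have car: "coset x \<in> carrier (poisson_quot (FC n) J)" if "x \<in> polys {1..n}" for x
    using that by (simp add: carrier_poisson_quot)
  show ?thesis
    unfolding pideal_def
  proof (intro conjI ballI)
    show "0 \<in> {x \<in> polys {1..n}. coset x \<in> K}"
      using zero by (simp add: coset_0 zero_poisson_quot)
  next
    fix a b assume "a \<in> {x \<in> polys {1..n}. coset x \<in> K}" "b \<in> {x \<in> polys {1..n}. coset x \<in> K}"
    then show "a + b \<in> {x \<in> polys {1..n}. coset x \<in> K}"
      using add[of "coset a" "coset b"] by (auto simp: add_poisson_quot intro: polys_add)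
  next
    fix a r :: "'k mpoly" assume "a \<in> {x \<in> polys {1..n}. coset x \<in> K}" "r \<in> polys {1..n}"
    then show "r * a \<in> {x \<in> polys {1..n}. coset x \<in> K}"
      using K.I_l_closed[of "coset a" "coset r"] car
      by (auto simp: mult_poisson_quot intro: polys_mult)
  next
    fix a r :: "'k mpoly" assume "a \<in> {x \<in> polys {1..n}. coset x \<in> K}" "r \<in> polys {1..n}"
    then show "C_bracket n a r \<in> {x \<in> polys {1..n}. coset x \<in> K}"
      using br[of "coset a" "coset r"] car
      by (auto simp: bracket_poisson_quot intro: C_bracket_polys)
  qed auto
qed

lemma poisson_simple_quot_iff:
  "poisson_simple (poisson_quot (FC n) J) \<longleftrightarrow>
    J \<noteq> polys {1..n} \<and> (\<forall>I. pideal n I \<longrightarrow> J \<subseteq> I \<longrightarrow> I = J \<or> I = polys {1..n})"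
proof -
  let ?Q = "poisson_quot (FC n) J"
  have J_iff: "coset x = J \<longleftrightarrow> x \<in> J" for x
    using coset_eq_iff[of x 0] by (simp add: coset_0)
  have trivial: "carrier ?Q = {\<zero>\<^bsub>?Q\<^esub>} \<longleftrightarrow> J = polys {1..n}"
  proof -
    have "J \<in> coset ` polys {1..n}" using coset_0 by (metis imageI polys_0)
    then have "coset ` polys {1..n} = {J} \<longleftrightarrow> coset ` polys {1..n} \<subseteq> {J}" by blast
    also have "\<dots> \<longleftrightarrow> polys {1..n} \<subseteq> J"
      unfolding image_subset_iff by (simp add: J_iff subset_eq)
    also have "\<dots> \<longleftrightarrow> J = polys {1..n}" using pidealD(1)[OF J] by blast
    finally show ?thesis unfolding carrier_poisson_quot zero_poisson_quot .
  qed
  show ?thesis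
  proof
    assume simple: "poisson_simple ?Q"
    show "J \<noteq> polys {1..n} \<and> (\<forall>I. pideal n I \<longrightarrow> J \<subseteq> I \<longrightarrow> I = J \<or> I = polys {1..n})"
    proof (intro conjI allI impI)
      show "J \<noteq> polys {1..n}" using simple trivial by (simp add: poisson_simple_def)
      fix I assume I: "pideal n I" "J \<subseteq> I"
      have "coset ` I = {J} \<or> coset ` I = coset ` polys {1..n}"
        using simple poisson_ideal_coset_image[OF I(1)]
        unfolding poisson_simple_def carrier_poisson_quot zero_poisson_quot by blast
      then show "I = J \<or> I = polys {1..n}"
      proof
        assume "coset ` I = {J}"
        then have "I \<subseteq> J" using J_iff by blast
        then show ?thesis using I(2) by blast
      next
        assume *: "coset ` I = coset ` polys {1..n}"
        have "x \<in> I" if "x \<in> polys {1..n}" for x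
        proof -
          have "coset x \<in> coset ` I" unfolding * using that by (rule imageI)
          then obtain a where a: "coset x = coset a" "a \<in> I" by (rule imageE)
          have "x - a \<in> I" using a(1) I(2) by (simp only: coset_eq_iff subset_iff)
          then show ?thesis using pidealD(3)[OF I(1) _ a(2), of "x - a"] by simp
        qed
        then show ?thesis using pidealD(1)[OF I(1)] by blast
      qed
    qed
  next
    assume *: "J \<noteq> polys {1..n} \<and> (\<forall>I. pideal n I \<longrightarrow> J \<subseteq> I \<longrightarrow> I = J \<or> I = polys {1..n})"
    show "poisson_simple ?Q"
      unfolding poisson_simple_def
    proof (intro conjI allI impI)
      show "carrier ?Q \<noteq> {\<zero>\<^bsub>?Q\<^esub>}" using * trivial by simp
      fix K assume K: "poisson_ideal K ?Q"
      let ?I = "{x \<in> polys {1..n}. coset x \<in> K}"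
      interpret K: ideal K ?Q using K by (simp add: poisson_ideal_def)
      have zero: "J \<in> K" using additive_subgroup.zero_closed[OF K.additive_subgroup_axioms]
        by (simp add: zero_poisson_quot)
      have K_eq: "K = coset ` ?I"
        using additive_subgroup.a_subset[OF K.additive_subgroup_axioms]
        unfolding carrier_poisson_quot by blast
      have "x \<in> ?I" if "x \<in> J" for x
      proof -
        have "coset x = J" using that J_iff by blast
        then show ?thesis using zero pidealD(1)[OF J that] by simp
      qed
      then have "J \<subseteq> ?I" by blast
      then have "?I = J \<or> ?I = polys {1..n}" using * pideal_coset_vimage[OF K] by blast
      then show "K = {\<zero>\<^bsub>?Q\<^esub>} \<or> K = carrier ?Q"
      proof
        assume "?I = J"
        then have "K = coset ` J" using K_eq by simp
        also have "\<dots> = {J}" using J_iff pidealD(2)[OF J] by blast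
        finally show ?thesis by (simp add: zero_poisson_quot)
      next
        assume "?I = polys {1..n}"
        then show ?thesis using K_eq by (simp add: carrier_poisson_quot)
      qed
    qed
  qed
qed

end


section \<open>Classification\<close>

context
  fixes n :: nat
  assumes n3: "n \<ge> 3" and n_odd: "odd n"
begin

lemma \<Omega>_minus_in_F: "\<Omega> n - pconst a \<in> polys {1..n}"
  using \<Omega>_in_F[OF n3 n_odd] by (intro polys_diff polys_pconst)

lemma PIdl_\<Omega>:
  "PIdl\<^bsub>FC n\<^esub> (\<Omega> n - pconst a) = {f \<in> polys {1..n}. \<Omega> n - pconst a dvd f}"
  by (rule ideal_FC_principal[OF \<Omega>_minus_in_F])

lemma pideal_PIdl_\<Omega>:
  fixes a :: "'k::field_char_0"
  shows "pideal n (PIdl\<^bsub>FC n\<^esub> (\<Omega> n - pconst a))"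
  unfolding PIdl_\<Omega> pideal_def
proof (intro conjI ballI)
  fix f g :: "'k mpoly"
  assume f: "f \<in> {f \<in> polys {1..n}. \<Omega> n - pconst a dvd f}" and g: "g \<in> polys {1..n}"
  obtain h where h: "f = (\<Omega> n - pconst a) * h" using f by (auto elim: dvdE)
  have "C_bracket n f g = (\<Omega> n - pconst a) * C_bracket n h g"
    unfolding h C_bracket_mult_left using C_bracket_\<Omega>(1)[OF n3 n_odd g] by (simp add: C_bracket_left)
  then have "\<Omega> n - pconst a dvd C_bracket n f g" by (metis dvd_triv_left)
  then show "C_bracket n f g \<in> {f \<in> polys {1..n}. \<Omega> n - pconst a dvd f}"
    using f g C_bracket_polys by blast
qed (auto intro: polys_add polys_mult)

lemma pideal_PIdl_\<Omega>_prime: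
  fixes a :: "'k::field_char_0"
  shows "1 \<notin> PIdl\<^bsub>FC n\<^esub> (\<Omega> n - pconst a)" "PIdl\<^bsub>FC n\<^esub> (\<Omega> n - pconst a) \<noteq> {0}"
    "f \<in> polys {1..n} \<Longrightarrow> g \<in> polys {1..n} \<Longrightarrow> f * g \<in> PIdl\<^bsub>FC n\<^esub> (\<Omega> n - pconst a) \<Longrightarrow>
      f \<in> PIdl\<^bsub>FC n\<^esub> (\<Omega> n - pconst a) \<or> g \<in> PIdl\<^bsub>FC n\<^esub> (\<Omega> n - pconst a)"
proof -
  have "\<Omega> n - pconst a \<noteq> 0" using prime_elem_\<Omega>(1)[OF n3 n_odd, of a] unfolding prime_elem_def by blast
  moreover have "\<Omega> n - pconst a \<in> PIdl\<^bsub>FC n\<^esub> (\<Omega> n - pconst a)"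
    unfolding PIdl_\<Omega> using \<Omega>_minus_in_F[of a] by simp
  ultimately show "PIdl\<^bsub>FC n\<^esub> (\<Omega> n - pconst a) \<noteq> {0}" by blast
qed (use prime_elem_\<Omega>(1)[OF n3 n_odd, of a] in \<open>auto simp: prime_elem_def PIdl_\<Omega>\<close>)

lemma one_in_pideal: "pideal n I \<Longrightarrow> I = polys {1..n} \<longleftrightarrow> 1 \<in> I"
  using pidealD(1,5)[of n I] by force

lemma poisson_primes:
  "{P :: 'k::{alg_closed_field, field_char_0} mpoly set.
      poisson_prime_ideal P (FC n) \<and> P \<noteq> {0} \<and> P \<noteq> carrier (FC n)} =
    {PIdl\<^bsub>FC n\<^esub> (\<Omega> n - pconst l) | l. True} \<union> {M_ideal n 1, M_ideal n (- 1)}"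
proof (intro equalityI subsetI)
  fix P :: "'k mpoly set"
  assume "P \<in> {P. poisson_prime_ideal P (FC n) \<and> P \<noteq> {0} \<and> P \<noteq> carrier (FC n)}"
  then have P: "pideal n P" "P \<noteq> {0}" and "primeideal P (FC n)"
    by (auto simp: poisson_prime_ideal_def poisson_ideal_FC_iff)
  then have one: "1 \<notin> P" using primeideal_FC_iff[OF P(1)] by simp
  have prime: "a \<in> P \<or> b \<in> P" if "a \<in> polys {1..n}" "b \<in> polys {1..n}" "a * b \<in> P" for a b
    using that \<open>primeideal P (FC n)\<close> primeideal_FC_iff[OF P(1)] by simp
  from poisson_prime_cases[OF n3 n_odd P(1) one P(2) prime]
  show "P \<in> {PIdl\<^bsub>FC n\<^esub> (\<Omega> n - pconst l) | l. True} \<union> {M_ideal n 1, M_ideal n (- 1)}"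
  proof
    assume "\<exists>a. P = {f \<in> polys {1..n}. \<Omega> n - pconst a dvd f}"
    then show ?thesis using PIdl_\<Omega> by blast
  next
    assume z: "cont 1 n \<in> P"
    let ?t = "cont 1 (n - 1) :: 'k mpoly"
    have "?t \<in> polys {1..n}" using n3 by (intro cont_in_F) auto
    then have F: "?t - pconst 1 \<in> polys {1..n}" "?t - pconst (- 1) \<in> polys {1..n}"
      by (auto intro: polys_diff simp del: pconst_simps)
    have "(?t - pconst 1) * (?t - pconst (- 1)) = ?t ^ 2 - 1"
      by (simp add: algebra_simps power2_eq_square)
    then have "(?t - pconst 1) * (?t - pconst (- 1)) \<in> P"
      using z_last_consequences(2)[OF n3 n_odd P(1) z] by simp
    then have "?t - pconst 1 \<in> P \<or> ?t - pconst (- 1) \<in> P" using prime F by blast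
    then have "P = M_ideal n 1 \<or> P = M_ideal n (- 1)"
      using prime_over_z_last_eq_M[OF n3 n_odd, of 1 P] prime_over_z_last_eq_M[OF n3 n_odd, of "- 1" P]
        P(1) one prime z by auto
    then show ?thesis by blast
  qed
next
  fix P :: "'k mpoly set"
  have *: "P \<in> {P. poisson_prime_ideal P (FC n) \<and> P \<noteq> {0} \<and> P \<noteq> carrier (FC n)}"
    if "pideal n P" "P \<noteq> {0}" "1 \<notin> P"
      "\<And>a b. a \<in> polys {1..n} \<Longrightarrow> b \<in> polys {1..n} \<Longrightarrow> a * b \<in> P \<Longrightarrow> a \<in> P \<or> b \<in> P"
    using that one_in_pideal[OF that(1)]
    by (auto simp: poisson_prime_ideal_def poisson_ideal_FC_iff primeideal_FC_iff)
  assume "P \<in> {PIdl\<^bsub>FC n\<^esub> (\<Omega> n - pconst l) | l. True} \<union> {M_ideal n 1, M_ideal n (- 1)}"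
  then consider l where "P = PIdl\<^bsub>FC n\<^esub> (\<Omega> n - pconst l)" | l :: 'k where "l * l = 1" "P = M_ideal n l"
    by force
  then show "P \<in> {P. poisson_prime_ideal P (FC n) \<and> P \<noteq> {0} \<and> P \<noteq> carrier (FC n)}"
  proof cases
    case 1
    show ?thesis using pideal_PIdl_\<Omega> pideal_PIdl_\<Omega>_prime unfolding 1 by (intro *[unfolded 1])
  next
    case 2
    show ?thesis
      using pideal_M[OF n3 n_odd 2(1)] M_nonzero[OF n3 n_odd 2(1)] M_prime[OF n3 n_odd 2(1)]
      unfolding 2(2) by (intro *[unfolded 2(2)])
  qed
qed

lemma poisson_simple_quotients:
  fixes \<mu> :: "'k::field_char_0"
  shows "poisson_simple (poisson_quot (FC n) (PIdl\<^bsub>FC n\<^esub> (\<Omega> n - pconst \<mu>))) \<longleftrightarrow> \<mu> \<noteq> 2 \<and> \<mu> \<noteq> - 2"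
proof -
  let ?J = "PIdl\<^bsub>FC n\<^esub> (\<Omega> n - pconst \<mu>)"
  have J: "pideal n ?J" "1 \<notin> ?J" "?J \<noteq> polys {1..n}"
    using pideal_PIdl_\<Omega> pideal_PIdl_\<Omega>_prime(1)[of \<mu>] one_in_pideal[OF pideal_PIdl_\<Omega>, of \<mu>] by auto
  have in_J: "\<Omega> n - pconst \<mu> \<in> ?J" unfolding PIdl_\<Omega> using \<Omega>_minus_in_F by simp
  have "(\<forall>I. pideal n I \<longrightarrow> ?J \<subseteq> I \<longrightarrow> I = ?J \<or> I = polys {1..n}) \<longleftrightarrow> \<mu> \<noteq> 2 \<and> \<mu> \<noteq> - 2"
  proof
    assume "\<mu> \<noteq> 2 \<and> \<mu> \<noteq> - 2"
    then show "\<forall>I. pideal n I \<longrightarrow> ?J \<subseteq> I \<longrightarrow> I = ?J \<or> I = polys {1..n}"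
      using pideal_\<Omega>_special[OF n3 n_odd, of _ \<mu>] one_in_pideal in_J pidealD(1) PIdl_\<Omega>[of \<mu>]
      by blast
  next
    assume *: "\<forall>I. pideal n I \<longrightarrow> ?J \<subseteq> I \<longrightarrow> I = ?J \<or> I = polys {1..n}"
    \<comment> \<open>For l = 1 and l = -1 the ideal M_l lies properly between (\<Omega> + 2 l) and
      the whole ring.\<close>
    have False if l: "l * l = 1" "\<mu> = - (2 * l)" for l
    proof -
      let ?M = "M_ideal n l"
      have M: "pideal n ?M" by (rule pideal_M[OF n3 n_odd l(1)])
      have "\<Omega> n - pconst \<mu> \<in> ?M" using \<Omega>_in_M[OF n3 n_odd l(1)] l(2) by simp
      then have "?J \<subseteq> ?M"
        using pidealD(4)[OF M] by (auto simp: cgenideal_def)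
      then have "?M = ?J \<or> ?M = polys {1..n}" using * M by blast
      then show False
        using M_not_principal[OF n3 n_odd l(1)] M_prime(1)[OF n3 n_odd l(1)] one_in_pideal[OF M]
        unfolding PIdl_\<Omega> by blast
    qed
    from this[of 1] this[of "- 1"] show "\<mu> \<noteq> 2 \<and> \<mu> \<noteq> - 2" by auto
  qed
  then show ?thesis using poisson_simple_quot_iff[OF J(1)] J(3) by blast
qed

end


section \<open>The field of fractions\<close>

lemma fderivative_Fract:
  "q \<noteq> 0 \<Longrightarrow> fderivative i (Fract p q) = Fract (pderivative i p * q - p * pderivative i q) (q * q)"
  by (simp add: Fract.abs_eq fderivative.abs_eq)

lemma is_derivation_fderivative: "is_derivation (fderivative i)"
  unfolding is_derivation_def
proof (intro conjI allI)
  fix x y :: "'a mpoly fract"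
  obtain a b where x: "x = Fract a b" "b \<noteq> 0" by (cases x) auto
  obtain c d where y: "y = Fract c d" "d \<noteq> 0" by (cases y) auto
  show "fderivative i (x + y) = fderivative i x + fderivative i y"
    using x y by (simp add: fderivative_Fract eq_fract pderivative_add pderivative_mult algebra_simps)
  show "fderivative i (x * y) = fderivative i x * y + x * fderivative i y"
    using x y by (simp add: fderivative_Fract eq_fract pderivative_mult algebra_simps)
qed

lemmas fderivative_simps = is_derivationD[OF is_derivation_fderivative]

lemma is_derivation_C_frac_left: "is_derivation (\<lambda>f. C_frac_bracket n f g)"
  by (simp add: is_derivation_def C_frac_bracket_def fderivative_simps sum_distrib_left
      sum_distrib_right algebra_simps flip: sum.distrib)

lemma is_derivation_C_frac_right: "is_derivation (\<lambda>g. C_frac_bracket n f g)"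
  by (simp add: is_derivation_def C_frac_bracket_def fderivative_simps sum_distrib_left
      sum_distrib_right algebra_simps flip: sum.distrib)

lemma C_frac_bracket_fconst [simp]:
  "C_frac_bracket n (fconst c) g = 0" "C_frac_bracket n g (fconst c) = 0"
  by (simp_all add: C_frac_bracket_def fconst_def fderivative_to_frac)

lemma FracC_simps [simp]:
  "carrier (FracC n) = UNIV" "x \<otimes>\<^bsub>FracC n\<^esub> y = x * y" "x \<oplus>\<^bsub>FracC n\<^esub> y = x + y"
  "\<one>\<^bsub>FracC n\<^esub> = 1" "\<zero>\<^bsub>FracC n\<^esub> = 0" "bracket (FracC n) = C_frac_bracket n"
  by (simp_all add: FracC_def)

lemma cring_FracC: "cring (FracC n)"
proof (intro cringI abelian_groupI comm_monoidI)
  show "\<exists>y\<in>carrier (FracC n). y \<oplus>\<^bsub>FracC n\<^esub> x = \<zero>\<^bsub>FracC n\<^esub>" for x :: "'a mpoly fract"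
    by (intro bexI[of _ "- x"]) auto
qed (auto simp: algebra_simps)

lemma FracC_a_inv: "\<ominus>\<^bsub>FracC n\<^esub> x = - x"
proof -
  interpret cring "FracC n" by (rule cring_FracC)
  show ?thesis by (intro minus_equality) auto
qed

lemma F_a_inv: "x \<in> polys {1..n} \<Longrightarrow> \<ominus>\<^bsub>F n\<^esub> x = - x"
proof -
  interpret cring "F n :: 'a mpoly ring" by (rule cring_F)
  show "\<ominus>\<^bsub>F n\<^esub> x = - x" if "x \<in> polys {1..n}"
    using that by (intro minus_equality) (auto intro: polys_uminus)
qed


lemma fconst_of_nat: "fconst (of_nat k) = of_nat k"
  by (induction k) simp_all

lemma fconst_of_int: "fconst (of_int k) = of_int k"
  by (cases k) (simp_all add: fconst_of_nat del: of_nat_Suc)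


section \<open>Laurent polynomials in finitely many elements\<close>

definition lpolys :: "nat set \<Rightarrow> 'k::field lpoly set" where
  "lpolys V = {p. \<forall>m\<in>keys p. keys m \<subseteq> V}"

lemma laurent_carrier_lpolys: "laurent_carrier n = lpolys {1..n}"
  by (simp add: laurent_carrier_def lpolys_def)

lemma lpolys_mono: "V \<subseteq> W \<Longrightarrow> lpolys V \<subseteq> lpolys W"
  by (auto simp: lpolys_def)

lemma lpolys_single: "keys m \<subseteq> V \<Longrightarrow> single m c \<in> lpolys V"
  by (auto simp: lpolys_def)

lemma lpolys_0 [simp]: "0 \<in> lpolys V"
  by (simp add: lpolys_def)

lemma lpolys_add: "p \<in> lpolys V \<Longrightarrow> q \<in> lpolys V \<Longrightarrow> p + q \<in> lpolys V"
  using Poly_Mapping.keys_add[of p q] unfolding lpolys_def by blast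

lemma lpolys_uminus: "p \<in> lpolys V \<Longrightarrow> - p \<in> lpolys V"
  by (simp add: lpolys_def in_keys_iff)

lemma lpolys_diff: "p \<in> lpolys V \<Longrightarrow> q \<in> lpolys V \<Longrightarrow> p - q \<in> lpolys V"
  using lpolys_add[of p V "- q"] lpolys_uminus[of q V] by simp

lemma lpolys_mult:
  assumes "p \<in> lpolys V" "q \<in> lpolys V"
  shows "p * q \<in> lpolys V"
  unfolding lpolys_def
proof safe
  fix m i
  assume "m \<in> keys (p * q)" and i: "i \<in> keys m"
  then obtain a b where "m = a + b" "a \<in> keys p" "b \<in> keys q"
    using keys_mult[of p q] by blast
  moreover have "i \<in> keys a \<union> keys b"
    using Poly_Mapping.keys_add[of a b] i \<open>m = a + b\<close> by blast
  ultimately show "i \<in> V" using assms unfolding lpolys_def by blast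
qed

lemma lpolys_sum: "(\<And>i. i \<in> A \<Longrightarrow> f i \<in> lpolys V) \<Longrightarrow> (\<Sum>i\<in>A. f i) \<in> lpolys V"
  by (induction A rule: infinite_finite_induct) (auto intro: lpolys_add)

lemma lookup_times_single:
  "lookup (p * single s 1) t = lookup (p :: 'k::field lpoly) (t - s)"
proof (induction p rule: poly_mapping_induct)
  case (single m c)
  have "m + s = t \<longleftrightarrow> m = t - s" by (auto simp: algebra_simps)
  then show ?case by (simp add: mult_single lookup_single when_def)
qed (simp_all add: distrib_right lookup_add)

text \<open>T_C and U are the cases \<open>A = {1..n}\<close> and \<open>A = {1..n - 1}\<close>, so
  their closure properties are proved together.\<close>

definition laurent_gen ::
    "nat \<Rightarrow> (nat \<Rightarrow> 'k::field mpoly fract) \<Rightarrow> nat set \<Rightarrow> 'k mpoly fract set" where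
  "laurent_gen n Y A = generate_ring (FracC n)
     (range fconst \<union> Y ` A \<union> (\<lambda>i. inverse (Y i)) ` A)"

context
  fixes n :: nat and Y :: "nat \<Rightarrow> 'k::field_char_0 mpoly fract"
  assumes Y0: "\<And>i. Y i \<noteq> 0"
begin

lemma laurent_gen_closed:
  "fconst c \<in> laurent_gen n Y A" "0 \<in> laurent_gen n Y A" "1 \<in> laurent_gen n Y A"
  "x \<in> laurent_gen n Y A \<Longrightarrow> y \<in> laurent_gen n Y A \<Longrightarrow> x + y \<in> laurent_gen n Y A"
  "x \<in> laurent_gen n Y A \<Longrightarrow> y \<in> laurent_gen n Y A \<Longrightarrow> x * y \<in> laurent_gen n Y A"
  "x \<in> laurent_gen n Y A \<Longrightarrow> - x \<in> laurent_gen n Y A"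
  "i \<in> A \<Longrightarrow> Y i powi k \<in> laurent_gen n Y A"
proof -
  let ?T = "laurent_gen n Y A"
  interpret cring "FracC n" by (rule cring_FracC)
  show const: "fconst c \<in> ?T" for c unfolding laurent_gen_def by (intro generate_ring.incl) auto
  show one: "1 \<in> ?T" using const[of 1] by simp
  show "0 \<in> ?T" using const[of 0] by simp
  show "x \<in> ?T \<Longrightarrow> y \<in> ?T \<Longrightarrow> x + y \<in> ?T"
    using generate_ring.eng_add[of x "FracC n" _ y] unfolding laurent_gen_def by simp
  show mult: "x \<in> ?T \<Longrightarrow> y \<in> ?T \<Longrightarrow> x * y \<in> ?T" for x y
    using generate_ring.eng_mult[of x "FracC n" _ y] unfolding laurent_gen_def by simp
  show "x \<in> ?T \<Longrightarrow> - x \<in> ?T"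
    using generate_ring.a_inv[of x "FracC n"] unfolding laurent_gen_def by (simp add: FracC_a_inv)
  have pow: "x ^ k \<in> ?T" if "x \<in> ?T" for x k using that by (induction k) (auto intro: one mult)
  assume i: "i \<in> A"
  have "Y i \<in> ?T" "inverse (Y i) \<in> ?T"
    using i unfolding laurent_gen_def by (auto intro!: generate_ring.incl)
  then show "Y i powi k \<in> ?T" by (auto simp: power_int_def intro: pow)
qed

lemma laurent_gen_induct [consumes 1, case_names const gen inv neg add mult]:
  assumes "x \<in> laurent_gen n Y A"
    and "\<And>c. P (fconst c)" "\<And>i. i \<in> A \<Longrightarrow> P (Y i)" "\<And>i. i \<in> A \<Longrightarrow> P (inverse (Y i))"
    and "\<And>x. x \<in> laurent_gen n Y A \<Longrightarrow> P x \<Longrightarrow> P (- x)"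
    and "\<And>x y. x \<in> laurent_gen n Y A \<Longrightarrow> y \<in> laurent_gen n Y A \<Longrightarrow> P x \<Longrightarrow> P y \<Longrightarrow> P (x + y)"
    and "\<And>x y. x \<in> laurent_gen n Y A \<Longrightarrow> y \<in> laurent_gen n Y A \<Longrightarrow> P x \<Longrightarrow> P y \<Longrightarrow> P (x * y)"
  shows "P x"
proof -
  have "x \<in> laurent_gen n Y A \<and> P x"
    using assms(1) unfolding laurent_gen_def
  proof (induction rule: generate_ring.induct)
    case one
    show ?case using assms(2)[of 1] laurent_gen_closed(3)[of A] by (simp add: laurent_gen_def)
  next
    case (incl h)
    then show ?case using assms(2-4) by (auto intro: generate_ring.incl)
  next
    case (a_inv h)
    then show ?case using assms(5) laurent_gen_closed(6)[of h A] by (simp add: FracC_a_inv laurent_gen_def)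
  next
    case (eng_add h k)
    then show ?case using assms(6) laurent_gen_closed(4)[of h A k] by (simp add: laurent_gen_def)
  next
    case (eng_mult h k)
    then show ?case using assms(7) laurent_gen_closed(5)[of h A k] by (simp add: laurent_gen_def)
  qed
  then show ?thesis ..
qed

lemma is_hom_leval_Y: "is_hom (leval fconst Y)"
  by (rule is_hom_leval[OF is_hom_fconst Y0])

lemma lmono_in_laurent_gen:
  assumes "keys m \<subseteq> A"
  shows "lmono_eval Y m \<in> laurent_gen n Y A"
proof -
  have prod: "(\<Prod>i\<in>B. Y i powi k i) \<in> laurent_gen n Y A" if "B \<subseteq> A" for B k
    using that by (induction B rule: infinite_finite_induct) (auto intro: laurent_gen_closed)
  show ?thesis unfolding lmono_eval_def by (rule prod[OF assms])
qed

lemma laurent_gen_eq_image: "laurent_gen n Y A = leval fconst Y ` lpolys A"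
proof (intro equalityI subsetI)
  note hom = is_homD[OF is_hom_leval_Y]
  fix x assume "x \<in> laurent_gen n Y A"
  then show "x \<in> leval fconst Y ` lpolys A"
  proof (induction rule: laurent_gen_induct)
    case (const c)
    have "fconst c = leval fconst Y (single 0 c)"
      by (simp add: leval_single[OF is_hom_fconst])
    then show ?case by (auto intro!: imageI lpolys_single)
  next
    case (gen i)
    have "Y i = leval fconst Y (single (single i 1) 1)"
      by (simp add: leval_single[OF is_hom_fconst])
    then show ?case using gen by (auto intro!: imageI lpolys_single)
  next
    case (inv i)
    have "inverse (Y i) = leval fconst Y (single (single i (- 1)) 1)"
      by (simp add: leval_single[OF is_hom_fconst])
    then show ?case using inv by (auto intro!: imageI lpolys_single)
  next
    case (neg x)
    then show ?case by (auto simp flip: hom intro!: imageI lpolys_uminus)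
  next
    case (add x y)
    then show ?case by (auto simp flip: hom intro!: imageI lpolys_add)
  next
    case (mult x y)
    then show ?case by (auto simp flip: hom intro!: imageI lpolys_mult)
  qed
next
  fix x assume "x \<in> leval fconst Y ` lpolys A"
  then obtain p where p: "p \<in> lpolys A" "x = leval fconst Y p" by blast
  have "(\<Sum>m\<in>B. fconst (lookup p m) * lmono_eval Y m) \<in> laurent_gen n Y A"
    if "B \<subseteq> keys p" for B
    using that p(1)
    by (induction B rule: infinite_finite_induct)
      (auto simp: lpolys_def intro!: laurent_gen_closed lmono_in_laurent_gen)
  then show "x \<in> laurent_gen n Y A" unfolding p(2) leval_gen_eval gen_eval_def by blast
qed

lemma derivation_laurent_gen:
  assumes D: "is_derivation D" and const: "\<And>c. D (fconst c) = 0"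
    and gen: "\<And>i. i \<in> A \<Longrightarrow> D (Y i) \<in> laurent_gen n Y A" and "x \<in> laurent_gen n Y A"
  shows "D x \<in> laurent_gen n Y A"
  using assms(4)
proof (induction rule: laurent_gen_induct)
  case (inv i)
  have "inverse (Y i) \<in> laurent_gen n Y A" using laurent_gen_closed(7)[OF inv, of "- 1"] by simp
  then show ?case unfolding derivation_inverse[OF D Y0]
    using gen[OF inv] by (intro laurent_gen_closed)
qed (simp_all add: is_derivationD[OF D] const gen laurent_gen_closed)

lemma derivation_laurent_gen_eq_0:
  assumes D: "is_derivation D" and const: "\<And>c. D (fconst c) = 0"
    and gen: "\<And>i. i \<in> A \<Longrightarrow> D (Y i) = 0" and "x \<in> laurent_gen n Y A"
  shows "D x = 0"
  using assms(4)
  by (induction rule: laurent_gen_induct)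
    (simp_all add: is_derivationD[OF D] const gen derivation_inverse[OF D Y0])

lemma bracket_laurent_gen:
  assumes "\<And>i j. i \<in> A \<Longrightarrow> j \<in> A \<Longrightarrow> C_frac_bracket n (Y i) (Y j) \<in> laurent_gen n Y A"
    and "x \<in> laurent_gen n Y A" "y \<in> laurent_gen n Y A"
  shows "C_frac_bracket n x y \<in> laurent_gen n Y A"
proof (rule derivation_laurent_gen[OF is_derivation_C_frac_right _ _ assms(3)])
  fix j assume "j \<in> A"
  then show "C_frac_bracket n x (Y j) \<in> laurent_gen n Y A"
    by (intro derivation_laurent_gen[OF is_derivation_C_frac_left _ _ assms(2)] assms(1)) auto
qed simp

lemma subring_laurent_gen: "subring (laurent_gen n Y A) (FracC n)"
  unfolding laurent_gen_def
  by (rule ring.generate_ring_is_subring[OF cring.axioms(1)[OF cring_FracC]]) simp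

lemma ring_laurent_gen: "ring (FracC n\<lparr>carrier := laurent_gen n Y A\<rparr>)"
  unfolding laurent_gen_def
  by (rule ring.generate_ring_is_ring[OF cring.axioms(1)[OF cring_FracC]]) simp

lemma laurent_gen_mono: "A \<subseteq> B \<Longrightarrow> laurent_gen n Y A \<subseteq> laurent_gen n Y B"
  unfolding laurent_gen_eq_image using lpolys_mono by blast

lemma laurent_gen_a_inv:
  assumes "x \<in> laurent_gen n Y A"
  shows "\<ominus>\<^bsub>FracC n\<lparr>carrier := laurent_gen n Y A\<rparr>\<^esub> x = - x"
proof -
  interpret ring "FracC n\<lparr>carrier := laurent_gen n Y A\<rparr>" by (rule ring_laurent_gen)
  show ?thesis using assms by (intro minus_equality) (auto intro: laurent_gen_closed)
qed

lemma subring_laurent_gen_mono: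
  assumes "A \<subseteq> B"
  shows "subring (laurent_gen n Y A) (FracC n\<lparr>carrier := laurent_gen n Y B\<rparr>)"
proof (rule ring.subringI[OF ring_laurent_gen])
  show "laurent_gen n Y A \<subseteq> carrier (FracC n\<lparr>carrier := laurent_gen n Y B\<rparr>)"
    using laurent_gen_mono[OF assms] by simp
  show "\<ominus>\<^bsub>FracC n\<lparr>carrier := laurent_gen n Y B\<rparr>\<^esub> h \<in> laurent_gen n Y A" if "h \<in> laurent_gen n Y A" for h
    using that laurent_gen_mono[OF assms] laurent_gen_a_inv[of h B] laurent_gen_closed(6)[of h A] by auto
qed (auto intro: laurent_gen_closed)

lemma derivation_lmono_eval:
  assumes D: "is_derivation d" and "finite A" "keys m \<subseteq> A"
    and eig: "\<And>i. i \<in> A \<Longrightarrow> d (Y i) = of_int (k i) * a * Y i"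
  shows "d (lmono_eval Y m) = of_int (\<Sum>i\<in>A. lookup m i * k i) * a * lmono_eval Y m"
  unfolding lmono_eval_superset[OF assms(2,3)]
proof (rule derivation_prod_eigen[OF D])
  fix i assume i: "i \<in> A"
  have inv: "d (inverse (Y i)) = of_int (- k i) * a * inverse (Y i)"
    unfolding derivation_inverse[OF D Y0] eig[OF i] using Y0[of i] by (simp add: field_simps)
  show "d (Y i powi lookup m i) =
      of_int (lookup m i * k i) * a * Y i powi lookup m i"
    using derivation_power_eigen[OF D eig[OF i], of "nat (lookup m i)"]
      derivation_power_eigen[OF D inv, of "nat (- lookup m i)"]
    by (auto simp: power_int_def)
qed

lemma lmono_unit: "lmono_eval Y m * lmono_eval Y (- m) = 1"
  using lmono_eval_add[of m "- m" Y] Y0 by simp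

text \<open>A Poisson ideal of a log-canonical Laurent polynomial algebra with nondegenerate matrix
  contains, with any nonzero element, one of its monomials, hence a unit.\<close>

lemma poisson_simple_laurent_gen:
  assumes r: "even r"
    and log: "\<And>i j. i \<in> {1..r} \<Longrightarrow> j \<in> {1..r} \<Longrightarrow>
      C_frac_bracket n (Y i) (Y j) = of_int (\<Lambda> i j) * Y i * Y j"
  shows "poisson_simple (FracC n\<lparr>carrier := laurent_gen n Y {1..r}\<rparr>)"
  unfolding poisson_simple_def
proof (intro conjI allI impI)
  let ?U = "laurent_gen n Y {1..r}" and ?R = "FracC n\<lparr>carrier := laurent_gen n Y {1..r}\<rparr>"
  show "carrier ?R \<noteq> {\<zero>\<^bsub>?R\<^esub>}" using laurent_gen_closed(3)[of "{1..r}"] by auto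
  fix I assume I: "poisson_ideal I ?R"
  interpret ideal I ?R using I by (simp add: poisson_ideal_def)
  note add = additive_subgroup.a_closed[OF additive_subgroup_axioms, simplified]
    and zero = additive_subgroup.zero_closed[OF additive_subgroup_axioms, simplified]
  have sub: "x \<in> ?U" if "x \<in> I" for x
    using additive_subgroup.a_subset[OF additive_subgroup_axioms] that by auto
  have mult: "x * a \<in> I" if "a \<in> I" "x \<in> ?U" for a x using I_l_closed[of a x] that by simp
  have br: "C_frac_bracket n a x \<in> I" if "a \<in> I" "x \<in> ?U" for a x
    using I that by (auto simp: poisson_ideal_def)
  have int: "of_int k \<in> ?U" for k
    unfolding fconst_of_int[symmetric] by (rule laurent_gen_closed)
  have gen: "Y i \<in> ?U" if "i \<in> {1..r}" for i using laurent_gen_closed(7)[OF that, of 1] by simp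
  show "I = {\<zero>\<^bsub>?R\<^esub>} \<or> I = carrier ?R"
  proof (cases "I = {0}")
    case False
    then obtain x where x: "x \<in> I" "x \<noteq> 0" using zero by blast
    obtain p where p: "p \<in> lpolys {1..r}" "x = leval fconst Y p"
      using sub[OF x(1)] unfolding laurent_gen_eq_image by blast
    then have "p \<noteq> 0" using x(2) is_homD(4)[OF is_hom_leval_Y] by auto
    then obtain m0 where m0: "m0 \<in> keys p" by (auto simp: poly_mapping_eq_iff fun_eq_iff in_keys_iff)
    have keys: "keys m \<subseteq> {1..r}" if "m \<in> keys p" for m
      using p(1) that by (auto simp: lpolys_def)
    define f where "f = (\<lambda>m. fconst (lookup p m) * lmono_eval Y m)"
    define \<chi> where "\<chi> = (\<lambda>m i. \<Sum>j\<in>{1..r}. lookup m j * \<Lambda> j i)"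
    have "\<exists>e k. k \<noteq> 0 \<and> keys e \<subseteq> {1..r} \<and> of_int k * mono_eval Y e * f m0 \<in> I"
    proof (rule eigenvector_separation[where d = "\<lambda>i g. C_frac_bracket n g (Y i)" and L = \<Lambda>
          and M = "keys p" and \<chi> = \<chi>])
      show "a - b \<in> I" if "a \<in> I" "b \<in> I" for a b
        using add[OF that(1) mult[OF that(2) int[of "- 1"]]] by simp
      show "of_int k * Y i * a \<in> I" if "a \<in> I" "i \<in> {1..r}" for a i k
        using that int gen by (intro mult laurent_gen_closed)
      show "C_frac_bracket n (Y j) (Y i) = of_int (\<Lambda> j i) * Y j * Y i"
        if "i \<in> {1..r}" "j \<in> {1..r}" for i j using log that by blast
      show "(\<Sum>m\<in>keys p. f m) \<in> I"
        using x(1) unfolding p(2) leval_gen_eval gen_eval_def f_def .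
      show "C_frac_bracket n (f m) (Y i) = of_int (\<chi> m i) * Y i * f m"
        if "m \<in> keys p" "i \<in> {1..r}" for m i
      proof -
        have "C_frac_bracket n (Y j) (Y i) = of_int (\<Lambda> j i) * Y i * Y j" if "j \<in> {1..r}" for j
          using log[OF that \<open>i \<in> {1..r}\<close>] by (simp add: mult_ac)
        then have "C_frac_bracket n (lmono_eval Y m) (Y i) = of_int (\<chi> m i) * Y i * lmono_eval Y m"
          unfolding \<chi>_def
          by (intro derivation_lmono_eval[OF is_derivation_C_frac_left _ keys[OF \<open>m \<in> keys p\<close>]]) auto
        then show ?thesis
          by (simp add: f_def is_derivationD(2)[OF is_derivation_C_frac_left] mult_ac)
      qed
      show "\<exists>i\<in>{1..r}. \<chi> m i \<noteq> \<chi> m0 i" if "m \<in> keys p" "m \<noteq> m0" for m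
      proof (rule ccontr)
        assume "\<not> ?thesis"
        then have 0: "(\<Sum>j\<in>{1..r}. (lookup m j - lookup m0 j) * \<Lambda> j i) = 0"
          if "i \<in> {1..r}" for i
          using that by (simp add: \<chi>_def left_diff_distrib sum_subtractf)
        have "lookup m j = lookup m0 j" for j
        proof (cases "j \<in> {1..r}")
          case True
          then show ?thesis using \<Lambda>_nondegenerate[OF r 0 True] by simp
        next
          case False
          then have "j \<notin> keys m" "j \<notin> keys m0"
            using keys \<open>m \<in> keys p\<close> m0 by blast+
          then show ?thesis by (simp add: in_keys_iff)
        qed
        then show False using \<open>m \<noteq> m0\<close> poly_mapping_eqI by blast
      qed
    qed (use m0 br gen is_derivation_C_frac_left in auto)
    then obtain e k where e: "k \<noteq> 0" "keys e \<subseteq> {1..r}"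
      "of_int k * mono_eval Y e * f m0 \<in> I" by blast
    let ?c = "lookup p m0"
    have inv_mono: "inverse (mono_eval Y e) \<in> ?U"
    proof -
      have "inverse (mono_eval Y e) = (\<Prod>i\<in>keys e. Y i powi (- int (lookup e i)))"
        by (simp add: mono_eval_def prod_inversef[symmetric] power_int_minus)
      moreover have "(\<Prod>i\<in>B. Y i powi (- int (lookup e i))) \<in> ?U" if "B \<subseteq> {1..r}" for B
        using that by (induction B rule: infinite_finite_induct)
          (auto intro: laurent_gen_closed simp del: atLeastAtMost_iff)
      ultimately show ?thesis using e(2) by simp
    qed
    have "keys (- m0) \<subseteq> {1..r}" using keys[OF m0] by simp
    \<comment> \<open>This is the inverse of the element found in the ideal: a nonzero scalar times
      two monomials, all of them units of U.\<close>
    then have "fconst (1 / (of_int k * ?c)) * inverse (mono_eval Y e) * lmono_eval Y (- m0) \<in> ?U"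
      by (intro laurent_gen_closed inv_mono lmono_in_laurent_gen)
    from mult[OF e(3) this]
    have "fconst (1 / (of_int k * ?c)) * inverse (mono_eval Y e) * lmono_eval Y (- m0) *
        (of_int k * mono_eval Y e * f m0) \<in> I" .
    also have "fconst (1 / (of_int k * ?c)) * inverse (mono_eval Y e) * lmono_eval Y (- m0) *
        (of_int k * mono_eval Y e * f m0) =
        (fconst (1 / (of_int k * ?c)) * (of_int k * fconst ?c)) * (inverse (mono_eval Y e) * mono_eval Y e)
          * (lmono_eval Y m0 * lmono_eval Y (- m0))"
      by (simp add: f_def mult_ac)
    also have "inverse (mono_eval Y e) * mono_eval Y e = 1"
      using Y0 by (simp add: mono_eval_def)
    also have "fconst (1 / (of_int k * ?c)) * (of_int k * fconst ?c) = 1"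
    proof -
      have "fconst (1 / (of_int k * ?c)) * (of_int k * fconst ?c) =
          fconst (1 / (of_int k * ?c) * (of_int k * ?c))"
        by (simp only: fconst_simps fconst_of_int)
      also have "1 / (of_int k * ?c) * (of_int k * ?c) = 1" using e(1) m0 by (simp add: in_keys_iff)
      finally show ?thesis by simp
    qed
    finally have "1 \<in> I" by (simp add: lmono_unit)
    then have "I = ?U" using sub mult[of 1] by auto
    then show ?thesis by simp
  qed simp
qed

end


section \<open>Algebraic independence of \<open>z\<^sub>1, \<dots>, z\<^sub>n\<^sub>-\<^sub>1, \<Omega>\<close>\<close>

lemma hom_sum: "is_hom h \<Longrightarrow> h (\<Sum>i\<in>A. f i) = (\<Sum>i\<in>A. h (f i))"
  by (induction A rule: infinite_finite_induct) (simp_all add: is_homD[of h])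

lemma hom_mono_eval: "is_hom h \<Longrightarrow> h (mono_eval y m) = mono_eval (\<lambda>i. h (y i)) m"
proof -
  assume h: "is_hom h"
  have "h (\<Prod>i\<in>A. f i) = (\<Prod>i\<in>A. h (f i))" for A :: "nat set" and f
    by (induction A rule: infinite_finite_induct) (simp_all add: is_homD[OF h])
  then show ?thesis by (simp add: mono_eval_def is_homD[OF h])
qed

lemma pvar_nz [simp]: "pvar i \<noteq> (0 :: 'k::field mpoly)"
  using cont_nz[of i 1, where 'k = 'k] by (simp add: One_nat_def)

context
  fixes n :: nat
  assumes n3: "n \<ge> 3" and n_odd: "odd n"
begin

lemma ygen_nz: "ygen n i \<noteq> (0 :: 'k::field_char_0 mpoly)"
proof (cases "i = n")
  case True
  have "\<Omega> n - pconst 0 \<noteq> (0 :: 'k mpoly)"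
    using prime_elem_\<Omega>(1)[OF n3 n_odd, of "0 :: 'k"] unfolding prime_elem_def by blast
  then show ?thesis using True by (simp add: ygen_def)
qed (simp add: ygen_def z_cont)

lemma ygen_in_F: "i \<in> {1..n} \<Longrightarrow> ygen n i \<in> polys {1..n}"
  by (cases "i = n") (simp_all add: ygen_def z_in_F \<Omega>_in_F[OF n3 n_odd])

text \<open>The substitution \<open>x\<^sub>i \<mapsto> (x\<^sub>i + x\<^sub>i\<^sub>-\<^sub>2) / x\<^sub>i\<^sub>-\<^sub>1\<close>, which solves the recurrence of the \<open>z\<^sub>i\<close>,
  maps \<open>z\<^sub>i\<close> to \<open>x\<^sub>i\<close>; the image of \<open>x\<^sub>n\<close> is chosen such that \<open>\<Omega>\<close> is mapped to \<open>x\<^sub>n\<close>.\<close>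

lemma ygen_inverse_hom:
  obtains ev :: "'k::field_char_0 mpoly \<Rightarrow> 'k mpoly fract" where
    "is_hom ev" "\<And>c. ev (pconst c) = fconst c" "\<And>i. i \<in> {1..n} \<Longrightarrow> ev (ygen n i) = to_frac (pvar i)"
proof -
  define X :: "nat \<Rightarrow> 'k mpoly fract"
    \<comment> \<open>\<open>X l\<close> is the prescribed image of \<open>cont 1 l\<close>, hence 0
      and 1 for the first two.\<close>
    where "X l = (if l = 0 then 0 else if l = 1 then 1 else to_frac (pvar (l - 1)))" for l
  define w' where "w' i = (X (Suc i) + X (i - 1)) / X i" for i
  define h :: "'k mpoly" where "h = cont 1 (n - 1) + cont 2 (n - 1)"
  \<comment> \<open>\<open>h\<close> does not involve x_n, so its image is known from
    \<open>w'\<close> before \<open>w n\<close> is chosen; \<open>w n\<close> solves \<Omega> =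
    z_{n-1} x_n - h for x_n.\<close>
  define w where "w i = (if i = n then (to_frac (pvar n) + peval fconst w' h) / X n else w' i)" for i
  have hom: "is_hom (peval fconst y)" for y :: "nat \<Rightarrow> 'k mpoly fract"
    by (rule is_hom_peval[OF is_hom_fconst])
  have X0: "X (Suc l) \<noteq> 0" for l by (simp add: X_def)
  have cont: "peval fconst w' (cont 1 l) = X l" for l
  proof (induction l rule: induct_nat_012)
    case (ge2 l)
    have "peval fconst w' (cont 1 (Suc (Suc l))) = X (Suc l) * w' (Suc l) - X l"
      by (simp add: is_homD[OF hom] ge2 is_hom_fconst plus_1_eq_Suc)
    also have "\<dots> = X (Suc (Suc l))" using X0[of l] by (simp add: w'_def)
    finally show ?case .
  qed (simp_all add: is_homD[OF hom] X_def)
  have agree: "peval fconst w p = peval fconst w' p" if "p \<in> polys {1..n - 1}" for p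
  proof (rule hom_eqI[OF hom hom _ _ that])
    fix i assume "i \<in> {1..n - 1}"
    then have "i \<noteq> n" using n3 by auto
    then show "peval fconst w (pvar i) = peval fconst w' (pvar i)" by (simp add: is_hom_fconst w_def)
  qed (simp add: is_hom_fconst)
  have "peval fconst w (ygen n i) = to_frac (pvar i)" if "i \<in> {1..n}" for i
  proof (cases "i = n")
    case True
    have poly: "cont 1 n \<in> (polys {1..n - 1} :: 'k mpoly set)" "h \<in> polys {1..n - 1}"
      using n3 unfolding h_def by (auto intro!: polys_add cont_polys)
    have "peval fconst w (\<Omega> n) = X n * w n - peval fconst w' h"
      by (simp add: \<Omega>_cont[OF n3] is_homD[OF hom] is_hom_fconst agree[OF poly(1)] cont
          agree[OF poly(2)] flip: h_def)
    also have "\<dots> = to_frac (pvar n)" using X0[of "n - 1"] n3 by (simp add: w_def)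
    finally show ?thesis using True by (simp add: ygen_def)
  next
    case False
    then have "i < n" using that by auto
    then have poly: "cont 1 (Suc i) \<in> (polys {1..n - 1} :: 'k mpoly set)"
      by (intro cont_polys) auto
    show ?thesis using False that agree[OF poly] by (simp add: ygen_def z_cont cont X_def del: cont.simps)
  qed
  then show ?thesis using that[of "peval fconst w"] hom by (simp add: is_hom_fconst)
qed

text \<open>The homomorphism sending the i-th generator to x_i inverts evaluation at the generators
  on the left.\<close>

lemma ygen_independent: "inj_on (peval pconst (ygen n :: nat \<Rightarrow> 'k::field_char_0 mpoly)) (polys {1..n})"
proof -
  obtain ev :: "'k mpoly \<Rightarrow> 'k mpoly fract" where ev: "is_hom ev" "\<And>c. ev (pconst c) = fconst c"
    "\<And>i. i \<in> {1..n} \<Longrightarrow> ev (ygen n i) = to_frac (pvar i)" by (rule ygen_inverse_hom) blast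
  have "ev (peval pconst (ygen n) p) = to_frac p" if "p \<in> polys {1..n}" for p
    by (rule hom_eqI[OF is_hom_compose[OF ev(1) is_hom_peval[OF is_hom_pconst]] is_hom_to_frac _ _ that])
      (auto simp: is_hom_pconst ev fconst_def)
  then show ?thesis by (intro inj_onI) (metis to_frac_eq_iff)
qed


section \<open>The algebra \<open>S\<^sub>C\<close>\<close>

lemma S_C_closed:
  "S_C n \<subseteq> (polys {1..n} :: 'k mpoly set)"
  "pconst c \<in> (S_C n :: 'k mpoly set)" "1 \<in> (S_C n :: 'k mpoly set)"
  "i \<in> {1..n} \<Longrightarrow> ygen n i \<in> (S_C n :: 'k mpoly set)"
  "x \<in> S_C n \<Longrightarrow> y \<in> S_C n \<Longrightarrow> x + y \<in> (S_C n :: 'k mpoly set)"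
  "x \<in> S_C n \<Longrightarrow> y \<in> S_C n \<Longrightarrow> x * y \<in> (S_C n :: 'k mpoly set)"
  "x \<in> S_C n \<Longrightarrow> - x \<in> (S_C n :: 'k::field_char_0 mpoly set)"
proof -
  interpret cring "F n :: 'k mpoly ring" by (rule cring_F)
  have "range pconst \<union> ygen n ` {1..n} \<subseteq> carrier (F n :: 'k mpoly ring)"
    using ygen_in_F by (auto simp del: atLeastAtMost_iff)
  then show sub: "S_C n \<subseteq> (polys {1..n} :: 'k mpoly set)"
    unfolding S_C_def using generate_ring_incl by simp
  show const: "pconst c \<in> S_C n" for c :: 'k unfolding S_C_def by (intro generate_ring.incl) auto
  show "1 \<in> (S_C n :: 'k mpoly set)" using const[of 1] by simp
  show "i \<in> {1..n} \<Longrightarrow> ygen n i \<in> (S_C n :: 'k mpoly set)"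
    unfolding S_C_def by (intro generate_ring.incl) auto
  show "x \<in> S_C n \<Longrightarrow> y \<in> S_C n \<Longrightarrow> x + y \<in> S_C n"
    using generate_ring.eng_add[of x "F n" _ y] unfolding S_C_def by simp
  show "x \<in> S_C n \<Longrightarrow> y \<in> S_C n \<Longrightarrow> x * y \<in> S_C n"
    using generate_ring.eng_mult[of x "F n" _ y] unfolding S_C_def by simp
  assume x: "x \<in> (S_C n :: 'k mpoly set)"
  then have "\<ominus>\<^bsub>F n\<^esub> x \<in> S_C n" unfolding S_C_def by (rule generate_ring.a_inv)
  then show "- x \<in> S_C n" using F_a_inv[of x n] x sub by auto
qed

lemma S_C_eq_image: "S_C n = peval pconst (ygen n :: nat \<Rightarrow> 'k::field_char_0 mpoly) ` polys {1..n}"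
proof (intro equalityI subsetI)
  let ?e = "peval pconst (ygen n :: nat \<Rightarrow> 'k mpoly)"
  note hom = is_homD[OF is_hom_peval[OF is_hom_pconst], of "ygen n :: nat \<Rightarrow> 'k mpoly"]
  have F: "?e p \<in> polys {1..n}" if "p \<in> polys {1..n}" for p
    by (rule peval_in_polys[OF that ygen_in_F])
  fix x :: "'k mpoly" assume "x \<in> S_C n"
  then show "x \<in> ?e ` polys {1..n}"
    unfolding S_C_def
  proof (induction rule: generate_ring.induct)
    case one
    show ?case using hom(1) by (auto intro!: image_eqI[of _ _ 1])
  next
    case (incl h)
    then consider c where "h = pconst c" | i where "i \<in> {1..n}" "h = ygen n i" by blast
    then show ?case
    proof cases
      case 1
      then show ?thesis by (intro image_eqI[of _ _ "pconst c"]) (auto simp: is_hom_pconst)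
    next
      case 2
      then show ?thesis
        by (intro image_eqI[of _ _ "pvar i"]) (auto simp: is_hom_pconst intro: polys_pvar)
    qed
  next
    case (a_inv h)
    then show ?case using F by (auto simp: F_a_inv simp flip: hom intro!: imageI polys_uminus)
  next
    case (eng_add h k)
    then show ?case by (auto simp flip: hom intro!: imageI polys_add)
  next
    case (eng_mult h k)
    then show ?case by (auto simp flip: hom intro!: imageI polys_mult)
  qed
next
  fix x assume "x \<in> peval pconst (ygen n :: nat \<Rightarrow> 'k mpoly) ` polys {1..n}"
  then obtain p where p: "p \<in> polys {1..n}" "x = peval pconst (ygen n) p" by blast
  from p(1) show "x \<in> S_C n" unfolding p(2)
    by (induction rule: polys_induct)
      (simp_all add: is_hom_pconst is_homD[OF is_hom_peval[OF is_hom_pconst]] S_C_closed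
        del: atLeastAtMost_iff)
qed

lemma derivation_S_C:
  assumes D: "is_derivation D" and "\<And>c. D (pconst c) = 0"
    and "\<And>i. i \<in> {1..n} \<Longrightarrow> D (ygen n i) \<in> S_C n" and "x \<in> S_C n"
  shows "D x \<in> (S_C n :: 'k::field_char_0 mpoly set)"
proof -
  obtain p where p: "p \<in> polys {1..n}" "x = peval pconst (ygen n) p"
    using assms(4) unfolding S_C_eq_image by blast
  have img: "peval pconst (ygen n) q \<in> (S_C n :: 'k mpoly set)" if "q \<in> polys {1..n}" for q
    unfolding S_C_eq_image using that by (rule imageI)
  have zero: "0 \<in> (S_C n :: 'k mpoly set)" using S_C_closed(2)[of 0] by simp
  note hom = is_homD[OF is_hom_peval[OF is_hom_pconst], of "ygen n :: nat \<Rightarrow> 'k mpoly"]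
  from p(1) show ?thesis unfolding p(2)
  proof (induction rule: polys_induct)
    case (mult p q)
    then show ?case unfolding hom is_derivationD(2)[OF D]
      by (intro S_C_closed(5,6) img)
  qed (simp_all add: is_hom_pconst hom is_derivationD[OF D] assms(2,3) zero S_C_closed(5)
      del: atLeastAtMost_iff)
qed

lemma poisson_subalgebra_S_C:
  "poisson_subalgebra (range (pconst :: 'k::field_char_0 \<Rightarrow> _)) (S_C n) (FC n)"
  unfolding poisson_subalgebra_def
proof (intro conjI ballI)
  show "subring (S_C n) (FC n :: 'k mpoly poisson_ring)"
  proof (rule ring.subringI[OF cring.axioms(1)[OF cring_FC]])
    show "\<ominus>\<^bsub>FC n\<^esub> h \<in> S_C n" if "h \<in> S_C n" for h :: "'k mpoly"
      using that S_C_closed(1) S_C_closed(7)[OF that] FC_a_inv[of h n] by auto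
  qed (use S_C_closed(1) in \<open>auto intro: S_C_closed\<close>)
  show "range (pconst :: 'k \<Rightarrow> _) \<subseteq> S_C n" by (auto intro: S_C_closed)
  fix a b :: "'k mpoly" assume a: "a \<in> S_C n" and b: "b \<in> S_C n"
  have gen: "C_bracket n (ygen n i) (ygen n j) \<in> (S_C n :: 'k mpoly set)"
    if "i \<in> {1..n}" "j \<in> {1..n}" for i j
  proof -
    have eq: "C_bracket n (ygen n i) (ygen n j) =
        pconst (of_int (\<Lambda> i j)) * ygen n i * (ygen n j :: 'k mpoly)"
      using log_canonical_ygen[OF n3 n_odd, where 'k = 'k] that
      by (simp add: log_canonical_def pconst_of_int)
    show ?thesis unfolding eq by (intro S_C_closed(2,4,6) that)
  qed
  have "C_bracket n a (ygen n j) \<in> S_C n" if "j \<in> {1..n}" for j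
    by (rule derivation_S_C[OF is_derivation_C_bracket_left _ gen[OF _ that] a]) simp
  then have "C_bracket n a b \<in> S_C n"
    by (intro derivation_S_C[OF is_derivation_C_bracket_right _ _ b]) auto
  then show "bracket (FC n) a b \<in> S_C n" by simp
qed


section \<open>The algebras \<open>T\<^sub>C\<close> and \<open>U\<close>\<close>

abbreviation (input) "Y_gen \<equiv> \<lambda>i. to_frac (ygen n i)"

lemma Y_gen_nz: "Y_gen i \<noteq> (0 :: 'k::field_char_0 mpoly fract)"
  by (simp add: ygen_nz)

lemma T_C_laurent_gen: "T_C n = (laurent_gen n Y_gen {1..n} :: 'k::field mpoly fract set)"
  by (simp add: T_C_def laurent_gen_def)

lemma U_C_laurent_gen: "U_C n = (laurent_gen n Y_gen {1..n - 1} :: 'k::field mpoly fract set)"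
proof -
  have "i \<noteq> n" if "i \<in> {1..n - 1}" for i using that n3 by auto
  then have eq: "Y_gen i = (to_frac (z i) :: 'k mpoly fract)" if "i \<in> {1..n - 1}" for i
    using that by (simp add: ygen_def)
  have 1: "(Y_gen :: nat \<Rightarrow> 'k mpoly fract) ` {1..n - 1} = (\<lambda>i. to_frac (z i)) ` {1..n - 1}"
    by (intro image_cong refl eq)
  have 2: "(\<lambda>i. inverse (Y_gen i :: 'k mpoly fract)) ` {1..n - 1} =
      (\<lambda>i. inverse (to_frac (z i))) ` {1..n - 1}"
    by (intro image_cong refl arg_cong[of _ _ inverse] eq)
  show ?thesis unfolding U_C_def laurent_gen_def 1 2 ..
qed

lemma to_frac_of_int: "to_frac (of_int k) = of_int k"
  by (metis fconst_def fconst_of_int pconst_of_int)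

lemma Y_gen_bracket:
  assumes "i \<in> {1..n}" "j \<in> {1..n}"
  shows "C_frac_bracket n (Y_gen i) (Y_gen j) =
    of_int (\<Lambda> i j) * Y_gen i * (Y_gen j :: 'k::field_char_0 mpoly fract)"
proof -
  have "C_bracket n (ygen n i) (ygen n j) = of_int (\<Lambda> i j) * ygen n i * (ygen n j :: 'k mpoly)"
    using log_canonical_ygen[OF n3 n_odd, where 'k = 'k] assms by (simp add: log_canonical_def)
  then show ?thesis by (simp add: C_frac_bracket_to_frac to_frac_of_int)
qed

lemma Y_gen_bracket_closed:
  assumes "A \<subseteq> {1..n}" "x \<in> laurent_gen n Y_gen A" "y \<in> laurent_gen n Y_gen A"
  shows "C_frac_bracket n x y \<in> (laurent_gen n Y_gen A :: 'k::field_char_0 mpoly fract set)"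
proof (rule bracket_laurent_gen[where Y = "Y_gen :: nat \<Rightarrow> 'k mpoly fract", OF Y_gen_nz _ assms(2,3)])
  note closed = laurent_gen_closed[where Y = "Y_gen :: nat \<Rightarrow> 'k mpoly fract", OF Y_gen_nz]
  fix i j assume ij: "i \<in> A" "j \<in> A"
  have "Y_gen k \<in> (laurent_gen n Y_gen A :: 'k mpoly fract set)" if "k \<in> A" for k
  proof -
    have "Y_gen k powi 1 \<in> (laurent_gen n Y_gen A :: 'k mpoly fract set)" by (rule closed(7)[OF that])
    then show ?thesis by simp
  qed
  from this[OF ij(1)] this[OF ij(2)]
  have "fconst (of_int (\<Lambda> i j)) * Y_gen i * Y_gen j \<in> (laurent_gen n Y_gen A :: 'k mpoly fract set)"
    by (intro closed(1,5))
  then show "C_frac_bracket n (Y_gen i) (Y_gen j) \<in> (laurent_gen n Y_gen A :: 'k mpoly fract set)"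
    using ij assms(1) by (subst Y_gen_bracket) (auto simp: fconst_of_int)
qed

text \<open>Multiplication by a high power of the product of all generators makes the exponents
  nonnegative, which reduces the claim to independence of polynomials.\<close>

lemma leval_Y_gen_eq_0:
  assumes p: "p \<in> lpolys {1..n}" and 0: "leval fconst Y_gen p = (0 :: 'k::field_char_0 mpoly fract)"
  shows "p = 0"
proof (rule ccontr)
  assume "p \<noteq> 0"
  then obtain m0 where m0: "m0 \<in> keys p"
    by (auto simp: poly_mapping_eq_iff fun_eq_iff in_keys_iff)
  \<comment> \<open>\<open>N\<close> bounds the absolute value of every exponent that occurs, so
    adding it is injective and loses nothing under \<open>nat\<close>.\<close>
  define N where "N = (\<Sum>m\<in>keys p. \<Sum>i\<in>{1..n}. \<bar>lookup m i\<bar>)"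
  have bound: "0 \<le> lookup m i + N" if "m \<in> keys p" "i \<in> {1..n}" for m i
  proof -
    have "\<bar>lookup m i\<bar> \<le> (\<Sum>i\<in>{1..n}. \<bar>lookup m i\<bar>)"
      using that(2) by (intro member_le_sum) auto
    also have "\<dots> \<le> N" unfolding N_def using that(1) by (intro member_le_sum sum_nonneg) auto
    finally show ?thesis by simp
  qed
  define E :: "(nat \<Rightarrow>\<^sub>0 int) \<Rightarrow> (nat \<Rightarrow>\<^sub>0 nat)"
    where "E m = (\<Sum>i\<in>{1..n}. single i (nat (lookup m i + N)))" for m
  have lookup_E: "lookup (E m) i =
      (if i \<in> {1..n} then nat (lookup m i + N) else 0)" for m i
    by (simp add: E_def lookup_sum lookup_single when_def sum.delta)
  have keys_E: "keys (E m) \<subseteq> {1..n}" for m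
    by (auto simp: in_keys_iff lookup_E split: if_splits)
  have keys: "keys m \<subseteq> {1..n}" if "m \<in> keys p" for m
    using p that by (auto simp: lpolys_def)
  have inj: "m = m'" if "E m = E m'" "m \<in> keys p" "m' \<in> keys p" for m m'
  proof (rule poly_mapping_eqI)
    fix i
    show "lookup m i = lookup m' i"
    proof (cases "i \<in> {1..n}")
      case True
      then have "nat (lookup m i + N) = nat (lookup m' i + N)"
        using lookup_E[of m i] lookup_E[of m' i] that(1) by simp
      then show ?thesis using bound[OF that(2) True] bound[OF that(3) True] by simp
    next
      case False
      then have "i \<notin> keys m" "i \<notin> keys m'"
        using keys that by blast+
      then show ?thesis by (simp add: in_keys_iff)
    qed
  qed
  define W where "W = (\<Prod>i\<in>{1..n}. (Y_gen i :: 'k mpoly fract) powi N)"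
  have mono: "to_frac (mono_eval (ygen n) (E m)) = lmono_eval Y_gen m * W" if "m \<in> keys p" for m
  proof -
    have "to_frac (mono_eval (ygen n) (E m)) =
        (\<Prod>i\<in>{1..n}. (Y_gen i :: 'k mpoly fract) ^ nat (lookup m i + N))"
      by (subst hom_mono_eval[OF is_hom_to_frac], subst mono_eval_superset[OF finite_atLeastAtMost keys_E])
        (auto simp: lookup_E intro!: prod.cong)
    also have "\<dots> = (\<Prod>i\<in>{1..n}. Y_gen i powi lookup m i * Y_gen i powi N)"
    proof (intro prod.cong refl)
      fix i assume "i \<in> {1..n}"
      then have "(Y_gen i :: 'k mpoly fract) ^ nat (lookup m i + N) =
          Y_gen i powi (lookup m i + N)"
        using bound[OF that] by (simp add: power_int_def del: atLeastAtMost_iff)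
      then show "(Y_gen i :: 'k mpoly fract) ^ nat (lookup m i + N) =
          Y_gen i powi lookup m i * Y_gen i powi N"
        using Y_gen_nz[of i, where 'k = 'k] by (simp add: power_int_add)
    qed
    finally show ?thesis
      by (simp add: W_def prod.distrib lmono_eval_superset[OF finite_atLeastAtMost keys[OF that]])
  qed
  define P where "P = (\<Sum>m\<in>keys p. single (E m) (lookup p m))"
  have hom: "is_hom (peval pconst (ygen n :: nat \<Rightarrow> 'k mpoly))" by (rule is_hom_peval[OF is_hom_pconst])
  have "to_frac (peval pconst (ygen n) P) = (\<Sum>m\<in>keys p.
      fconst (lookup p m) * (lmono_eval Y_gen m * W))"
    unfolding P_def hom_sum[OF hom] hom_sum[OF is_hom_to_frac]
    by (intro sum.cong refl) (simp add: peval_single[OF is_hom_pconst] mono fconst_def)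
  also have "\<dots> = leval fconst Y_gen p * W"
    by (simp add: leval_gen_eval gen_eval_def sum_distrib_right mult.assoc)
  finally have "peval pconst (ygen n) P = 0" using 0 by simp
  moreover have "P \<in> polys {1..n}" unfolding P_def by (intro polys_sum single_polys keys_E)
  ultimately have "P = 0"
    using inj_onD[OF ygen_independent, of P 0] is_homD(4)[OF hom] by simp
  have "lookup P (E m0) =
      (\<Sum>m\<in>keys p. if m = m0 then lookup p m else 0)"
    unfolding P_def lookup_sum lookup_single when_def
    using inj m0 by (intro sum.cong refl) auto
  then have "lookup p m0 = 0" using m0 \<open>P = 0\<close> by simp
  then show False using m0 by (simp add: in_keys_iff)
qed

lemma inj_on_leval_Y_gen:
  "inj_on (leval fconst (Y_gen :: nat \<Rightarrow> 'k::field_char_0 mpoly fract)) (lpolys {1..n})"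
proof (rule inj_onI)
  fix p q assume pq: "p \<in> lpolys {1..n}" "q \<in> lpolys {1..n}"
    "leval fconst (Y_gen :: nat \<Rightarrow> 'k mpoly fract) p = leval fconst Y_gen q"
  then have "leval fconst (Y_gen :: nat \<Rightarrow> 'k mpoly fract) (p - q) = 0"
    by (simp add: is_homD[OF is_hom_leval_Y[where Y = "Y_gen :: nat \<Rightarrow> 'k mpoly fract", OF Y_gen_nz]])
  then have "p - q = 0" by (intro leval_Y_gen_eq_0 lpolys_diff pq)
  then show "p = q" by simp
qed

text \<open>Surjectivity comes from splitting off the exponent at index \<open>n\<close> in each
  monomial; uniqueness follows by collecting the coefficients in one Laurent polynomial in which
  that exponent tells the summands apart.\<close>

lemma laurent_extension_U_T:
  "laurent_extension (U_C n) (to_frac (\<Omega> n :: 'k::field_char_0 mpoly)) (T_C n)"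
proof -
  let ?w = "to_frac (\<Omega> n :: 'k mpoly)" and ?U = "U_C n :: 'k mpoly fract set"
  let ?ev = "leval fconst (Y_gen :: nat \<Rightarrow> 'k mpoly fract)"
  let ?A = "{a. finite {i. a i \<noteq> 0} \<and> range a \<subseteq> ?U}"
  let ?S = "\<lambda>a::int \<Rightarrow> 'k mpoly fract. \<Sum>i | a i \<noteq> 0. a i * ?w powi i"
  note hom = is_homD[OF is_hom_leval_Y[where Y = "Y_gen :: nat \<Rightarrow> 'k mpoly fract", OF Y_gen_nz]]
  have w: "?w = Y_gen n" by (simp add: ygen_def)
  have U: "?U = ?ev ` lpolys {1..n - 1}"
    unfolding U_C_laurent_gen by (rule laurent_gen_eq_image[where Y = "Y_gen :: nat \<Rightarrow> 'k mpoly fract", OF Y_gen_nz])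
  have T: "T_C n = ?ev ` lpolys {1..n}"
    unfolding T_C_laurent_gen by (rule laurent_gen_eq_image[where Y = "Y_gen :: nat \<Rightarrow> 'k mpoly fract", OF Y_gen_nz])
  have mono: "p \<in> lpolys {1..n}" if "p \<in> lpolys {1..n - 1}" for p :: "'k lpoly"
    using that lpolys_mono[of "{1..n - 1}" "{1..n}"] by auto
  note T_closed = laurent_gen_closed[where Y = "Y_gen :: nat \<Rightarrow> 'k mpoly fract", OF Y_gen_nz, where A = "{1..n}" and n = n, folded T_C_laurent_gen]
  note U_closed = laurent_gen_closed[where Y = "Y_gen :: nat \<Rightarrow> 'k mpoly fract", OF Y_gen_nz, where A = "{1..n - 1}" and n = n, folded U_C_laurent_gen]
  have S_superset: "?S a = (\<Sum>i\<in>B. a i * ?w powi i)" if "finite B" "{i. a i \<noteq> 0} \<subseteq> B" for a B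
    using that by (intro sum.mono_neutral_left) auto
  have S_add: "?S (\<lambda>i. a i + b i) = ?S a + ?S b" if "a \<in> ?A" "b \<in> ?A" for a b
  proof -
    let ?B = "{i. a i \<noteq> 0} \<union> {i. b i \<noteq> 0}"
    have B: "finite ?B" using that by simp
    have "?S (\<lambda>i. a i + b i) = (\<Sum>i\<in>?B. (a i + b i) * ?w powi i)" by (rule S_superset[OF B]) auto
    also have "\<dots> = (\<Sum>i\<in>?B. a i * ?w powi i) + (\<Sum>i\<in>?B. b i * ?w powi i)"
      by (simp add: distrib_right sum.distrib)
    also have "(\<Sum>i\<in>?B. a i * ?w powi i) = ?S a" by (rule S_superset[OF B, symmetric]) auto
    also have "(\<Sum>i\<in>?B. b i * ?w powi i) = ?S b" by (rule S_superset[OF B, symmetric]) auto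
    finally show ?thesis .
  qed
  have A_add: "(\<lambda>i. a i + b i) \<in> ?A" if "a \<in> ?A" "b \<in> ?A" for a b
  proof -
    have "{i. a i + b i \<noteq> 0} \<subseteq> {i. a i \<noteq> 0} \<union> {i. b i \<noteq> 0}" by auto
    then have "finite {i. a i + b i \<noteq> 0}" using that finite_subset by blast
    then show ?thesis using that U_closed(4) by blast
  qed
  have A_uminus: "(\<lambda>i. - a i) \<in> ?A" if "a \<in> ?A" for a
    using that U_closed(6) by auto
  have S_uminus: "?S (\<lambda>i. - a i) = - ?S a" for a by (simp add: sum_negf)
  have S_zero: "a = (\<lambda>_. 0)" if a: "a \<in> ?A" and 0: "?S a = 0" for a
  proof -
    have "\<forall>i. \<exists>p\<in>lpolys {1..n - 1}. a i = ?ev p" using a unfolding U by blast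
    then obtain p where p: "\<And>i. p i \<in> lpolys {1..n - 1}" "\<And>i. a i = ?ev (p i)" by metis
    let ?e = "\<lambda>i. single n i :: nat \<Rightarrow>\<^sub>0 int"
    define q where "q = (\<Sum>i | a i \<noteq> 0. p i * single (?e i) 1)"
    have e: "keys (?e i) \<subseteq> {1..n}" for i using n3 by simp
    have "?ev q = ?S a"
      unfolding q_def hom_sum[OF is_hom_leval_Y[where Y = "Y_gen :: nat \<Rightarrow> 'k mpoly fract", OF Y_gen_nz]] hom
      by (intro sum.cong refl) (simp add: p(2) leval_single[OF is_hom_fconst] w)
    moreover have "q \<in> lpolys {1..n}"
      unfolding q_def by (intro lpolys_sum lpolys_mult lpolys_single e mono p(1))
    ultimately have "q = 0" using 0 leval_Y_gen_eq_0 by metis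
    have "a i = 0" for i
    proof (rule ccontr)
      assume i: "a i \<noteq> 0"
      have "p i = 0"
      proof (rule poly_mapping_eqI)
        fix m
        show "lookup (p i) m = lookup 0 m"
        proof (cases "m \<in> keys (p i)")
          case True
          \<comment> \<open>The coefficients do not involve index \<open>n\<close>, so only the
            summand with \<open>j = i\<close> can contribute at the exponent
            \<open>m + ?e i\<close>.\<close>
          have not_key: "n \<notin> keys m" if "m \<in> keys (p j)" for m j
            using p(1)[of j] that n3 unfolding lpolys_def by fastforce
          have "lookup (p j) (m + ?e i - ?e j) = 0" if "j \<noteq> i" for j
          proof (rule ccontr)
            assume "lookup (p j) (m + ?e i - ?e j) \<noteq> 0"
            then have "n \<notin> keys (m + ?e i - ?e j)"
              by (intro not_key) (simp add: in_keys_iff)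
            then have "lookup m n + i - j = 0"
              by (simp add: in_keys_iff lookup_add lookup_minus)
            moreover have "lookup m n = 0"
              using not_key[OF True] by (simp add: in_keys_iff)
            ultimately show False using that by simp
          qed
          then have "lookup q (m + ?e i) =
              (\<Sum>j | a j \<noteq> 0. if j = i then lookup (p i) m else 0)"
            unfolding q_def lookup_sum lookup_times_single by (intro sum.cong refl) auto
          also have "\<dots> = lookup (p i) m" using a i by simp
          finally show ?thesis using \<open>q = 0\<close> by simp
        qed (simp add: in_keys_iff)
      qed
      then show False using i p(2)[of i] hom(4) by simp
    qed
    then show ?thesis by blast
  qed
  have "?S a \<in> T_C n" if "a \<in> ?A" for a
  proof -
    have "(\<Sum>i\<in>B. a i * ?w powi i) \<in> T_C n" for B
    proof (induction B rule: infinite_finite_induct)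
      case (insert i B)
      have "a i \<in> T_C n" using that mono unfolding U T by blast
      moreover have "?w powi i \<in> T_C n" unfolding w using n3 by (intro T_closed(7)) auto
      ultimately show ?case using insert by (simp add: T_closed)
    qed (simp_all add: T_closed)
    then show ?thesis .
  qed
  moreover have "\<exists>a\<in>?A. ?S a = x" if x: "x \<in> T_C n" for x
  proof -
    obtain q where q: "q \<in> lpolys {1..n}" "x = ?ev q" using x unfolding T by blast
    have "\<exists>a\<in>?A. ?S a = ?ev q"
    proof (induction q rule: poly_mapping_induct)
      case (single m c)
      \<comment> \<open>\<open>?m\<close> is the part of the exponent free of \<Omega>, and
        \<open>?k\<close> is the power of \<Omega>.\<close>
      let ?m = "m - single n (lookup m n)"
      let ?k = "lookup m n"
      define a where "a i = (if i = ?k then ?ev (single ?m c) else 0)" for i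
      have "keys m \<subseteq> {1..n}" using single q(1) by (auto simp: lpolys_def)
      moreover have "lookup ?m n = 0" by (simp add: lookup_minus)
      moreover have "lookup ?m i = lookup m i" if "i \<noteq> n" for i
        using that by (simp add: lookup_minus lookup_single)
      ultimately have "keys ?m \<subseteq> {1..n} - {n}"
        by (auto simp: in_keys_iff subset_iff) (metis)+
      also have "{1..n} - {n} = {1..n - 1}" by auto
      finally have "?ev (single ?m c) \<in> ?U" unfolding U by (intro imageI lpolys_single)
      moreover have "{i. a i \<noteq> 0} \<subseteq> {?k}" by (auto simp: a_def)
      ultimately have a: "a \<in> ?A" using finite_subset U_closed(2) by (auto simp: a_def)
      have "?S a = a ?k * ?w powi ?k"
        using S_superset[of "{?k}" a] \<open>{i. a i \<noteq> 0} \<subseteq> {?k}\<close> by simp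
      also have "\<dots> = ?ev (single ?m c * single (single n ?k) 1)"
        unfolding hom by (simp add: a_def leval_single[OF is_hom_fconst] w)
      also have "\<dots> = ?ev (single m c)" by (simp add: mult_single)
      finally show ?case using a by (intro bexI[of _ a])
    next
      case zero
      have "(\<lambda>_. 0) \<in> ?A" using U_closed(2) by auto
      then show ?case using hom(4) by (intro bexI[of _ "\<lambda>_. 0"]) simp_all
    next
      case (add q q')
      then obtain a b where "a \<in> ?A" "?S a = ?ev q" "b \<in> ?A" "?S b = ?ev q'" by blast
      then show ?case using S_add[of a b] A_add[of a b] hom(2)
        by (intro bexI[of _ "\<lambda>i. a i + b i"]) simp_all
    qed
    then show ?thesis using q(2) by simp
  qed
  moreover have "inj_on ?S ?A"
  proof (rule inj_onI)
    fix a b assume ab: "a \<in> ?A" "b \<in> ?A" "?S a = ?S b"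
    have "?S (\<lambda>i. a i + - b i) = ?S a + ?S (\<lambda>i. - b i)" by (rule S_add[OF ab(1) A_uminus[OF ab(2)]])
    also have "\<dots> = 0" unfolding S_uminus ab(3) by simp
    finally have "(\<lambda>i. a i + - b i) = (\<lambda>_. 0)"
      by (rule S_zero[OF A_add[OF ab(1) A_uminus[OF ab(2)]]])
    then show "a = b" by (simp add: fun_eq_iff)
  qed
  ultimately show ?thesis
    unfolding laurent_extension_def bij_betw_def by blast
qed

end

theorem proposition7p11:
  fixes n :: nat
  assumes "n \<ge> 3" and "odd n"
  shows
    "(poisson_subalgebra (range (pconst :: 'k::{alg_closed_field, field_char_0} \<Rightarrow> _)) (S_C n) (FC n) \<and>
      polynomial_algebra (pconst :: 'k \<Rightarrow> _) n (ygen n) (S_C n) \<and>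
      log_canonical n \<Lambda> (ygen n :: nat \<Rightarrow> 'k mpoly) (bracket (FC n)) \<and>
      poisson_subalgebra (range fconst) (T_C n :: 'k mpoly fract set) (FracC n) \<and>
      laurent_algebra (fconst :: 'k \<Rightarrow> _) n (\<lambda>i. to_frac (ygen n i)) (T_C n) \<and>
      log_canonical n \<Lambda> (\<lambda>i. to_frac (ygen n i :: 'k mpoly)) (bracket (FracC n)))
     \<and>
     (laurent_extension (U_C n) (to_frac (\<Omega> n :: 'k mpoly)) (T_C n) \<and>
      poisson_subalgebra (range fconst) (U_C n :: 'k mpoly fract set) (FracC n\<lparr>carrier := T_C n\<rparr>) \<and>
      poisson_simple (FracC n\<lparr>carrier := (U_C n :: 'k mpoly fract set)\<rparr>) \<and>
      poisson_central (to_frac (\<Omega> n :: 'k mpoly)) (FracC n\<lparr>carrier := T_C n\<rparr>))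
     \<and>
     {P :: 'k mpoly set. poisson_prime_ideal P (FC n) \<and> P \<noteq> {0} \<and> P \<noteq> carrier (FC n)} =
       {PIdl\<^bsub>FC n\<^esub> (\<Omega> n - pconst l) | l. True} \<union> {M_ideal n 1, M_ideal n (- 1)}
     \<and>
     (\<forall>\<mu> :: 'k. poisson_simple (poisson_quot (FC n) (PIdl\<^bsub>FC n\<^esub> (\<Omega> n - pconst \<mu>)))
        \<longleftrightarrow> \<mu> \<noteq> 2 \<and> \<mu> \<noteq> - 2)"
proof (intro conjI allI)
  let ?Y = "\<lambda>i. to_frac (ygen n i) :: 'k mpoly fract"
  note Y0 = Y_gen_nz[OF assms, where 'k = 'k]
  note T = T_C_laurent_gen[OF assms, where 'k = 'k] and U = U_C_laurent_gen[OF assms, where 'k = 'k]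
  have sub: "{1..n - 1} \<subseteq> {1..n}" by auto
  show "poisson_subalgebra (range (pconst :: 'k \<Rightarrow> _)) (S_C n) (FC n)"
    by (rule poisson_subalgebra_S_C[OF assms])
  show "polynomial_algebra (pconst :: 'k \<Rightarrow> _) n (ygen n) (S_C n)"
    unfolding polynomial_algebra_def poly_carrier_polys bij_betw_def
    using ygen_independent[OF assms] S_C_eq_image[OF assms] by blast
  show "log_canonical n \<Lambda> (ygen n :: nat \<Rightarrow> 'k mpoly) (bracket (FC n))"
    using log_canonical_ygen[OF assms] by simp
  show "poisson_subalgebra (range fconst) (T_C n :: 'k mpoly fract set) (FracC n)"
    unfolding T poisson_subalgebra_def
    using subring_laurent_gen[where Y = ?Y, OF Y0] laurent_gen_closed(1)[where Y = ?Y, OF Y0] Y_gen_bracket_closed[OF assms order_refl]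
    by auto
  show "laurent_algebra (fconst :: 'k \<Rightarrow> _) n ?Y (T_C n)"
    unfolding laurent_algebra_def laurent_carrier_lpolys bij_betw_def T
    using inj_on_leval_Y_gen[OF assms] laurent_gen_eq_image[where Y = ?Y, OF Y0] by blast
  show "log_canonical n \<Lambda> ?Y (bracket (FracC n))"
    using Y_gen_bracket[OF assms] unfolding log_canonical_def FracC_simps by blast
  show "laurent_extension (U_C n) (to_frac (\<Omega> n :: 'k mpoly)) (T_C n)"
    by (rule laurent_extension_U_T[OF assms])
  show "poisson_subalgebra (range fconst) (U_C n :: 'k mpoly fract set) (FracC n\<lparr>carrier := T_C n\<rparr>)"
    unfolding T U poisson_subalgebra_def
    using subring_laurent_gen_mono[where Y = ?Y, OF Y0 sub] laurent_gen_closed(1)[where Y = ?Y, OF Y0]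
      Y_gen_bracket_closed[OF assms sub]
    by auto
  show "poisson_simple (FracC n\<lparr>carrier := (U_C n :: 'k mpoly fract set)\<rparr>)"
    unfolding U using assms sub
    by (intro poisson_simple_laurent_gen[where Y = ?Y, OF Y0] Y_gen_bracket[OF assms]) auto
  show "poisson_central (to_frac (\<Omega> n :: 'k mpoly)) (FracC n\<lparr>carrier := T_C n\<rparr>)"
  proof -
    have w: "to_frac (\<Omega> n) = ?Y n" by (simp add: ygen_def)
    have "?Y n powi 1 \<in> laurent_gen n ?Y {1..n}"
      using assms(1) by (intro laurent_gen_closed(7)[where Y = ?Y, OF Y0]) auto
    moreover have "C_frac_bracket n (?Y n) x = 0" if "x \<in> laurent_gen n ?Y {1..n}" for x
    proof (rule derivation_laurent_gen_eq_0[where Y = ?Y, OF Y0 is_derivation_C_frac_right _ _ that])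
      fix i assume i: "i \<in> {1..n}"
      then have "\<Lambda> n i = 0" using assms(2) by (auto simp: \<Lambda>_def)
      then show "C_frac_bracket n (?Y n) (?Y i) = 0"
        using Y_gen_bracket[OF assms, of n i, where 'k = 'k] i assms(1) by simp
    qed simp
    ultimately show ?thesis unfolding T w poisson_central_def by simp
  qed
  show "{P :: 'k mpoly set. poisson_prime_ideal P (FC n) \<and> P \<noteq> {0} \<and> P \<noteq> carrier (FC n)} =
      {PIdl\<^bsub>FC n\<^esub> (\<Omega> n - pconst l) | l. True} \<union> {M_ideal n 1, M_ideal n (- 1)}"
    by (rule poisson_primes[OF assms])
  show "poisson_simple (poisson_quot (FC n) (PIdl\<^bsub>FC n\<^esub> (\<Omega> n - pconst \<mu>))) \<longleftrightarrow> \<mu> \<noteq> 2 \<and> \<mu> \<noteq> - 2"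
    for \<mu> :: 'k
    by (rule poisson_simple_quotients[OF assms])
qed

end
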